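(* Let $\varphi$ be a minimal counterexample to Vaught's conjecture and let $\lambda\in S^\circ=\mathfrak F\cap C_{5.3}\cap(\mathrm{qr}(\varphi),\omega_1)$. If $M,M'$ are fiber models at $\lambda$ with $\mathrm{trace}(M)=\mathrm{trace}(M')$, then $M\cong M'$. Hence $\mathrm{trace}$ is a complete isomorphism invariant on the fiber at $\lambda$, and the (countable) set $\mathrm{Spec}_\lambda=\{\mathrm{trace}(M):M\text{ a fiber model at }\lambda\}$ enumerates the isomorphism classes of the fiber.
   Context: Structures are countable structures in a countable vocabulary; classes of models are counted up to isomorphism. $\Sigma^{\mathrm{in}}_0=\Pi^{\mathrm{in}}_0$ is the set of finitary quantifier-free formulas; for $\alpha>0$, $\Sigma^{\mathrm{in}}_\alpha$ consists of countable disjunctions of formulas $\exists\bar x\,\psi$ with $\psi\in\Pi^{\mathrm{in}}_\beta$, $\beta<\alpha$, and $\Pi^{\mathrm{in}}_\alpha$ is dual. $M\equiv_\alpha N$: $M,N$ satisfy the same $\Pi^{\mathrm{in}}_\alpha$ (equivalently $\Sigma^{\mathrm{in}}_\alpha$) sentences. A Scott sentence of $M$ is an $L_{\omega_1\omega}$ sentence whose countable models are exactly the copies of $M$. $\mathrm{cSR}(M)$: the least $\alpha$ such that $M$ has a $\Pi^{\mathrm{in}}_{\alpha+1}$ Scott sentence. $\omega_1^A=\min\{\omega_1^X: X\in 2^\omega\text{ computes a copy of }A\}$. $\mathrm{qr}(S)$: the least $\beta$ with $S\in\Pi^{\mathrm{in}}_\beta\cup\Sigma^{\mathrm{in}}_\beta$.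 Standing hypotheses: Vaught's conjecture fails, and $\varphi$ is a minimal counterexample: an $L_{\omega_1\omega}$ sentence with exactly $\aleph_1$ countable models up to isomorphism, scattered (for each $\alpha<\omega_1$ at most countably many $\equiv_\alpha$-classes among its models), and such that for every $L_{\omega_1\omega}$ sentence $\psi$ one of $\varphi\wedge\psi$, $\varphi\wedge\neg\psi$ has only countably many models. Moreover for each $\alpha<\omega_1$ only countably many $\Sigma^{\mathrm{in}}_\alpha$-types are realized in models of $\varphi$. For each $\beta<\omega_1$ exactly one $\equiv_\beta$-class of models of $\varphi$ is uncountable, denoted $\mathcal C_\beta$. $f(\alpha)=\min\{\beta:(\forall M\models\varphi)(M\notin\mathcal C_\alpha\Rightarrow\mathrm{cSR}(M)<\beta)\}$, $\mathfrak F=\{\alpha<\omega_1:f(\alpha)\le\alpha\}$. Sacks rank. A fragment is a countable set of $L_{\omega_1\omega}$ formulas closed under subformulas, substitution and the finitary connectives and quantifiers. For a structure $A$: $L^A_0$ is the finitary language; $T^A_\delta=\mathrm{Th}_{L^A_\delta}(A)$; $L^A_{\delta+1}$ is the least fragment containing $L^A_\delta$ and $\bigwedge p$ for every non-principal complete $L^A_\delta$-type $p$ realized in $A$; unions at limits. $\mathrm{sr}_{\mathrm{Sacks}}(A)$ is the least $\delta$ such that $A$ is the atomic model of $T^A_\delta$. Tree of nodes. $L_0$ is the fragment generated by $\varphi$, and $T$ is $\{\varphi\}$ together with the tautologies of $L_0$. A theory $T'$ in a fragment $L'$ is $\omega$-complete if for each sentence $F\in L'$, $F\in T'$ or $\neg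 F\in T'$, and whenever $\bigvee_iF_i\in T'$, some $F_i\in T'$; it is finitarily consistent if no contradiction is derivable from it by finite-length deductions. Nodes on level $0$: finitarily consistent $\omega$-complete extensions of $T$ in $L_0$. An $n$-type of a node $S$ (in fragment $L_S$) is a maximal set of $L_S(\bar x)$-formulas finitarily consistent with $S$; it is principal if generated over $S$ by one of its formulas. Nodes on level $\delta+1$: finitarily consistent $\omega$-complete extensions of a level-$\delta$ node $S$ in $L'_S$, the least fragment containing $L_S$ and $\bigwedge p$ for each non-principal $n$-type $p$ of $S$. Nodes on limit levels: unions along chains. Every model of a node is a model of $\varphi$. Fixed data, supplied by a theorem of Sacks (Bounds on weak scattering, Prop. 5.2 and Thm. 5.3): an increasing branch $(T_\delta)_{\delta<\omega_1}$ of nodes, $T_\delta$ on level $\delta$, unions at limits, $\Delta_1$ over $L(\omega_1,T)$, such that every $T_\delta$ has an atomic model of $\mathrm{sr}_{\mathrm{Sacks}}$ exactly $\delta$; and a club $C_{5.3}\subseteq\omega_1$ (the ordinals $\omega_1^{L(\beta_\delta,T)}$ for the transitive collapses $L(\beta_\delta,T)$ of the $\Sigma_1$-hulls in Sacks' proof) such that for each $\lambda\in C_{5.3}$: $\lambda>\omega$ and $L(\lambda,T)$ is $\Sigma_1$-admissible; and the set of non-principal $n$-types of $T_\lambda$ is non-empty and countable. For $\lambda\in S^\circ$: $N$ is the set of non-principal $n$-types (all $n\ge1$) of $T_\lambda$. The fiber at $\lambda$ is the class of countable $M$ with $M\models T_\lambda$ and $\omega_1^M=\lambda$; its members are fiber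 models. For a fiber model $M$, $\mathrm{trace}(M)=\{p\in N:M\text{ realizes }p\}$. *)

theory Defs
  imports Complex_Main "HOL-Library.Countable_Set_Type" "HOL-Library.Nat_Bijection"
begin

section \<open>Countable ordinals\<close>

text \<open>The elements of \<open>omega1\<close> are the ordinals below the first uncountable one.\<close>

typedef omega1 = "Field (cardSuc natLeq)"
proof -
  have "\<not> finite (Field (cardSuc natLeq))"
    using cardSuc_finite[OF natLeq_Card_order] by (simp add: Field_natLeq)
  then show "\<exists>x. x \<in> Field (cardSuc natLeq)" by (metis ex_in_conv finite.emptyI)
qed

instantiation omega1 :: wellorder
begin

definition less_eq_omega1 :: "omega1 \<Rightarrow> omega1 \<Rightarrow> bool" where
  "a \<le> b \<longleftrightarrow> (Rep_omega1 a, Rep_omega1 b) \<in> cardSuc natLeq"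

definition less_omega1 :: "omega1 \<Rightarrow> omega1 \<Rightarrow> bool" where
  "(a :: omega1) < b \<longleftrightarrow> a \<le> b \<and> \<not> b \<le> a"

instance
proof -
  have wo: "Well_order (cardSuc natLeq)"
    using cardSuc_Card_order[OF natLeq_Card_order] card_order_on_well_order_on by blast
  have lin: "linear_order_on (Field (cardSuc natLeq)) (cardSuc natLeq)"
    using wo by (simp add: well_order_on_def)
  have r: "refl_on (Field (cardSuc natLeq)) (cardSuc natLeq)" and t: "trans (cardSuc natLeq)"
    and as: "antisym (cardSuc natLeq)" and tot: "total_on (Field (cardSuc natLeq)) (cardSuc natLeq)"
    using lin by (auto simp: linear_order_on_def partial_order_on_def preorder_on_def)
  have wf: "wf (cardSuc natLeq - Id)" using wo by (simp add: well_order_on_def)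
  show "OFCLASS(omega1, wellorder_class)"
  proof
    fix x y z :: omega1
    show "(x < y) = (x \<le> y \<and> \<not> y \<le> x)" by (simp add: less_omega1_def)
    show "x \<le> x" unfolding less_eq_omega1_def using r Rep_omega1 by (auto simp: refl_on_def)
    show "x \<le> y \<Longrightarrow> y \<le> z \<Longrightarrow> x \<le> z" unfolding less_eq_omega1_def using t by (rule transD)
    show "x \<le> y \<Longrightarrow> y \<le> x \<Longrightarrow> x = y" unfolding less_eq_omega1_def
      by (simp add: antisymD[OF as] flip: Rep_omega1_inject)
    show "x \<le> y \<or> y \<le> x"
    proof (cases "x = y")
      case True
      then show ?thesis using refl_onD[OF r Rep_omega1[of y]] by (simp add: less_eq_omega1_def)
    next
      case False
      then have "Rep_omega1 x \<noteq> Rep_omega1 y" by (simp add: Rep_omega1_inject)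
      then show ?thesis
        using tot Rep_omega1[of x] Rep_omega1[of y] unfolding total_on_def less_eq_omega1_def by blast
    qed
  next
    fix P :: "omega1 \<Rightarrow> bool" and a
    assume step: "\<And>x. (\<And>y. y < x \<Longrightarrow> P y) \<Longrightarrow> P x"
    have "wf (inv_image (cardSuc natLeq - Id) Rep_omega1)" using wf by (rule wf_inv_image)
    then show "P a"
    proof (induction a rule: wf_induct_rule)
      case (less x)
      show ?case
      proof (rule step)
        fix y assume "y < x"
        then have "(y, x) \<in> inv_image (cardSuc natLeq - Id) Rep_omega1"
          by (auto simp: less_omega1_def less_eq_omega1_def inv_image_def)
        then show "P y" by (rule less)
      qed
    qed
  qed
qed

end

instantiation omega1 :: zero
begin
definition zero_omega1 :: omega1 where "0 = (LEAST a :: omega1. True)"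
instance ..
end

definition osuc :: "omega1 \<Rightarrow> omega1" where
  "osuc a = (LEAST b. a < b)"

definition islim :: "omega1 \<Rightarrow> bool" where
  "islim a \<longleftrightarrow> a \<noteq> 0 \<and> (\<forall>b. a \<noteq> osuc b)"

definition om :: omega1 where
  "om = (LEAST a. infinite {..<a})"

lemma countable_below_omega1: "countable {..<a :: omega1}"
proof -
  let ?r = "cardSuc natLeq"
  have co: "Card_order ?r" using cardSuc_Card_order[OF natLeq_Card_order] .
  have inj: "inj_on Rep_omega1 {..<a}" by (meson Rep_omega1_inject inj_onI)
  have sub: "Rep_omega1 ` {..<a} \<subseteq> underS ?r (Rep_omega1 a)"
    by (auto simp: underS_def less_omega1_def less_eq_omega1_def)
  have "(card_of (underS ?r (Rep_omega1 a)), ?r) \<in> ordLess"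
    using card_of_underS[OF co Rep_omega1] .
  then have "(card_of (underS ?r (Rep_omega1 a)), natLeq) \<in> ordLeq"
    using cardSuc_ordLeq_ordLess[OF natLeq_Card_order card_of_Card_order]
    by blast
  then have "(card_of (underS ?r (Rep_omega1 a)), card_of (UNIV :: nat set)) \<in> ordLeq"
    by (meson card_of_nat ordIso_symmetric ordLeq_ordIso_trans)
  then have "countable (underS ?r (Rep_omega1 a))"
    by (metis card_of_ordLeq countableI)
  then show ?thesis by (meson countable_image_inj_on countable_subset inj sub)
qed

lemma uncountable_omega1: "uncountable (UNIV :: omega1 set)"
proof
  assume "countable (UNIV :: omega1 set)"
  then have "countable (range Rep_omega1)" by blast
  then have "countable (Field (cardSuc natLeq))"
    using type_definition.Rep_range[OF type_definition_omega1] by simp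
  then have "(card_of (Field (cardSuc natLeq)), card_of (UNIV :: nat set)) \<in> ordLeq"
    unfolding countable_def using card_of_ordLeq by blast
  moreover have "(card_of (Field (cardSuc natLeq)), cardSuc natLeq) \<in> ordIso"
    using cardSuc_Card_order[OF natLeq_Card_order] card_of_Field_ordIso by blast
  ultimately have "(cardSuc natLeq, natLeq) \<in> ordLeq"
    by (meson card_of_nat ordIso_symmetric ordIso_ordLeq_trans ordLeq_ordIso_trans)
  moreover have "(natLeq, cardSuc natLeq) \<in> ordLess"
    using cardSuc_greater[OF natLeq_Card_order] .
  ultimately show False using not_ordLess_ordLeq by blast
qed

lemma osuc_greater: "a < osuc a"
proof -
  have "\<exists>b. a < b"
  proof (rule ccontr)
    assume "\<not> ?thesis"
    then have "x \<in> insert a {..<a}" for x using linorder_less_linear[of x a] by auto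
    then have "UNIV \<subseteq> insert a {..<a}" by (intro subsetI)
    then show False
      using uncountable_omega1 countable_subset[OF _ countable_insert[OF countable_below_omega1]]
      by simp
  qed
  then show ?thesis unfolding osuc_def by (rule LeastI_ex)
qed

lemma osuc_inject: "osuc a = osuc b \<longleftrightarrow> a = b"
proof -
  have "x < y \<Longrightarrow> osuc x \<le> y" for x y unfolding osuc_def by (rule Least_le)
  from this[of a b] this[of b a] show ?thesis
    using osuc_greater[of a] osuc_greater[of b] linorder_less_linear[of a b] by fastforce
qed

lemma zero_le_omega1: "(0 :: omega1) \<le> a"
  unfolding zero_omega1_def by (rule Least_le) simp

lemma osuc_nonzero: "osuc a \<noteq> 0"
  using osuc_greater[of a] zero_le_omega1[of a] by auto

text \<open>Transfinite iteration of a set operator, with unions at limits.\<close>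

function ord_iter :: "'a set \<Rightarrow> ('a set \<Rightarrow> 'a set) \<Rightarrow> omega1 \<Rightarrow> 'a set" where
  "ord_iter Z F a =
     (if a = 0 then Z
      else if \<exists>b. a = osuc b then \<Union> ((\<lambda>b. F (ord_iter Z F b)) ` {b. a = osuc b})
      else \<Union> (ord_iter Z F ` {..<a}))"
  by pat_completeness auto
termination
  by (relation "inv_image {(a, b). a < b} (\<lambda>(_, _, a). a)")
     (auto simp: wf wf_inv_image osuc_greater)

declare ord_iter.simps [simp del]

lemma ord_iter_zero: "ord_iter Z F 0 = Z"
  by (subst ord_iter.simps) simp

lemma ord_iter_osuc: "ord_iter Z F (osuc a) = F (ord_iter Z F a)"
proof -
  have "{b. osuc a = osuc b} = {a}" by (auto simp: osuc_inject)
  then show ?thesis by (subst ord_iter.simps) (auto simp: osuc_nonzero)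
qed

lemma ord_iter_lim: "islim a \<Longrightarrow> ord_iter Z F a = (\<Union>b<a. ord_iter Z F b)"
  unfolding islim_def by (subst ord_iter.simps) auto

definition club :: "omega1 set \<Rightarrow> bool" where
  "club C \<longleftrightarrow> (\<forall>a. \<exists>c\<in>C. a < c) \<and>
     (\<forall>a. islim a \<and> (\<forall>b<a. \<exists>c\<in>C. b < c \<and> c < a) \<longrightarrow> a \<in> C)"


section \<open>Infinitary formulas and countable structures\<close>

text \<open>Symbols of a countable vocabulary are natural numbers; the partial functions below give
  the arity of those that belong to the vocabulary.\<close>

record vocab =
  relar :: "nat \<Rightarrow> nat option"
  funar :: "nat \<Rightarrow> nat option"

datatype tm = Var nat | Fn nat "tm list"

text \<open>De Bruijn indices: a quantifier binds the variable 0 of its body.\<close>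

datatype fm =
    Eq tm tm
  | Rel nat "tm list"
  | Neg fm
  | CConj "fm cset"
  | CDisj "fm cset"
  | Ex fm
  | All fm

definition And :: "fm \<Rightarrow> fm \<Rightarrow> fm" where
  "And \<phi> \<psi> = CConj (acset {\<phi>, \<psi>})"

primrec wf_tm :: "vocab \<Rightarrow> tm \<Rightarrow> bool" where
  "wf_tm V (Var i) = True"
| "wf_tm V (Fn f ts) = (funar V f = Some (length ts) \<and> list_all (wf_tm V) ts)"

primrec fv_tm :: "tm \<Rightarrow> nat set" where
  "fv_tm (Var i) = {i}"
| "fv_tm (Fn f ts) = \<Union> (set (map fv_tm ts))"

primrec subst_tm :: "(nat \<Rightarrow> tm) \<Rightarrow> tm \<Rightarrow> tm" where
  "subst_tm \<sigma> (Var i) = \<sigma> i"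
| "subst_tm \<sigma> (Fn f ts) = Fn f (map (subst_tm \<sigma>) ts)"

primrec wf_shape :: "vocab \<Rightarrow> fm \<Rightarrow> bool" where
  "wf_shape V (Eq s t) = (wf_tm V s \<and> wf_tm V t)"
| "wf_shape V (Rel r ts) = (relar V r = Some (length ts) \<and> list_all (wf_tm V) ts)"
| "wf_shape V (Neg \<phi>) = wf_shape V \<phi>"
| "wf_shape V (CConj F) = (False \<notin> rcset (cimage (wf_shape V) F))"
| "wf_shape V (CDisj F) = (False \<notin> rcset (cimage (wf_shape V) F))"
| "wf_shape V (Ex \<phi>) = wf_shape V \<phi>"
| "wf_shape V (All \<phi>) = wf_shape V \<phi>"

primrec fv :: "fm \<Rightarrow> nat set" where
  "fv (Eq s t) = fv_tm s \<union> fv_tm t"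
| "fv (Rel r ts) = \<Union> (set (map fv_tm ts))"
| "fv (Neg \<phi>) = fv \<phi>"
| "fv (CConj F) = \<Union> (rcset (cimage fv F))"
| "fv (CDisj F) = \<Union> (rcset (cimage fv F))"
| "fv (Ex \<phi>) = {i. Suc i \<in> fv \<phi>}"
| "fv (All \<phi>) = {i. Suc i \<in> fv \<phi>}"

definition wf_fm :: "vocab \<Rightarrow> fm \<Rightarrow> bool" where
  "wf_fm V \<phi> \<longleftrightarrow> wf_shape V \<phi> \<and> finite (fv \<phi>)"

definition sentence :: "vocab \<Rightarrow> fm \<Rightarrow> bool" where
  "sentence V \<phi> \<longleftrightarrow> wf_fm V \<phi> \<and> fv \<phi> = {}"

definition up :: "(nat \<Rightarrow> tm) \<Rightarrow> nat \<Rightarrow> tm" where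
  "up \<sigma> = case_nat (Var 0) (\<lambda>i. subst_tm (\<lambda>j. Var (Suc j)) (\<sigma> i))"

primrec subst :: "fm \<Rightarrow> (nat \<Rightarrow> tm) \<Rightarrow> fm" where
  "subst (Eq s t) \<sigma> = Eq (subst_tm \<sigma> s) (subst_tm \<sigma> t)"
| "subst (Rel r ts) \<sigma> = Rel r (map (subst_tm \<sigma>) ts)"
| "subst (Neg \<phi>) \<sigma> = Neg (subst \<phi> \<sigma>)"
| "subst (CConj F) \<sigma> = CConj (cimage (\<lambda>\<phi>. subst \<phi> \<sigma>) F)"
| "subst (CDisj F) \<sigma> = CDisj (cimage (\<lambda>\<phi>. subst \<phi> \<sigma>) F)"
| "subst (Ex \<phi>) \<sigma> = Ex (subst \<phi> (up \<sigma>))"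
| "subst (All \<phi>) \<sigma> = All (subst \<phi> (up \<sigma>))"

definition lift_fm :: "fm \<Rightarrow> fm" where
  "lift_fm \<phi> = subst \<phi> (\<lambda>i. Var (Suc i))"

definition inst :: "fm \<Rightarrow> tm \<Rightarrow> fm" where
  "inst \<phi> t = subst \<phi> (case_nat t Var)"

text \<open>Up to isomorphism a countable structure has a non-empty set of natural numbers
  as its universe.\<close>

record struct =
  univ :: "nat set"
  irel :: "nat \<Rightarrow> nat list \<Rightarrow> bool"
  ifun :: "nat \<Rightarrow> nat list \<Rightarrow> nat"

definition structure_of :: "vocab \<Rightarrow> struct \<Rightarrow> bool" where
  "structure_of V M \<longleftrightarrow> univ M \<noteq> {} \<and>
     (\<forall>f xs. funar V f = Some (length xs) \<and> set xs \<subseteq> univ M \<longrightarrow> ifun M f xs \<in> univ M)"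

primrec val :: "struct \<Rightarrow> (nat \<Rightarrow> nat) \<Rightarrow> tm \<Rightarrow> nat" where
  "val M e (Var i) = e i"
| "val M e (Fn f ts) = ifun M f (map (val M e) ts)"

primrec sat :: "struct \<Rightarrow> fm \<Rightarrow> (nat \<Rightarrow> nat) \<Rightarrow> bool" where
  "sat M (Eq s t) e = (val M e s = val M e t)"
| "sat M (Rel r ts) e = irel M r (map (val M e) ts)"
| "sat M (Neg \<phi>) e = (\<not> sat M \<phi> e)"
| "sat M (CConj F) e = (False \<notin> rcset (cimage (\<lambda>\<phi>. sat M \<phi> e) F))"
| "sat M (CDisj F) e = (True \<in> rcset (cimage (\<lambda>\<phi>. sat M \<phi> e) F))"
| "sat M (Ex \<phi>) e = (\<exists>x\<in>univ M. sat M \<phi> (case_nat x e))"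
| "sat M (All \<phi>) e = (\<forall>x\<in>univ M. sat M \<phi> (case_nat x e))"

lemma sat_CConj: "sat M (CConj F) e \<longleftrightarrow> (\<forall>\<phi>\<in>rcset F. sat M \<phi> e)"
  by (auto simp: cimage.rep_eq)

lemma sat_CDisj: "sat M (CDisj F) e \<longleftrightarrow> (\<exists>\<phi>\<in>rcset F. sat M \<phi> e)"
  by (auto simp: cimage.rep_eq)

lemma wf_shape_CConj: "wf_shape V (CConj F) \<longleftrightarrow> (\<forall>\<phi>\<in>rcset F. wf_shape V \<phi>)"
  by (auto simp: cimage.rep_eq)

lemma wf_shape_CDisj: "wf_shape V (CDisj F) \<longleftrightarrow> (\<forall>\<phi>\<in>rcset F. wf_shape V \<phi>)"
  by (auto simp: cimage.rep_eq)

definition assignment :: "struct \<Rightarrow> (nat \<Rightarrow> nat) \<Rightarrow> bool" where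
  "assignment M e \<longleftrightarrow> range e \<subseteq> univ M"

definition holds :: "struct \<Rightarrow> fm \<Rightarrow> bool" where
  "holds M \<phi> \<longleftrightarrow> (\<forall>e. assignment M e \<longrightarrow> sat M \<phi> e)"

definition isomorphic :: "vocab \<Rightarrow> struct \<Rightarrow> struct \<Rightarrow> bool" where
  "isomorphic V M N \<longleftrightarrow> (\<exists>h. bij_betw h (univ M) (univ N) \<and>
     (\<forall>r xs. relar V r = Some (length xs) \<and> set xs \<subseteq> univ M \<longrightarrow>
        irel M r xs = irel N r (map h xs)) \<and>
     (\<forall>f xs. funar V f = Some (length xs) \<and> set xs \<subseteq> univ M \<longrightarrow>
        h (ifun M f xs) = ifun N f (map h xs)))"

definition models :: "vocab \<Rightarrow> fm \<Rightarrow> struct set" where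
  "models V \<phi> = {M. structure_of V M \<and> holds M \<phi>}"

definition iso_types :: "vocab \<Rightarrow> struct set \<Rightarrow> struct set set" where
  "iso_types V K = K // {(M, N). M \<in> K \<and> N \<in> K \<and> isomorphic V M N}"

abbreviation few :: "vocab \<Rightarrow> struct set \<Rightarrow> bool" where
  "few V K \<equiv> countable (iso_types V K)"


section \<open>Complexity of formulas, Scott rank, minimal counterexamples\<close>

inductive fin_qf :: "fm \<Rightarrow> bool" where
  "fin_qf (Eq s t)"
| "fin_qf (Rel r ts)"
| "fin_qf \<phi> \<Longrightarrow> fin_qf (Neg \<phi>)"
| "finite (rcset F) \<Longrightarrow> (\<And>\<phi>. \<phi> \<in> rcset F \<Longrightarrow> fin_qf \<phi>) \<Longrightarrow> fin_qf (CConj F)"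
| "finite (rcset F) \<Longrightarrow> (\<And>\<phi>. \<phi> \<in> rcset F \<Longrightarrow> fin_qf \<phi>) \<Longrightarrow> fin_qf (CDisj F)"

inductive Sigma_in :: "omega1 \<Rightarrow> fm \<Rightarrow> bool" and Pi_in :: "omega1 \<Rightarrow> fm \<Rightarrow> bool" where
  "fin_qf \<phi> \<Longrightarrow> Sigma_in 0 \<phi>"
| "fin_qf \<phi> \<Longrightarrow> Pi_in 0 \<phi>"
| "0 < \<alpha> \<Longrightarrow> (\<And>\<chi>. \<chi> \<in> rcset F \<Longrightarrow> \<exists>k \<beta> \<psi>. \<beta> < \<alpha> \<and> Pi_in \<beta> \<psi> \<and> \<chi> = (Ex ^^ k) \<psi>)
    \<Longrightarrow> Sigma_in \<alpha> (CDisj F)"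
| "0 < \<alpha> \<Longrightarrow> (\<And>\<chi>. \<chi> \<in> rcset F \<Longrightarrow> \<exists>k \<beta> \<psi>. \<beta> < \<alpha> \<and> Sigma_in \<beta> \<psi> \<and> \<chi> = (All ^^ k) \<psi>)
    \<Longrightarrow> Pi_in \<alpha> (CConj F)"

definition equiv_in :: "vocab \<Rightarrow> omega1 \<Rightarrow> struct \<Rightarrow> struct \<Rightarrow> bool" where
  "equiv_in V \<alpha> M N \<longleftrightarrow> (\<forall>\<sigma>. sentence V \<sigma> \<and> Pi_in \<alpha> \<sigma> \<longrightarrow> holds M \<sigma> = holds N \<sigma>)"

definition Sigma_type :: "vocab \<Rightarrow> omega1 \<Rightarrow> struct \<Rightarrow> nat \<Rightarrow> (nat \<Rightarrow> nat) \<Rightarrow> fm set" where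
  "Sigma_type V \<alpha> M n e =
     {\<psi>. wf_fm V \<psi> \<and> Sigma_in \<alpha> \<psi> \<and> fv \<psi> \<subseteq> {..<n} \<and> sat M \<psi> e}"

definition scott_sentence :: "vocab \<Rightarrow> struct \<Rightarrow> fm \<Rightarrow> bool" where
  "scott_sentence V M \<sigma> \<longleftrightarrow> sentence V \<sigma> \<and>
     (\<forall>N. structure_of V N \<longrightarrow> (holds N \<sigma> \<longleftrightarrow> isomorphic V M N))"

definition cSR :: "vocab \<Rightarrow> struct \<Rightarrow> omega1" where
  "cSR V M = (LEAST \<alpha>. \<exists>\<sigma>. scott_sentence V M \<sigma> \<and> Pi_in (osuc \<alpha>) \<sigma>)"

text \<open>Membership in the complexity classes is understood up to logical equivalence;
  an arbitrary sentence need not have the shape required by \<open>Sigma_in\<close> or \<open>Pi_in\<close>.\<close>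

definition qr :: "vocab \<Rightarrow> fm \<Rightarrow> omega1" where
  "qr V \<phi> = (LEAST \<beta>. \<exists>\<sigma>. sentence V \<sigma> \<and> (Pi_in \<beta> \<sigma> \<or> Sigma_in \<beta> \<sigma>) \<and>
     (\<forall>M. structure_of V M \<longrightarrow> holds M \<sigma> = holds M \<phi>))"

definition equiv_class :: "vocab \<Rightarrow> fm \<Rightarrow> omega1 \<Rightarrow> struct \<Rightarrow> struct set" where
  "equiv_class V \<phi> \<beta> M = {N \<in> models V \<phi>. equiv_in V \<beta> M N}"

definition minimal_counterexample :: "vocab \<Rightarrow> fm \<Rightarrow> bool" where
  "minimal_counterexample V \<phi> \<longleftrightarrow>
     sentence V \<phi> \<and>
     (card_of (iso_types V (models V \<phi>)), cardSuc natLeq) \<in> ordIso \<and>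
     (\<forall>\<alpha>. countable (equiv_class V \<phi> \<alpha> ` models V \<phi>)) \<and>
     (\<forall>\<psi>. sentence V \<psi> \<longrightarrow>
        few V (models V (And \<phi> \<psi>)) \<or> few V (models V (And \<phi> (Neg \<psi>)))) \<and>
     (\<forall>\<alpha>. countable {Sigma_type V \<alpha> M n e | M n e. M \<in> models V \<phi> \<and> assignment M e}) \<and>
     (\<forall>\<beta>. \<exists>!K. K \<in> equiv_class V \<phi> \<beta> ` models V \<phi> \<and> \<not> few V K)"

definition big_class :: "vocab \<Rightarrow> fm \<Rightarrow> omega1 \<Rightarrow> struct set" where
  "big_class V \<phi> \<beta> = (THE K. K \<in> equiv_class V \<phi> \<beta> ` models V \<phi> \<and> \<not> few V K)"

definition rank_bound :: "vocab \<Rightarrow> fm \<Rightarrow> omega1 \<Rightarrow> omega1" where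
  "rank_bound V \<phi> \<alpha> =
     (LEAST \<beta>. \<forall>M\<in>models V \<phi>. M \<notin> big_class V \<phi> \<alpha> \<longrightarrow> cSR V M < \<beta>)"

definition frakF :: "vocab \<Rightarrow> fm \<Rightarrow> omega1 set" where
  "frakF V \<phi> = {\<alpha>. rank_bound V \<phi> \<alpha> \<le> \<alpha>}"


section \<open>Relative computability\<close>

datatype rf = Zero | Succ | Proj nat | Oracle | Comp rf "rf list" | PrimRec rf rf | Mu rf

text \<open>\<open>reval X f xs y\<close>: the partial function with code \<open>f\<close>, recursive in \<open>X\<close>,
  is defined at \<open>xs\<close> with value \<open>y\<close>.\<close>

inductive reval :: "nat set \<Rightarrow> rf \<Rightarrow> nat list \<Rightarrow> nat \<Rightarrow> bool" for X where
  "reval X Zero xs 0"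
| "reval X Succ (x # xs) (Suc x)"
| "i < length xs \<Longrightarrow> reval X (Proj i) xs (xs ! i)"
| "reval X Oracle (x # xs) (if x \<in> X then 1 else 0)"
| "length ys = length gs \<Longrightarrow> (\<And>i. i < length gs \<Longrightarrow> reval X (gs ! i) xs (ys ! i)) \<Longrightarrow>
     reval X f ys z \<Longrightarrow> reval X (Comp f gs) xs z"
| "reval X f xs y \<Longrightarrow> reval X (PrimRec f g) (0 # xs) y"
| "reval X (PrimRec f g) (n # xs) y \<Longrightarrow> reval X g (n # y # xs) z \<Longrightarrow>
     reval X (PrimRec f g) (Suc n # xs) z"
| "reval X f (m # xs) 0 \<Longrightarrow> (\<And>k. k < m \<Longrightarrow> \<exists>v>0. reval X f (k # xs) v) \<Longrightarrow>
     reval X (Mu f) xs m"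

definition computes :: "nat set \<Rightarrow> nat set \<Rightarrow> bool" where
  "computes X Y \<longleftrightarrow> (\<exists>f. \<forall>n. reval X f [n] (if n \<in> Y then 1 else 0))"

definition omega1_CK :: "nat set \<Rightarrow> omega1" where
  "omega1_CK X = (LEAST \<alpha>. \<not> (\<exists>R. Well_order R \<and> computes X (prod_encode ` R) \<and>
     (R, {(a, b). a \<le> b \<and> b < \<alpha>}) \<in> ordIso))"

text \<open>Atomic diagram; functions are represented by their graphs.\<close>

definition diagram :: "vocab \<Rightarrow> struct \<Rightarrow> nat set" where
  "diagram V B =
     {prod_encode (0, x) | x. x \<in> univ B} \<union>
     {prod_encode (1, prod_encode (r, list_encode xs)) | r xs.
        relar V r = Some (length xs) \<and> set xs \<subseteq> univ B \<and> irel B r xs} \<union>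
     {prod_encode (2, prod_encode (f, list_encode (ifun B f xs # xs))) | f xs.
        funar V f = Some (length xs) \<and> set xs \<subseteq> univ B}"

definition omega1_of :: "vocab \<Rightarrow> struct \<Rightarrow> omega1" where
  "omega1_of V A = (LEAST \<alpha>. \<exists>X B. structure_of V B \<and> isomorphic V A B \<and>
     computes X (diagram V B) \<and> omega1_CK X = \<alpha>)"


section \<open>Fragments, types, Sacks rank\<close>

text \<open>A fragment contains all atomic formulas, hence all finitary formulas of the vocabulary.
  The equivalences combine closure under a connective with closure under subformulas.\<close>

definition fragment_closed :: "vocab \<Rightarrow> fm set \<Rightarrow> bool" where
  "fragment_closed V L \<longleftrightarrow>
     (\<forall>\<phi>\<in>L. wf_fm V \<phi>) \<and>
     (\<forall>s t. wf_fm V (Eq s t) \<longrightarrow> Eq s t \<in> L) \<and>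
     (\<forall>r ts. wf_fm V (Rel r ts) \<longrightarrow> Rel r ts \<in> L) \<and>
     (\<forall>\<phi>. Neg \<phi> \<in> L \<longleftrightarrow> \<phi> \<in> L) \<and>
     (\<forall>\<phi>. Ex \<phi> \<in> L \<longleftrightarrow> \<phi> \<in> L) \<and>
     (\<forall>\<phi>. All \<phi> \<in> L \<longleftrightarrow> \<phi> \<in> L) \<and>
     (\<forall>F. CConj F \<in> L \<or> CDisj F \<in> L \<longrightarrow> rcset F \<subseteq> L) \<and>
     (\<forall>F. finite (rcset F) \<and> rcset F \<subseteq> L \<longrightarrow> CConj F \<in> L \<and> CDisj F \<in> L) \<and>
     (\<forall>\<phi>\<in>L. \<forall>\<sigma>. (\<forall>i. wf_tm V (\<sigma> i)) \<longrightarrow> subst \<phi> \<sigma> \<in> L)"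

definition is_fragment :: "vocab \<Rightarrow> fm set \<Rightarrow> bool" where
  "is_fragment V L \<longleftrightarrow> countable L \<and> fragment_closed V L"

definition frag_gen :: "vocab \<Rightarrow> fm set \<Rightarrow> fm set" where
  "frag_gen V X = \<Inter> {L. fragment_closed V L \<and> X \<subseteq> L}"

definition sentences :: "fm set \<Rightarrow> fm set" where
  "sentences L = {\<sigma> \<in> L. fv \<sigma> = {}}"

definition formulas_in :: "fm set \<Rightarrow> nat \<Rightarrow> fm set" where
  "formulas_in L n = {\<psi> \<in> L. fv \<psi> \<subseteq> {..<n}}"

text \<open>Finite-length deductions from a set of formulas: natural deduction in which the rules with
  one premise per member of a conjunction or disjunction are restricted to finite ones.
  Free variables of the assumptions behave like constants.\<close>

inductive fderiv :: "vocab \<Rightarrow> fm set \<Rightarrow> fm \<Rightarrow> bool" for V where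
  assm: "\<phi> \<in> \<Gamma> \<Longrightarrow> fderiv V \<Gamma> \<phi>"
| negI: "fderiv V (insert \<phi> \<Gamma>) \<psi> \<Longrightarrow> fderiv V (insert \<phi> \<Gamma>) (Neg \<psi>) \<Longrightarrow> fderiv V \<Gamma> (Neg \<phi>)"
| contr: "fderiv V (insert (Neg \<phi>) \<Gamma>) \<psi> \<Longrightarrow> fderiv V (insert (Neg \<phi>) \<Gamma>) (Neg \<psi>) \<Longrightarrow> fderiv V \<Gamma> \<phi>"
| conjE: "fderiv V \<Gamma> (CConj F) \<Longrightarrow> \<phi> \<in> rcset F \<Longrightarrow> fderiv V \<Gamma> \<phi>"
| conjI: "finite (rcset F) \<Longrightarrow> (\<And>\<phi>. \<phi> \<in> rcset F \<Longrightarrow> fderiv V \<Gamma> \<phi>) \<Longrightarrow> fderiv V \<Gamma> (CConj F)"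
| disjI: "fderiv V \<Gamma> \<phi> \<Longrightarrow> \<phi> \<in> rcset F \<Longrightarrow> fderiv V \<Gamma> (CDisj F)"
| disjE: "finite (rcset F) \<Longrightarrow> fderiv V \<Gamma> (CDisj F) \<Longrightarrow>
    (\<And>\<phi>. \<phi> \<in> rcset F \<Longrightarrow> fderiv V (insert \<phi> \<Gamma>) \<chi>) \<Longrightarrow> fderiv V \<Gamma> \<chi>"
| neg_conj: "fderiv V \<Gamma> (Neg (CConj F)) \<Longrightarrow> fderiv V \<Gamma> (CDisj (cimage Neg F))"
| disj_neg: "fderiv V \<Gamma> (CDisj (cimage Neg F)) \<Longrightarrow> fderiv V \<Gamma> (Neg (CConj F))"
| neg_disj: "fderiv V \<Gamma> (Neg (CDisj F)) \<Longrightarrow> fderiv V \<Gamma> (CConj (cimage Neg F))"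
| conj_neg: "fderiv V \<Gamma> (CConj (cimage Neg F)) \<Longrightarrow> fderiv V \<Gamma> (Neg (CDisj F))"
| allI: "fderiv V (lift_fm ` \<Gamma>) \<phi> \<Longrightarrow> fderiv V \<Gamma> (All \<phi>)"
| allE: "fderiv V \<Gamma> (All \<phi>) \<Longrightarrow> wf_tm V t \<Longrightarrow> fderiv V \<Gamma> (inst \<phi> t)"
| exI: "fderiv V \<Gamma> (inst \<phi> t) \<Longrightarrow> wf_tm V t \<Longrightarrow> fderiv V \<Gamma> (Ex \<phi>)"
| exE: "fderiv V \<Gamma> (Ex \<phi>) \<Longrightarrow> fderiv V (insert \<phi> (lift_fm ` \<Gamma>)) (lift_fm \<chi>) \<Longrightarrow> fderiv V \<Gamma> \<chi>"
| eq_refl: "fderiv V \<Gamma> (Eq t t)"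
| eq_subst: "fderiv V \<Gamma> (Eq s t) \<Longrightarrow> fderiv V \<Gamma> (inst \<phi> s) \<Longrightarrow> fderiv V \<Gamma> (inst \<phi> t)"

definition fin_consistent :: "vocab \<Rightarrow> fm set \<Rightarrow> bool" where
  "fin_consistent V \<Gamma> \<longleftrightarrow> \<not> (\<exists>\<psi>. fderiv V \<Gamma> \<psi> \<and> fderiv V \<Gamma> (Neg \<psi>))"

definition omega_complete :: "fm set \<Rightarrow> fm set \<Rightarrow> bool" where
  "omega_complete L S \<longleftrightarrow> S \<subseteq> sentences L \<and>
     (\<forall>\<sigma>\<in>sentences L. \<sigma> \<in> S \<or> Neg \<sigma> \<in> S) \<and>
     (\<forall>F. CDisj F \<in> S \<longrightarrow> (\<exists>\<sigma>\<in>rcset F. \<sigma> \<in> S))"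

definition is_type :: "vocab \<Rightarrow> fm set \<Rightarrow> fm set \<Rightarrow> nat \<Rightarrow> fm set \<Rightarrow> bool" where
  "is_type V L S n p \<longleftrightarrow> p \<subseteq> formulas_in L n \<and> fin_consistent V (S \<union> p) \<and>
     (\<forall>q. p \<subseteq> q \<and> q \<subseteq> formulas_in L n \<and> fin_consistent V (S \<union> q) \<longrightarrow> q = p)"

definition principal :: "vocab \<Rightarrow> fm set \<Rightarrow> fm set \<Rightarrow> bool" where
  "principal V S p \<longleftrightarrow> (\<exists>\<psi>\<in>p. \<forall>\<chi>\<in>p. fderiv V (insert \<psi> S) \<chi>)"

definition tp :: "fm set \<Rightarrow> struct \<Rightarrow> nat \<Rightarrow> (nat \<Rightarrow> nat) \<Rightarrow> fm set" where
  "tp L A n e = {\<psi> \<in> formulas_in L n. sat A \<psi> e}"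

definition Th :: "fm set \<Rightarrow> struct \<Rightarrow> fm set" where
  "Th L A = {\<sigma> \<in> sentences L. holds A \<sigma>}"

definition model_of :: "vocab \<Rightarrow> fm set \<Rightarrow> struct \<Rightarrow> bool" where
  "model_of V S M \<longleftrightarrow> structure_of V M \<and> (\<forall>\<sigma>\<in>S. holds M \<sigma>)"

definition atomic_model :: "vocab \<Rightarrow> fm set \<Rightarrow> fm set \<Rightarrow> struct \<Rightarrow> bool" where
  "atomic_model V L S A \<longleftrightarrow> model_of V S A \<and>
     (\<forall>n e. assignment A e \<longrightarrow> principal V S (tp L A n e))"

text \<open>The fragments attached to a structure; \<open>frag_gen V {}\<close> is the finitary language.\<close>

definition LA :: "vocab \<Rightarrow> struct \<Rightarrow> omega1 \<Rightarrow> fm set" where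
  "LA V A = ord_iter (frag_gen V {})
     (\<lambda>L. frag_gen V (L \<union> {CConj (acset (tp L A n e)) | n e.
        assignment A e \<and> \<not> principal V (Th L A) (tp L A n e)}))"

definition sr_Sacks :: "vocab \<Rightarrow> struct \<Rightarrow> omega1" where
  "sr_Sacks V A = (LEAST \<delta>. atomic_model V (LA V A \<delta>) (Th (LA V A \<delta>) A) A)"


section \<open>The tree of nodes\<close>

definition base_frag :: "vocab \<Rightarrow> fm \<Rightarrow> fm set" where
  "base_frag V \<phi> = frag_gen V {\<phi>}"

text \<open>The tautologies of a fragment are its logically valid sentences.\<close>

definition base_thy :: "vocab \<Rightarrow> fm \<Rightarrow> fm set" where
  "base_thy V \<phi> = insert \<phi> {\<sigma> \<in> sentences (base_frag V \<phi>).
     \<forall>M. structure_of V M \<longrightarrow> holds M \<sigma>}"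

text \<open>A node is a pair of a fragment and a theory in it. There is no next level above a node
  with so many non-principal types that \<open>next_frag\<close> is uncountable.\<close>

definition root_node :: "vocab \<Rightarrow> fm \<Rightarrow> fm set \<times> fm set \<Rightarrow> bool" where
  "root_node V \<phi> N \<longleftrightarrow> fst N = base_frag V \<phi> \<and> is_fragment V (fst N) \<and>
     base_thy V \<phi> \<subseteq> snd N \<and> omega_complete (fst N) (snd N) \<and> fin_consistent V (snd N)"

definition next_frag :: "vocab \<Rightarrow> fm set \<times> fm set \<Rightarrow> fm set" where
  "next_frag V N = frag_gen V (fst N \<union>
     {CConj (acset p) | p n. is_type V (fst N) (snd N) n p \<and> \<not> principal V (snd N) p})"

definition child_node :: "vocab \<Rightarrow> fm set \<times> fm set \<Rightarrow> fm set \<times> fm set \<Rightarrow> bool" where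
  "child_node V N N' \<longleftrightarrow> fst N' = next_frag V N \<and> is_fragment V (fst N') \<and>
     snd N \<subseteq> snd N' \<and> omega_complete (fst N') (snd N') \<and> fin_consistent V (snd N')"

text \<open>A branch of nodes through all countable levels.\<close>

definition is_branch :: "vocab \<Rightarrow> fm \<Rightarrow> (omega1 \<Rightarrow> fm set \<times> fm set) \<Rightarrow> bool" where
  "is_branch V \<phi> B \<longleftrightarrow> root_node V \<phi> (B 0) \<and>
     (\<forall>\<delta>. child_node V (B \<delta>) (B (osuc \<delta>))) \<and>
     (\<forall>\<delta>. islim \<delta> \<longrightarrow> B \<delta> = (\<Union>\<gamma><\<delta>. fst (B \<gamma>), \<Union>\<gamma><\<delta>. snd (B \<gamma>)))"


section \<open>Hereditarily countable sets and relative constructibility\<close>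

datatype hc = HC "hc cset"

primrec elts :: "hc \<Rightarrow> hc set" where
  "elts (HC X) = rcset X"

definition hset :: "hc set \<Rightarrow> hc" where
  "hset A = HC (acset A)"

definition hpair :: "hc \<Rightarrow> hc \<Rightarrow> hc" where
  "hpair x y = hset {hset {x}, hset {x, y}}"

primrec hnat :: "nat \<Rightarrow> hc" where
  "hnat 0 = hset {}"
| "hnat (Suc n) = hset (insert (hnat n) (elts (hnat n)))"

function hord :: "omega1 \<Rightarrow> hc" where
  "hord a = hset (hord ` {..<a})"
  by pat_completeness auto
termination
  by (relation "{(a, b). a < b}") (auto simp: wf)

declare hord.simps [simp del]

primrec code_tm :: "tm \<Rightarrow> hc" where
  "code_tm (Var i) = hpair (hnat 0) (hnat i)"
| "code_tm (Fn f ts) =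
     hpair (hnat 1) (hpair (hnat f) (foldr hpair (map code_tm ts) (hset {})))"

primrec code_fm :: "fm \<Rightarrow> hc" where
  "code_fm (Eq s t) = hpair (hnat 0) (hpair (code_tm s) (code_tm t))"
| "code_fm (Rel r ts) =
     hpair (hnat 1) (hpair (hnat r) (foldr hpair (map code_tm ts) (hset {})))"
| "code_fm (Neg \<phi>) = hpair (hnat 2) (code_fm \<phi>)"
| "code_fm (CConj F) = hpair (hnat 3) (HC (cimage code_fm F))"
| "code_fm (CDisj F) = hpair (hnat 4) (HC (cimage code_fm F))"
| "code_fm (Ex \<phi>) = hpair (hnat 5) (code_fm \<phi>)"
| "code_fm (All \<phi>) = hpair (hnat 6) (code_fm \<phi>)"

definition code_thy :: "fm set \<Rightarrow> hc" where
  "code_thy S = hset (code_fm ` S)"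

text \<open>First-order formulas of set theory, again with de Bruijn indices.\<close>

datatype sfm = SMem nat nat | SEq nat nat | SNeg sfm | SAnd sfm sfm | SEx sfm

primrec ssat :: "hc set \<Rightarrow> sfm \<Rightarrow> (nat \<Rightarrow> hc) \<Rightarrow> bool" where
  "ssat D (SMem i j) e = (e i \<in> elts (e j))"
| "ssat D (SEq i j) e = (e i = e j)"
| "ssat D (SNeg f) e = (\<not> ssat D f e)"
| "ssat D (SAnd f g) e = (ssat D f e \<and> ssat D g e)"
| "ssat D (SEx f) e = (\<exists>x\<in>D. ssat D f (case_nat x e))"

inductive Delta0 :: "sfm \<Rightarrow> bool" where
  "Delta0 (SMem i j)"
| "Delta0 (SEq i j)"
| "Delta0 f \<Longrightarrow> Delta0 (SNeg f)"
| "Delta0 f \<Longrightarrow> Delta0 g \<Longrightarrow> Delta0 (SAnd f g)"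
| "Delta0 f \<Longrightarrow> Delta0 (SEx (SAnd (SMem 0 (Suc j)) f))"

definition Sigma1 :: "sfm \<Rightarrow> bool" where
  "Sigma1 f \<longleftrightarrow> (\<exists>k g. Delta0 g \<and> f = (SEx ^^ k) g)"

text \<open>Boldface: parameters from \<open>D\<close> are allowed.\<close>

definition Sigma1_over :: "hc set \<Rightarrow> (hc \<Rightarrow> hc \<Rightarrow> bool) \<Rightarrow> bool" where
  "Sigma1_over D R \<longleftrightarrow> (\<exists>f e. Sigma1 f \<and> range e \<subseteq> D \<and>
     (\<forall>x\<in>D. \<forall>y\<in>D. R x y = ssat D f (case_nat x (case_nat y e))))"

definition Delta1_over :: "hc set \<Rightarrow> (hc \<Rightarrow> hc \<Rightarrow> bool) \<Rightarrow> bool" where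
  "Delta1_over D R \<longleftrightarrow> (\<forall>x y. R x y \<longrightarrow> x \<in> D \<and> y \<in> D) \<and>
     Sigma1_over D R \<and> Sigma1_over D (\<lambda>x y. \<not> R x y)"

inductive_set tclosure :: "hc \<Rightarrow> hc set" for x where
  "x \<in> tclosure x"
| "y \<in> tclosure x \<Longrightarrow> z \<in> elts y \<Longrightarrow> z \<in> tclosure x"

definition Def_over :: "hc set \<Rightarrow> hc set" where
  "Def_over D = {hset {x \<in> D. ssat D f (case_nat x e)} | f e. range e \<subseteq> D}"

text \<open>\<open>Lrel x \<alpha>\<close> is the level \<open>L(\<alpha>, x)\<close> of the sets constructible from \<open>x\<close>, starting from
  the transitive closure of the singleton of \<open>x\<close>.\<close>

definition Lrel :: "hc \<Rightarrow> omega1 \<Rightarrow> hc set" where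
  "Lrel x = ord_iter (tclosure x) Def_over"

definition Lrel_omega1 :: "hc \<Rightarrow> hc set" where
  "Lrel_omega1 x = (\<Union>\<alpha>. Lrel x \<alpha>)"

text \<open>Admissibility as satisfaction of the Kripke--Platek axioms by a transitive set.\<close>

definition admissible :: "hc set \<Rightarrow> bool" where
  "admissible D \<longleftrightarrow> D \<noteq> {} \<and> (\<forall>x\<in>D. elts x \<subseteq> D) \<and>
     (\<forall>x\<in>D. \<forall>y\<in>D. hset {x, y} \<in> D) \<and>
     (\<forall>x\<in>D. hset (\<Union> (elts ` elts x)) \<in> D) \<and>
     (\<forall>f e a. Delta0 f \<and> range e \<subseteq> D \<and> a \<in> D \<longrightarrow>
        hset {x \<in> elts a. ssat D f (case_nat x e)} \<in> D) \<and>
     (\<forall>f e a. Delta0 f \<and> range e \<subseteq> D \<and> a \<in> D \<and>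
        (\<forall>x\<in>elts a. \<exists>y\<in>D. ssat D f (case_nat x (case_nat y e))) \<longrightarrow>
        (\<exists>b\<in>D. \<forall>x\<in>elts a. \<exists>y\<in>elts b. ssat D f (case_nat x (case_nat y e))))"

text \<open>\<open>D\<close> contains the graph of an injection of the ordinal into the natural numbers.\<close>

definition countable_in :: "hc set \<Rightarrow> omega1 \<Rightarrow> bool" where
  "countable_in D \<gamma> \<longleftrightarrow> (\<exists>g. inj_on g {..<\<gamma>} \<and>
     hset {hpair (hord \<xi>) (hnat (g \<xi>)) | \<xi>. \<xi> < \<gamma>} \<in> D)"

definition is_omega1_in :: "hc set \<Rightarrow> omega1 \<Rightarrow> bool" where
  "is_omega1_in D \<kappa> \<longleftrightarrow> hord \<kappa> \<in> D \<and> \<not> countable_in D \<kappa> \<and> (\<forall>\<gamma><\<kappa>. countable_in D \<gamma>)"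


section \<open>The data supplied by Sacks, the fiber and the trace\<close>

definition sacks_branch :: "vocab \<Rightarrow> fm \<Rightarrow> (omega1 \<Rightarrow> fm set \<times> fm set) \<Rightarrow> bool" where
  "sacks_branch V \<phi> B \<longleftrightarrow> is_branch V \<phi> B \<and>
     Delta1_over (Lrel_omega1 (code_thy (base_thy V \<phi>)))
       (\<lambda>x y. \<exists>\<delta>. x = hord \<delta> \<and> y = code_thy (snd (B \<delta>))) \<and>
     (\<forall>\<delta>. \<exists>A. atomic_model V (fst (B \<delta>)) (snd (B \<delta>)) A \<and> sr_Sacks V A = \<delta>)"

definition nonprincipal_types :: "vocab \<Rightarrow> fm set \<times> fm set \<Rightarrow> fm set set" where
  "nonprincipal_types V N =
     {p. \<exists>n\<ge>1. is_type V (fst N) (snd N) n p \<and> \<not> principal V (snd N) p}"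

text \<open>The elements of the club are of the form \<open>\<omega>\<^sub>1\<close> computed in some countable level of the sets
  constructible from the base theory.\<close>

definition sacks_club ::
  "vocab \<Rightarrow> fm \<Rightarrow> (omega1 \<Rightarrow> fm set \<times> fm set) \<Rightarrow> omega1 set \<Rightarrow> bool" where
  "sacks_club V \<phi> B C \<longleftrightarrow> club C \<and>
     (\<forall>\<kappa>\<in>C. (\<exists>\<beta>. is_omega1_in (Lrel (code_thy (base_thy V \<phi>)) \<beta>) \<kappa>) \<and>
        om < \<kappa> \<and> admissible (Lrel (code_thy (base_thy V \<phi>)) \<kappa>) \<and>
        nonprincipal_types V (B \<kappa>) \<noteq> {} \<and> countable (nonprincipal_types V (B \<kappa>)))"

definition S_circ :: "vocab \<Rightarrow> fm \<Rightarrow> omega1 set \<Rightarrow> omega1 set" where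
  "S_circ V \<phi> C = frakF V \<phi> \<inter> C \<inter> {qr V \<phi><..}"

definition fiber :: "vocab \<Rightarrow> (omega1 \<Rightarrow> fm set \<times> fm set) \<Rightarrow> omega1 \<Rightarrow> struct set" where
  "fiber V B \<kappa> = {M. model_of V (snd (B \<kappa>)) M \<and> omega1_of V M = \<kappa>}"

definition realizes :: "struct \<Rightarrow> fm set \<Rightarrow> bool" where
  "realizes M p \<longleftrightarrow> (\<exists>e. assignment M e \<and> (\<forall>\<psi>\<in>p. sat M \<psi> e))"

definition trace :: "vocab \<Rightarrow> (omega1 \<Rightarrow> fm set \<times> fm set) \<Rightarrow> omega1 \<Rightarrow> struct \<Rightarrow> fm set set" where
  "trace V B \<kappa> M = {p \<in> nonprincipal_types V (B \<kappa>). realizes M p}"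

definition Spec :: "vocab \<Rightarrow> (omega1 \<Rightarrow> fm set \<times> fm set) \<Rightarrow> omega1 \<Rightarrow> fm set set set" where
  "Spec V B \<kappa> = trace V B \<kappa> ` fiber V B \<kappa>"

end

(* By Karp's theorem, two countable structures are isomorphic if the finite tuples realizing the same
   T_kappa-types form a back-and-forth system.  If M and M' have the same trace, then a type realized
   in M is realized in M': a principal type because T_kappa is complete, a non-principal one by
   assumption.  To extend a given pair of tuples, M' has moreover to be homogeneous for these types.
   This is where omega_1^M' = kappa is used, as in Nadel's theorem: tuples with the same T_delta-type
   for all delta < kappa survive delta rounds of the back-and-forth game for all delta < kappa, and by
   boundedness for an oracle X computing M' with omega_1^X = kappa they survive the infinite game.
   There are only countably many traces, since membership of one type in the trace is expressed by an
   infinitary sentence and phi is scattered. *)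

theory Submission
  imports Defs
begin

section \<open>Relative recursiveness\<close>

text \<open>The two models are never compared by one long game. A game between M and M' would need
  an oracle computing both, and the join of two oracles that have \<kappa> as their first
  non-computable ordinal may compute a well-order of length \<kappa>. Hence every long game is
  played between a model and itself, with an oracle for a copy of that model alone; what it yields
  is homogeneity, and the comparison of M with M' is left to the trace.

  Boundedness has to come from the definition of \<open>omega1_CK\<close>, which limits only the
  length of well-orders decidable in the oracle. Ranks must therefore be ranks in a decidable tree.
  Notations for the ordinals below \<kappa> do not form a decidable set and cannot serve as a clock
  for the game, so the tree of attempts is made its own clock: if it is well-founded, then its ranks
  are below \<kappa>, and a state that is safe for that long allows the attempt to go on.

  One level of the branch is lost per move, because the formula isolating a type of level \<delta>
  belongs to the level after \<delta>. This is why agreement at level \<delta> is worth \<delta>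
  rounds.\<close>

definition crec :: "nat set \<Rightarrow> nat \<Rightarrow> (nat list \<Rightarrow> nat) \<Rightarrow> bool" where
  "crec X k f \<longleftrightarrow> (\<exists>c. \<forall>xs. length xs = k \<longrightarrow> reval X c xs (f xs))"

lemma crec_cong: "crec X k f \<Longrightarrow> (\<And>xs. length xs = k \<Longrightarrow> f xs = g xs) \<Longrightarrow> crec X k g"
  unfolding crec_def by metis

lemma crec_comp:
  assumes h: "crec X (length fs) h" and fs: "\<And>f. f \<in> set fs \<Longrightarrow> crec X k f"
  shows "crec X k (\<lambda>xs. h (map (\<lambda>f. f xs) fs))"
proof -
  obtain c where c: "\<And>xs. length xs = length fs \<Longrightarrow> reval X c xs (h xs)"
    using h unfolding crec_def by blast
  have "\<forall>i<length fs. \<exists>g. \<forall>xs. length xs = k \<longrightarrow> reval X g xs ((fs ! i) xs)"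
    using fs unfolding crec_def by (meson nth_mem)
  then obtain gs where gs: "length gs = length fs"
    "\<And>i xs. i < length fs \<Longrightarrow> length xs = k \<Longrightarrow> reval X (gs ! i) xs ((fs ! i) xs)"
    unfolding Skolem_list_nth by blast
  have "reval X (Comp c gs) xs (h (map (\<lambda>f. f xs) fs))" if "length xs = k" for xs
    by (rule reval.intros(5)[where ys = "map (\<lambda>f. f xs) fs"]) (use gs c that in auto)
  then show ?thesis unfolding crec_def by blast
qed

lemma crec_comp1: "crec X 1 (\<lambda>xs. h (xs ! 0)) \<Longrightarrow> crec X k f \<Longrightarrow> crec X k (\<lambda>xs. h (f xs))"
  using crec_comp[of X "[f]" "\<lambda>xs. h (xs ! 0)" k] by simp

lemma crec_comp2:
  "crec X 2 (\<lambda>xs. h (xs ! 0) (xs ! 1)) \<Longrightarrow> crec X k f \<Longrightarrow> crec X k g \<Longrightarrow>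
    crec X k (\<lambda>xs. h (f xs) (g xs))"
  using crec_comp[of X "[f, g]" "\<lambda>xs. h (xs ! 0) (xs ! 1)" k] by (auto simp: numeral_2_eq_2)

lemma crec_comp3:
  "crec X 3 (\<lambda>xs. h (xs ! 0) (xs ! 1) (xs ! 2)) \<Longrightarrow> crec X k f \<Longrightarrow> crec X k g \<Longrightarrow> crec X k u \<Longrightarrow>
    crec X k (\<lambda>xs. h (f xs) (g xs) (u xs))"
  using crec_comp[of X "[f, g, u]" "\<lambda>xs. h (xs ! 0) (xs ! 1) (xs ! 2)" k]
  by (auto simp: numeral_eq_Suc)

lemma crec_nth: "i < k \<Longrightarrow> crec X k (\<lambda>xs. xs ! i)"
  unfolding crec_def by (intro HOL.exI[of _ "Proj i"]) (auto intro: reval.intros)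

lemma crec_Suc: "crec X 1 (\<lambda>xs. Suc (xs ! 0))"
  unfolding crec_def
proof (intro HOL.exI[of _ Succ] HOL.allI impI)
  fix xs :: "nat list" assume "length xs = 1"
  then show "reval X Succ xs (Suc (xs ! 0))"
    by (cases xs) (auto intro: reval.intros)
qed

lemma crec_Suc_comp: "crec X k f \<Longrightarrow> crec X k (\<lambda>xs. Suc (f xs))"
  by (rule crec_comp1[OF crec_Suc])

lemma crec_const: "crec X k (\<lambda>xs. n)"
proof (induction n)
  case 0
  show ?case unfolding crec_def by (intro HOL.exI[of _ Zero]) (auto intro: reval.intros)
qed (rule crec_Suc_comp)

lemma crec_prim:
  assumes f: "crec X k f" and g: "crec X (Suc (Suc k)) g"
  shows "crec X (Suc k) (\<lambda>xs. rec_nat (f (tl xs)) (\<lambda>n y. g (n # y # tl xs)) (hd xs))"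
proof -
  obtain a b where ab: "\<And>xs. length xs = k \<Longrightarrow> reval X a xs (f xs)"
    "\<And>xs. length xs = Suc (Suc k) \<Longrightarrow> reval X b xs (g xs)"
    using f g unfolding crec_def by blast
  have "reval X (PrimRec a b) (n # xs) (rec_nat (f xs) (\<lambda>n y. g (n # y # xs)) n)"
    if "length xs = k" for n xs
    by (induction n) (auto intro!: reval.intros ab that)
  then show ?thesis unfolding crec_def
    by (intro HOL.exI[of _ "PrimRec a b"]) (auto simp: length_Suc_conv)
qed

lemma crec_prim2:
  assumes "crec X 1 (\<lambda>xs. a (xs ! 0))" "crec X 3 (\<lambda>xs. g (xs ! 2) (xs ! 0) (xs ! 1))"
  shows "crec X 2 (\<lambda>xs. rec_nat (a (xs ! 1)) (g (xs ! 1)) (xs ! 0))"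
  using crec_prim[OF assms(1), of "\<lambda>xs. g (xs ! 2) (xs ! 0) (xs ! 1)"] assms(2)
  by (auto simp: numeral_eq_Suc length_Suc_conv elim!: crec_cong)

text \<open>\<open>Mu\<close> puts the number searched for at the head of the argument list, hence
  the order of the arguments of \<open>f\<close>. The assumption \<open>ex\<close> makes the search
  total.\<close>

lemma crec_Least:
  assumes f: "crec X 2 (\<lambda>xs. f (xs ! 1) (xs ! 0))" and ex: "\<And>n. \<exists>m. f n m = 0"
  shows "crec X 1 (\<lambda>xs. LEAST m. f (xs ! 0) m = 0)"
proof -
  obtain c where c: "\<And>n m. reval X c [m, n] (f n m)"
    using f unfolding crec_def by (metis One_nat_def length_Cons list.size(3) nth_Cons_0 nth_Cons_Suc numeral_2_eq_2)
  have "reval X (Mu c) [n] (LEAST m. f n m = 0)" for n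
  proof (rule reval.intros)
    show "reval X c [LEAST m. f n m = 0, n] 0"
      using c[of "LEAST m. f n m = 0" n] LeastI_ex[OF ex[of n]] by simp
    show "\<exists>v>0. reval X c [k, n] v" if "k < (LEAST m. f n m = 0)" for k
      using c[of k n] not_less_Least[OF that] by auto
  qed
  then show ?thesis unfolding crec_def
    by (intro HOL.exI[of _ "Mu c"]) (auto simp: length_Suc_conv)
qed

lemma crec_rec_nat:
  assumes "crec X 1 (\<lambda>xs. a (xs ! 0))" "crec X 3 (\<lambda>xs. g (xs ! 2) (xs ! 0) (xs ! 1))"
    "crec X k m" "crec X k n"
  shows "crec X k (\<lambda>xs. rec_nat (a (n xs)) (g (n xs)) (m xs))"
  using crec_comp2[OF crec_prim2[OF assms(1,2)] assms(3,4)] .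

section \<open>Arithmetic, pairing and the projections\<close>

lemma crec_add: "crec X k f \<Longrightarrow> crec X k g \<Longrightarrow> crec X k (\<lambda>xs. f xs + g xs)"
proof -
  have eq: "rec_nat n (\<lambda>_ y. Suc y) m = m + n" for m n :: nat by (induction m) auto
  show "crec X k f \<Longrightarrow> crec X k g \<Longrightarrow> crec X k (\<lambda>xs. f xs + g xs)"
    using crec_rec_nat[where a = "\<lambda>n. n" and g = "\<lambda>_ _ y. Suc y" and m = f and n = g, of X k]
    by (simp add: eq crec_nth crec_Suc_comp)
qed

lemma crec_pred: "crec X k f \<Longrightarrow> crec X k (\<lambda>xs. f xs - 1)"
proof -
  have eq: "rec_nat 0 (\<lambda>y _. y) m = m - 1" for m :: nat by (induction m) auto
  show "crec X k f \<Longrightarrow> crec X k (\<lambda>xs. f xs - 1)"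
    using crec_rec_nat[where a = "\<lambda>n. 0" and g = "\<lambda>_ y _. y" and m = f and n = f, of X k]
    by (simp add: eq crec_nth crec_const)
qed

lemma crec_diff: "crec X k f \<Longrightarrow> crec X k g \<Longrightarrow> crec X k (\<lambda>xs. g xs - f xs)"
proof -
  have eq: "rec_nat n (\<lambda>_ y. y - 1) m = n - m" for m n :: nat by (induction m) auto
  show "crec X k f \<Longrightarrow> crec X k g \<Longrightarrow> crec X k (\<lambda>xs. g xs - f xs)"
    using crec_rec_nat[where a = "\<lambda>n. n" and g = "\<lambda>_ _ y. y - 1" and m = f and n = g, of X k]
      crec_pred[OF crec_nth[of 1 3]]
    by (simp add: eq[simplified] crec_nth)
qed

lemma crec_If0:
  assumes "crec X k f" "crec X k g" "crec X k h"
  shows "crec X k (\<lambda>xs. if f xs = 0 then g xs else h xs)"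
proof -
  have eq: "rec_nat a (\<lambda>_ _. b) m = (if m = 0 then a else b)" for a b m :: nat
    by (induction m) auto
  \<comment> \<open>A case distinction is a recursion whose step ignores the previous value. The
    entries \<open>n\<close> and \<open>y\<close> precede the parameters in the step, so index 3 is
    the second parameter, the value for nonzero arguments.\<close>
  have "crec X (Suc 2) (\<lambda>xs. rec_nat (tl xs ! 0) (\<lambda>n y. (n # y # tl xs) ! 3) (hd xs))"
    by (rule crec_prim) (simp_all add: crec_nth)
  then have "crec X 3 (\<lambda>xs. rec_nat (xs ! 1) (\<lambda>_ _. xs ! 2) (xs ! 0))"
    by (rule crec_cong[OF back_subst[of "\<lambda>k. crec X k _"]])
       (auto simp: numeral_eq_Suc length_Suc_conv)
  from crec_comp3[OF this[unfolded eq] assms] show ?thesis .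
qed

lemma crec_triangle: "crec X k f \<Longrightarrow> crec X k (\<lambda>xs. triangle (f xs))"
proof -
  have eq: "rec_nat 0 (\<lambda>n y. y + Suc n) m = triangle m" for m :: nat by (induction m) auto
  show "crec X k f \<Longrightarrow> crec X k (\<lambda>xs. triangle (f xs))"
    using crec_rec_nat[where a = "\<lambda>n. 0" and g = "\<lambda>_ n y. y + Suc n" and m = f and n = f, of X k]
    by (simp add: eq[simplified] crec_nth crec_const crec_add crec_Suc_comp)
qed

lemma crec_pair: "crec X k f \<Longrightarrow> crec X k g \<Longrightarrow> crec X k (\<lambda>xs. prod_encode (f xs, g xs))"
  unfolding prod_encode_def by (auto intro!: crec_add crec_triangle)

definition pfst :: "nat \<Rightarrow> nat" where "pfst n = fst (prod_decode n)"
definition psnd :: "nat \<Rightarrow> nat" where "psnd n = snd (prod_decode n)"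
abbreviation pr :: "nat \<Rightarrow> nat \<Rightarrow> nat" where "pr m n \<equiv> prod_encode (m, n)"

lemma pfst_pr [simp]: "pfst (pr m n) = m" and psnd_pr [simp]: "psnd (pr m n) = n"
  by (simp_all add: pfst_def psnd_def)

lemma pr_pfst_psnd [simp]: "pr (pfst n) (psnd n) = n"
  by (simp add: pfst_def psnd_def)

lemma triangle_mono: "m \<le> n \<Longrightarrow> triangle m \<le> triangle n"
  by (induction n) (auto simp: le_Suc_eq)

text \<open>The code \<open>pr a b\<close> is \<open>triangle (a + b) + a\<close>. So a + b is the
  first k for which the code lies below \<open>triangle (Suc k)\<close>; this search makes both
  projections recursive.\<close>

lemma Least_triangle: "(LEAST k. Suc (pr a b) - triangle (Suc k) = 0) = a + b"
proof (rule Least_equality)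
  show "Suc (pr a b) - triangle (Suc (a + b)) = 0" by (simp add: prod_encode_def)
next
  fix k assume "Suc (pr a b) - triangle (Suc k) = 0"
  then show "a + b \<le> k"
    using triangle_mono[of "Suc k" "a + b"] by (force simp: prod_encode_def)
qed

text \<open>A function is \<open>X\<close>-recursive as a unary function; several arguments are passed as a pair.\<close>

definition rec :: "nat set \<Rightarrow> (nat \<Rightarrow> nat) \<Rightarrow> bool" where
  "rec X f \<longleftrightarrow> crec X 1 (\<lambda>xs. f (xs ! 0))"

definition dec :: "nat set \<Rightarrow> (nat \<Rightarrow> bool) \<Rightarrow> bool" where
  "dec X P \<longleftrightarrow> rec X (\<lambda>n. if P n then 1 else 0)"

lemma computes_iff_dec: "computes X Y \<longleftrightarrow> dec X (\<lambda>n. n \<in> Y)"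
proof -
  have "(\<forall>xs. length xs = 1 \<longrightarrow> Q xs) \<longleftrightarrow> (\<forall>n. Q [n])" for Q :: "nat list \<Rightarrow> bool"
    by (auto simp: length_Suc_conv)
  then show ?thesis unfolding computes_def dec_def rec_def crec_def by simp
qed

lemma rec_id: "rec X (\<lambda>n. n)"
  unfolding rec_def by (simp add: crec_nth)

lemma rec_const: "rec X (\<lambda>n. m)"
  unfolding rec_def by (rule crec_const)

lemma rec_comp: "rec X h \<Longrightarrow> rec X f \<Longrightarrow> rec X (\<lambda>n. h (f n))"
  unfolding rec_def by (rule crec_comp1)

lemma dec_comp: "dec X P \<Longrightarrow> rec X f \<Longrightarrow> dec X (\<lambda>n. P (f n))"
  unfolding dec_def by (rule rec_comp)

lemma rec_Suc: "rec X f \<Longrightarrow> rec X (\<lambda>n. Suc (f n))"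
  unfolding rec_def by (rule crec_Suc_comp)

lemma rec_diff: "rec X f \<Longrightarrow> rec X g \<Longrightarrow> rec X (\<lambda>n. f n - g n)"
  unfolding rec_def by (rule crec_diff)

lemma rec_pair: "rec X f \<Longrightarrow> rec X g \<Longrightarrow> rec X (\<lambda>n. pr (f n) (g n))"
  unfolding rec_def by (rule crec_pair)

lemma rec_pfst: "rec X f \<Longrightarrow> rec X (\<lambda>n. pfst (f n))"
  and rec_psnd: "rec X f \<Longrightarrow> rec X (\<lambda>n. psnd (f n))"
proof -
  define s where "s n = (LEAST k. Suc n - triangle (Suc k) = 0)" for n
  have s: "s n = pfst n + psnd n" for n
    using Least_triangle[of "pfst n" "psnd n"] unfolding s_def by (simp only: pr_pfst_psnd)
  have "rec X s"
    unfolding rec_def s_def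
  proof (rule crec_Least)
    show "\<exists>m. Suc n - triangle (Suc m) = 0" for n
      by (rule HOL.exI[of _ n]) simp
  qed (intro crec_diff crec_triangle crec_Suc_comp crec_nth; simp)
  then have rs: "rec X (\<lambda>n. pfst n + psnd n)" by (simp add: s[abs_def])
  have 1: "n - triangle (pfst n + psnd n) = pfst n" for n
  proof -
    have "pr (pfst n) (psnd n) = triangle (pfst n + psnd n) + pfst n" by (simp add: prod_encode_def)
    then show ?thesis by simp
  qed
  have "rec X (\<lambda>n. n - triangle (pfst n + psnd n))"
    using rs unfolding rec_def by (intro crec_diff crec_triangle crec_nth) simp_all
  then have f: "rec X (\<lambda>n. pfst n)" unfolding 1 .
  have g: "rec X (\<lambda>n. psnd n)" using rec_diff[OF rs f] by simp
  show "rec X f \<Longrightarrow> rec X (\<lambda>n. pfst (f n))" by (rule rec_comp[OF f])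
  show "rec X f \<Longrightarrow> rec X (\<lambda>n. psnd (f n))" by (rule rec_comp[OF g])
qed

lemma rec_If:
  assumes "dec X P" "rec X f" "rec X g"
  shows "rec X (\<lambda>n. if P n then f n else g n)"
proof -
  have "crec X 1 (\<lambda>xs. if (if P (xs ! 0) then 1 else 0) = (0 :: nat) then g (xs ! 0) else f (xs ! 0))"
    by (rule crec_If0) (use assms in \<open>simp_all add: rec_def dec_def\<close>)
  then show ?thesis unfolding rec_def by (rule crec_cong) simp
qed

lemma dec_of_rec: "rec X f \<Longrightarrow> dec X (\<lambda>n. f n = 0)"
  unfolding dec_def rec_def by (intro crec_If0 crec_const)

lemma dec_le: "rec X f \<Longrightarrow> rec X g \<Longrightarrow> dec X (\<lambda>n. f n \<le> g n)"
  using dec_of_rec[OF rec_diff, of X f g] by simp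

lemma dec_not: "dec X P \<Longrightarrow> dec X (\<lambda>n. \<not> P n)"
proof -
  assume "dec X P"
  then have "dec X (\<lambda>n. (if P n then 1 else 0) = (0 :: nat))"
    unfolding dec_def[of X P] by (rule dec_of_rec)
  moreover have "(if P n then 1 else 0) = (0 :: nat) \<longleftrightarrow> \<not> P n" for n by simp
  ultimately show "dec X (\<lambda>n. \<not> P n)" by simp
qed

lemma dec_conj:
  assumes "dec X P" "dec X Q" shows "dec X (\<lambda>n. P n \<and> Q n)"
proof -
  have eq: "(if P n \<and> Q n then 1 else 0) = (if P n then if Q n then 1 else 0 else (0 :: nat))" for n
    by simp
  show ?thesis unfolding dec_def eq
    by (intro rec_If rec_const assms(1) assms(2)[unfolded dec_def])
qed

lemma dec_disj: "dec X P \<Longrightarrow> dec X Q \<Longrightarrow> dec X (\<lambda>n. P n \<or> Q n)"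
  using dec_not[OF dec_conj[OF dec_not dec_not], of X P Q] by (simp only: de_Morgan_conj not_not)

lemma dec_imp: "dec X P \<Longrightarrow> dec X Q \<Longrightarrow> dec X (\<lambda>n. P n \<longrightarrow> Q n)"
  unfolding imp_conv_disj by (intro dec_disj dec_not)

lemma dec_iff: "dec X P \<Longrightarrow> dec X Q \<Longrightarrow> dec X (\<lambda>n. P n \<longleftrightarrow> Q n)"
  unfolding iff_conv_conj_imp by (intro dec_conj dec_imp)

lemma dec_eq: "rec X f \<Longrightarrow> rec X g \<Longrightarrow> dec X (\<lambda>n. f n = g n)"
proof -
  have eq: "f n = g n \<longleftrightarrow> f n \<le> g n \<and> g n \<le> f n" for n by auto
  show "rec X f \<Longrightarrow> rec X g \<Longrightarrow> dec X (\<lambda>n. f n = g n)"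
    unfolding eq by (intro dec_conj dec_le)
qed

lemma dec_less: "rec X f \<Longrightarrow> rec X g \<Longrightarrow> dec X (\<lambda>n. f n < g n)"
  using dec_not[OF dec_le, of X g f] by (simp add: not_le)

lemma rec_Least:
  assumes P: "dec X (\<lambda>v. P (pfst v) (psnd v))" and ex: "\<And>n. \<exists>m. P n m"
  shows "rec X (\<lambda>n. LEAST m. P n m)"
proof -
  let ?f = "\<lambda>v. if \<not> P (pfst v) (psnd v) then 1 else (0 :: nat)"
  have "rec X ?f" using dec_not[OF P] unfolding dec_def .
  then have "crec X 2 (\<lambda>xs. ?f (pr (xs ! 1) (xs ! 0)))"
    unfolding rec_def by (rule crec_comp1) (intro crec_pair crec_nth; simp)
  from crec_Least[of X "\<lambda>n m. ?f (pr n m)", OF this] ex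
  have "crec X 1 (\<lambda>xs. LEAST m. ?f (pr (xs ! 0) m) = 0)" by simp
  moreover have "?f (pr n m) = 0 \<longleftrightarrow> P n m" for n m by simp
  ultimately show ?thesis unfolding rec_def by simp
qed

text \<open>The alternative \<open>i = b n\<close> makes the search total; a witness below the bound
  exists precisely if the search stops before \<open>b n\<close>.\<close>

lemma dec_bex:
  assumes P: "dec X (\<lambda>v. P (pfst v) (psnd v))" and b: "rec X b"
  shows "dec X (\<lambda>n. \<exists>i<b n. P n i)"
proof -
  have eq: "(\<exists>i<b n. P n i) \<longleftrightarrow> (LEAST i. i = b n \<or> P n i) < b n" for n
  proof
    assume "\<exists>i<b n. P n i"
    then show "(LEAST i. i = b n \<or> P n i) < b n"
      by (metis (mono_tags, lifting) Least_le order_le_less_trans)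
  next
    assume l: "(LEAST i. i = b n \<or> P n i) < b n"
    have "(LEAST i. i = b n \<or> P n i) = b n \<or> P n (LEAST i. i = b n \<or> P n i)"
      by (rule LeastI[of _ "b n"]) simp
    then show "\<exists>i<b n. P n i" using l by auto
  qed
  have "rec X (\<lambda>n. LEAST i. i = b n \<or> P n i)"
    by (rule rec_Least) (use b in \<open>auto intro!: dec_disj dec_eq P rec_psnd rec_id rec_comp[OF b] rec_pfst\<close>)
  then show ?thesis unfolding eq by (rule dec_less) fact
qed

lemma dec_ball:
  assumes P: "dec X (\<lambda>v. P (pfst v) (psnd v))" and b: "rec X b"
  shows "dec X (\<lambda>n. \<forall>i<b n. P n i)"
  using dec_not[OF dec_bex[OF dec_not[OF P] b]] by simp

lemma rec_nat_param:
  assumes a: "rec X a" and g: "rec X (\<lambda>v. g (pfst v) (pfst (psnd v)) (psnd (psnd v)))" and m: "rec X m"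
  shows "rec X (\<lambda>n. rec_nat (a n) (g n) (m n))"
proof -
  have "crec X 3 (\<lambda>xs. g (xs ! 2) (xs ! 0) (xs ! 1))"
    using crec_comp1[OF g[unfolded rec_def], of 3 "\<lambda>xs. pr (xs ! 2) (pr (xs ! 0) (xs ! 1))"]
    by (simp add: crec_pair crec_nth)
  from crec_rec_nat[OF a[unfolded rec_def] this m[unfolded rec_def] rec_id[unfolded rec_def]]
  show ?thesis unfolding rec_def .
qed

lemma rec_funpow:
  assumes "rec X h" "rec X k" "rec X a"
  shows "rec X (\<lambda>n. (h ^^ k n) (a n))"
proof -
  have eq: "(h ^^ m) x = rec_nat x (\<lambda>_ y. h y) m" for m x by (induction m) auto
  show ?thesis unfolding eq
    by (intro rec_nat_param assms rec_psnd rec_id rec_comp[OF assms(1)])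
qed


section \<open>Computable well-orders\<close>

text \<open>Used for counting: a code can then decide at most one set. For \<open>Mu\<close>, two
  different results conflict at the smaller one, where one derivation gives the value 0 and the
  other a positive value.\<close>

lemma reval_functional: "reval X f xs y \<Longrightarrow> reval X f xs z \<Longrightarrow> y = z"
proof (induction arbitrary: z rule: reval.induct)
  case (5 ys gs xs f y)
  from "5.prems" obtain zs where zs: "length zs = length gs"
    "\<And>i. i < length gs \<Longrightarrow> reval X (gs ! i) xs (zs ! i)" "reval X f zs z"
    by (cases rule: reval.cases) auto
  have "ys = zs" using "5.hyps"(1) "5.IH"(1) zs(1,2) by (metis nth_equalityI)
  then show ?case using "5.IH"(2) zs(3) by blast
next
  case (7 f g n xs y w)
  from "7.prems" obtain y' where "reval X (PrimRec f g) (n # xs) y'" "reval X g (n # y' # xs) z"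
    by (cases rule: reval.cases) auto
  then show ?case using "7.IH" by blast
next
  case (8 f m xs)
  from "8.prems" have z: "reval X f (z # xs) 0" "\<And>k. k < z \<Longrightarrow> \<exists>v>0. reval X f (k # xs) v"
    by (cases rule: reval.cases, auto)+
  show ?case
  proof (cases m z rule: linorder_cases)
    case less
    then show ?thesis using z(2)[of m] "8.IH"(1) by (metis less_irrefl)
  next
    case greater
    then show ?thesis using z(1) "8.IH"(2)[of z] by (metis less_irrefl)
  qed
qed (erule reval.cases; auto)+

instance rf :: countable by countable_datatype

lemma countable_computable: "countable {Y. computes X Y}"
proof -
  define c where "c Y = (SOME f. \<forall>n. reval X f [n] (if n \<in> Y then 1 else 0))" for Y
  have c: "reval X (c Y) [n] (if n \<in> Y then 1 else 0)" if "computes X Y" for Y n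
    using someI_ex[OF that[unfolded computes_def]] unfolding c_def by blast
  have "inj_on c {Y. computes X Y}"
  proof (rule inj_onI, clarsimp)
    fix Y Z assume *: "computes X Y" "computes X Z" "c Y = c Z"
    have "n \<in> Y \<longleftrightarrow> n \<in> Z" for n
      using reval_functional[OF c[OF *(1), of n] c[OF *(2), of n, folded *(3)]]
      by (auto split: if_splits)
    then show "Y = Z" by blast
  qed
  then show ?thesis by (rule countableI')
qed

section \<open>Ordinals computable from an oracle\<close>

abbreviation below :: "omega1 \<Rightarrow> (omega1 \<times> omega1) set" where
  "below \<alpha> \<equiv> {(a, b). a \<le> b \<and> b < \<alpha>}"

lemma Field_below: "Field (below \<alpha>) = {..<\<alpha>}"
  by (force simp: Field_def)

lemma Well_order_wf:
  assumes "wf (R - Id)" "refl_on (Field R) R" "total_on (Field R) R" "antisym R" "trans R"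
  shows "Well_order R"
  using assms
  by (auto simp: well_order_on_def linear_order_on_def partial_order_on_def preorder_on_def
      Field_def)

lemma Well_order_below: "Well_order (below \<alpha>)"
proof (rule Well_order_wf)
  have "below \<alpha> - Id \<subseteq> {(a, b). a < b}" by auto
  then show "wf (below \<alpha> - Id)" using wf wf_subset by blast
  show "refl_on (Field (below \<alpha>)) (below \<alpha>)"
    unfolding Field_below by (auto simp: refl_on_def)
  show "total_on (Field (below \<alpha>)) (below \<alpha>)"
    unfolding Field_below by (auto simp: total_on_def)
qed (auto simp: antisym_def trans_def)

lemma below_Restr: "\<alpha> < \<beta> \<Longrightarrow> below \<alpha> = Restr (below \<beta>) (underS (below \<beta>) \<alpha>)"
  by (auto simp: underS_def)

lemma below_ordLess: "\<alpha> < \<beta> \<Longrightarrow> (below \<alpha>, below \<beta>) \<in> ordLess"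
proof -
  assume "\<alpha> < \<beta>"
  then have "Field (below \<beta>) \<noteq> {}" unfolding Field_below by auto
  from underS_Restr_ordLess[OF Well_order_below this, of \<alpha>] below_Restr[OF \<open>\<alpha> < \<beta>\<close>]
  show ?thesis by simp
qed

lemma below_ordIso: "(below \<alpha>, below \<beta>) \<in> ordIso \<Longrightarrow> \<alpha> = \<beta>"
  using below_ordLess[of \<alpha> \<beta>] below_ordLess[of \<beta> \<alpha>]
  by (meson linorder_less_linear not_ordLess_ordIso ordIso_symmetric)

definition computable_ordinal :: "nat set \<Rightarrow> omega1 \<Rightarrow> bool" where
  "computable_ordinal X \<alpha> \<longleftrightarrow>
     (\<exists>R. Well_order R \<and> computes X (prod_encode ` R) \<and> (R, below \<alpha>) \<in> ordIso)"

text \<open>\<open>omega1_CK\<close> is a least element, so some non-computable ordinal has to be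
  exhibited first. It exists by counting: otherwise uncountably many ordinals would have pairwise
  different computable orders, of which there are only countably many.\<close>

lemma not_computable_ordinal_CK: "\<not> computable_ordinal X (omega1_CK X)"
proof -
  have "\<exists>\<alpha>. \<not> computable_ordinal X \<alpha>"
  proof (rule ccontr)
    assume "\<nexists>\<alpha>. \<not> computable_ordinal X \<alpha>"
    then have "\<forall>\<alpha>. \<exists>R. computes X (prod_encode ` R) \<and> (R, below \<alpha>) \<in> ordIso"
      unfolding computable_ordinal_def by meson
    then obtain R where R: "\<And>\<alpha>. computes X (prod_encode ` R \<alpha>)" "\<And>\<alpha>. (R \<alpha>, below \<alpha>) \<in> ordIso"
      by metis
    have "inj (\<lambda>\<alpha>. prod_encode ` R \<alpha>)"
    proof (rule injI)
      fix \<alpha> \<beta> assume "prod_encode ` R \<alpha> = prod_encode ` R \<beta>"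
      then have "R \<alpha> = R \<beta>" by (simp add: inj_image_eq_iff inj_prod_encode)
      then have "(R \<alpha>, below \<beta>) \<in> ordIso" using R(2)[of \<beta>] by simp
      then show "\<alpha> = \<beta>"
        by (rule below_ordIso[OF ordIso_transitive[OF ordIso_symmetric[OF R(2)]]])
    qed
    moreover have "countable (range (\<lambda>\<alpha>. prod_encode ` R \<alpha>))"
      by (rule countable_subset[OF _ countable_computable[of X]]) (use R(1) in auto)
    ultimately show False
      using uncountable_omega1 countable_image_inj_on by blast
  qed
  moreover have "omega1_CK X = (LEAST \<alpha>. \<not> computable_ordinal X \<alpha>)"
    unfolding omega1_CK_def computable_ordinal_def by (rule refl)
  ultimately show ?thesis
    using LeastI_ex[of "\<lambda>\<alpha>. \<not> computable_ordinal X \<alpha>"] by simp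
qed

text \<open>If \<open>R\<close> were at least as long as \<open>omega1_CK X\<close>, then
  \<open>R\<close> or one of its proper initial segments would be isomorphic to
  \<open>below (omega1_CK X)\<close>. Such segments are decidable as well, so
  \<open>omega1_CK X\<close> would be a computable ordinal. Hence \<open>R\<close> embeds into
  \<open>below (omega1_CK X)\<close>, and the embedding is the required rank.\<close>

lemma computable_well_order_rank:
  assumes R: "Well_order R" and dec: "dec X (\<lambda>n. (pfst n, psnd n) \<in> R)"
  obtains \<rho> :: "nat \<Rightarrow> omega1" where "\<And>a. a \<in> Field R \<Longrightarrow> \<rho> a < omega1_CK X"
    "\<And>a b. (a, b) \<in> R \<Longrightarrow> a \<noteq> b \<Longrightarrow> \<rho> a < \<rho> b"
proof -
  have mem: "n \<in> prod_encode ` S \<longleftrightarrow> (pfst n, psnd n) \<in> S" for n S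
    unfolding pfst_def psnd_def by (metis image_iff prod.collapse prod_decode_inverse prod_encode_inverse)
  \<comment> \<open>The bound \<open>a\<close> of an initial segment enters its decision procedure
    as a constant.\<close>
  have comp: "computable_ordinal X \<alpha>"
    if "S = R \<or> (\<exists>a. S = Restr R (underS R a))" "(S, below \<alpha>) \<in> ordIso" for S \<alpha>
  proof -
    have "dec X (\<lambda>n. (pfst n, a) \<in> R)" "dec X (\<lambda>n. (psnd n, a) \<in> R)" for a
      using dec_comp[OF dec rec_pair[OF rec_pfst[OF rec_id] rec_const]]
        dec_comp[OF dec rec_pair[OF rec_psnd[OF rec_id] rec_const]] by simp_all
    then have "dec X (\<lambda>n. (pfst n, psnd n) \<in> R \<and> ((pfst n, a) \<in> R \<and> pfst n \<noteq> a) \<and>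
        (psnd n, a) \<in> R \<and> psnd n \<noteq> a)" for a
      by (intro dec_conj dec_not dec_eq dec rec_pfst rec_psnd rec_id rec_const)
    then have "computes X (prod_encode ` S)"
      unfolding computes_iff_dec mem using that(1) dec
      by (auto simp: underS_def)
         (rule back_subst[of "dec X"], assumption, auto)
    moreover have "Well_order S" using that(1) R Well_order_Restr by auto
    ultimately show ?thesis unfolding computable_ordinal_def using that(2) by blast
  qed
  let ?W = "below (omega1_CK X)"
  have "\<not> (?W, R) \<in> ordLeq"
  proof
    assume "(?W, R) \<in> ordLeq"
    then consider "(?W, R) \<in> ordLess" | "(?W, R) \<in> ordIso" using ordLeq_iff_ordLess_or_ordIso by blast
    then show False
    proof cases
      case 1
      then obtain a where "(?W, Restr R (underS R a)) \<in> ordIso"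
        using ordLess_iff_ordIso_Restr[OF R Well_order_below] by blast
      then show ?thesis using comp not_computable_ordinal_CK ordIso_symmetric by blast
    next
      case 2
      then show ?thesis using comp not_computable_ordinal_CK ordIso_symmetric by blast
    qed
  qed
  then have "(R, ?W) \<in> ordLess"
    using R Well_order_below ordLess_or_ordLeq by blast
  then obtain f where f: "embed R ?W f" unfolding ordLess_def embedS_def by blast
  have inj: "inj_on f (Field R)" using embed_inj_on[OF R f] .
  have into: "f a \<in> Field ?W" if "a \<in> Field R" for a
    using embed_in_Field[OF f that] .
  have mono: "(f a, f b) \<in> ?W" if "(a, b) \<in> R" for a b
    using embed_compat[OF f] that unfolding compat_def by blast
  show ?thesis
  proof (rule that[of f])
    show "a \<in> Field R \<Longrightarrow> f a < omega1_CK X" for a using into[of a] unfolding Field_below by simp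
    show "f a < f b" if "(a, b) \<in> R" "a \<noteq> b" for a b
    proof -
      have "f a \<noteq> f b" using inj that by (meson FieldI1 FieldI2 inj_on_contraD)
      then show ?thesis using mono[OF that(1)] by auto
    qed
  qed
qed


section \<open>Computable trees and closed games\<close>

text \<open>This is the clause of \<open>list_encode\<close> for a nonempty list. The empty list has
  code 0, which is a fixed point of \<open>ctl\<close>, so iterating \<open>ctl\<close> beyond the
  end of a list is harmless.\<close>

abbreviation ccons :: "nat \<Rightarrow> nat \<Rightarrow> nat" where "ccons x v \<equiv> Suc (pr x v)"
definition chd :: "nat \<Rightarrow> nat" where "chd v = pfst (v - 1)"
definition ctl :: "nat \<Rightarrow> nat" where "ctl v = psnd (v - 1)"
definition clen :: "nat \<Rightarrow> nat" where "clen v = length (list_decode v)"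
definition cnth :: "nat \<Rightarrow> nat \<Rightarrow> nat" where "cnth v i = chd ((ctl ^^ i) v)"

lemma chd_ccons [simp]: "chd (ccons x v) = x" and ctl_ccons [simp]: "ctl (ccons x v) = v"
  by (simp_all add: chd_def ctl_def)

lemma psnd_0 [simp]: "psnd 0 = 0"
  using psnd_pr[of 0 0] by (simp add: prod_encode_def)

lemma pfst_le: "pfst n \<le> n" and psnd_le: "psnd n \<le> n"
  using le_prod_encode_1[of "pfst n" "psnd n"] le_prod_encode_2[of "psnd n" "pfst n"] by simp_all

lemma ctl_less: "v \<noteq> 0 \<Longrightarrow> ctl v < v" and chd_less: "v \<noteq> 0 \<Longrightarrow> chd v < v"
  using psnd_le[of "v - 1"] pfst_le[of "v - 1"] by (auto simp: ctl_def chd_def)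

lemma list_decode_ccons [simp]: "list_decode (ccons x v) = x # list_decode v"
  by (simp add: prod_encode_inverse)

lemma list_decode_ctl: "list_decode (ctl v) = tl (list_decode v)"
proof (cases v)
  case 0
  then show ?thesis by (simp add: ctl_def)
next
  case (Suc m)
  then show ?thesis using list_decode_ccons[of "pfst m" "psnd m"] by (simp add: ctl_def)
qed

lemma list_decode_funpow_ctl: "list_decode ((ctl ^^ i) v) = drop i (list_decode v)"
  by (induction i) (simp_all add: list_decode_ctl drop_Suc tl_drop)

lemma list_decode_eq_Nil: "list_decode v = [] \<longleftrightarrow> v = 0"
  by (metis list_decode.simps(1) list_encode.simps(1) list_decode_inverse)

lemma cnth_eq: "i < clen v \<Longrightarrow> cnth v i = list_decode v ! i"
proof -
  assume i: "i < clen v"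
  then obtain x xs where x: "drop i (list_decode v) = x # xs"
    unfolding clen_def by (metis Cons_nth_drop_Suc)
  then have "list_decode ((ctl ^^ i) v) = list_decode (ccons x (list_encode xs))"
    by (simp only: list_decode_funpow_ctl list_decode_ccons list_encode_inverse)
  then have "(ctl ^^ i) v = ccons x (list_encode xs)" by (metis list_decode_inverse)
  then have "cnth v i = x" by (simp add: cnth_def)
  then show ?thesis using x by (metis hd_drop_conv_nth i clen_def list.sel(1))
qed

lemma rec_chd: "rec X f \<Longrightarrow> rec X (\<lambda>n. chd (f n))" and rec_ctl: "rec X f \<Longrightarrow> rec X (\<lambda>n. ctl (f n))"
  unfolding chd_def ctl_def by (intro rec_pfst rec_psnd rec_diff rec_const; assumption)+

lemma rec_funpow_ctl: "rec X f \<Longrightarrow> rec X g \<Longrightarrow> rec X (\<lambda>n. (ctl ^^ g n) (f n))"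
  by (intro rec_funpow rec_ctl rec_id)

lemma rec_cnth: "rec X f \<Longrightarrow> rec X g \<Longrightarrow> rec X (\<lambda>n. cnth (f n) (g n))"
  unfolding cnth_def by (intro rec_chd rec_funpow_ctl)

lemma rec_clen: "rec X f \<Longrightarrow> rec X (\<lambda>n. clen (f n))"
proof -
  have z: "(ctl ^^ m) n = 0 \<longleftrightarrow> clen n \<le> m" for m n
    using list_decode_eq_Nil[of "(ctl ^^ m) n"] by (simp add: list_decode_funpow_ctl clen_def)
  have "clen n = (LEAST m. (ctl ^^ m) n = 0)" for n
    unfolding z by (rule Least_equality[symmetric]) auto
  moreover have "rec X (\<lambda>n. LEAST m. (ctl ^^ m) n = 0)"
  proof (rule rec_Least)
    show "\<exists>m. (ctl ^^ m) n = 0" for n unfolding z by blast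
  qed (intro dec_eq rec_funpow_ctl rec_pfst rec_psnd rec_id rec_const)
  ultimately have "rec X (\<lambda>n. clen n)" by simp
  from rec_comp[OF this] show "rec X f \<Longrightarrow> rec X (\<lambda>n. clen (f n))" .
qed

lemmas rec_intros = rec_id rec_const rec_Suc rec_diff rec_pair rec_pfst rec_psnd
  rec_chd rec_ctl rec_cnth rec_clen
lemmas dec_intros = dec_not dec_conj dec_disj dec_imp dec_iff dec_eq dec_le dec_less

text \<open>A tree of coded lists, newest entry first, that refers to itself: the condition on \<open>v\<close> may depend
  on the membership of a node named by the newest entry of \<open>v\<close>, whose code is smaller than \<open>v\<close>.\<close>

function tree :: "(nat \<Rightarrow> bool) \<Rightarrow> (nat \<Rightarrow> bool) \<Rightarrow> nat \<Rightarrow> bool" where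
  "tree P P' v = (if v = 0 then True
     else tree P P' (ctl v) \<and> P v \<and> (tree P P' (pfst (chd v)) \<longrightarrow> P' v))"
  by pat_completeness auto
termination
proof (relation "measure (\<lambda>(_, _, v). v)")
  fix v :: nat assume "v \<noteq> 0"
  then have "ctl v < v" "pfst (chd v) < v"
    using ctl_less chd_less pfst_le[of "chd v"] by (auto intro: le_less_trans)
  then show "((P, P', ctl v), P, P', v) \<in> measure (\<lambda>(_, _, v). v)"
    "((P, P', pfst (chd v)), P, P', v) \<in> measure (\<lambda>(_, _, v). v)"
    for P P' :: "nat \<Rightarrow> bool" by simp_all
qed simp

declare tree.simps [simp del]

lemma tree_0 [simp]: "tree P P' 0" by (simp add: tree.simps)

text \<open>Course-of-values recursion. \<open>hist n\<close> codes the truth values of the tree at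
  all numbers below \<open>n\<close>, newest first, so the value at j stands at position n - 1 - j.
  \<open>F\<close> computes the next value; both numbers that it looks up, \<open>ctl n\<close> and
  \<open>pfst (chd n)\<close>, are smaller than \<open>n\<close> unless \<open>n\<close> is
  0.\<close>

lemma dec_tree:
  assumes P: "dec X P" and P': "dec X P'"
  shows "dec X (tree P P')"
proof -
  let ?t = "tree P P'"
  define F where "F m l = (if m = 0 \<or> cnth l (m - 1 - ctl m) = 1 \<and> P m \<and>
    (cnth l (m - 1 - pfst (chd m)) = 1 \<longrightarrow> P' m) then 1 else (0 :: nat))" for m l
  define hist where "hist n = rec_nat 0 (\<lambda>m l. ccons (F m l) l) n" for n
  have hist: "list_decode (hist n) = map (\<lambda>v. if ?t v then 1 else 0) (rev [0..<n])" for n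
  proof (induction n)
    case 0
    show ?case by (simp add: hist_def)
  next
    case (Suc n)
    have look: "cnth (hist n) (n - 1 - j) = (if ?t j then 1 else 0)" if "j < n" for j
    proof -
      have "n - 1 - j < clen (hist n)" using that by (simp add: clen_def Suc)
      then show ?thesis using that by (simp add: cnth_eq Suc rev_nth)
    qed
    have "pfst (chd n) < n" if "n \<noteq> 0"
      using chd_less[OF that] pfst_le[of "chd n"] by simp
    then have "F n (hist n) = (if ?t n then 1 else 0)"
      using look[of "ctl n"] look[of "pfst (chd n)"] ctl_less[of n]
      by (cases "n = 0") (simp_all add: F_def tree.simps[of P P' n])
    then show ?case using Suc by (simp add: hist_def)
  qed
  have "(if ?t n then 1 else 0) = chd (hist (Suc n))" for n
    using hist[of "Suc n"] by (simp add: hist_def)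
  moreover have "rec X (\<lambda>n. chd (hist (Suc n)))"
    unfolding hist_def F_def
    by (rule rec_chd, rule rec_nat_param)
      (intro rec_intros dec_intros rec_If dec_comp[OF P] dec_comp[OF P'])+
  ultimately show ?thesis unfolding dec_def by simp
qed

text \<open>The Kleene--Brouwer order; extensions of a list precede it.\<close>

fun kb :: "nat list \<Rightarrow> nat list \<Rightarrow> bool" where
  "kb [] ys = False"
| "kb (x # xs) [] = True"
| "kb (x # xs) (y # ys) = (x < y \<or> x = y \<and> kb xs ys)"

lemma kb_total: "xs \<noteq> ys \<Longrightarrow> kb xs ys \<or> kb ys xs"
proof (induction xs ys rule: kb.induct)
  case (1 ys)
  then show ?case by (cases ys) auto
qed auto

lemma kb_snoc: "kb (xs @ [x]) xs"
  by (induction xs) auto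

lemma kb_iff: "kb xs ys \<longleftrightarrow> (\<exists>i<length xs. i \<le> length ys \<and> (\<forall>j<i. xs ! j = ys ! j) \<and>
    (i = length ys \<or> xs ! i < ys ! i))"
  by (induction xs ys rule: kb.induct) (auto simp: Ex_less_Suc2 All_less_Suc2)

text \<open>Directed from child to parent, so that well-foundedness excludes infinite
  branches.\<close>

definition children :: "nat list set \<Rightarrow> (nat list \<times> nat list) set" where
  "children Tr = {(xs @ [x], xs) | xs x. xs @ [x] \<in> Tr}"

text \<open>A descending chain need not start at the root. But its i-th node has length at least i
  and is extended by all later nodes, so entry j of the branch can be read off from node
  \<open>Suc j\<close>.\<close>

lemma branch_of_not_wf:
  assumes closed: "\<And>xs x. xs @ [x] \<in> Tr \<Longrightarrow> xs \<in> Tr" and "\<not> wf (children Tr)"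
  obtains g where "\<And>m. map g [0..<m] \<in> Tr"
proof -
  obtain f where "\<And>i. (f (Suc i), f i) \<in> children Tr"
    using assms(2) unfolding wf_iff_no_infinite_down_chain by blast
  then have "\<exists>x. f (Suc i) = f i @ [x] \<and> f (Suc i) \<in> Tr" for i
    unfolding children_def by fastforce
  then have f: "\<exists>x. f (Suc i) = f i @ [x]" "f (Suc i) \<in> Tr" for i by blast+
  have take: "take m xs \<in> Tr" if "xs \<in> Tr" for m xs
    using that
  proof (induction xs rule: rev_induct)
    case (snoc x xs)
    then show ?case using closed by (cases "m \<le> length xs") auto
  qed simp
  have len: "i \<le> length (f i)" for i
  proof (induction i)
    case (Suc i)
    then show ?case using f(1)[of i] by auto
  qed simp
  have ext: "f (i + d) ! j = f i ! j" if "j < length (f i)" for i d j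
  proof (induction d)
    case (Suc d)
    have "length (f i) \<le> length (f (i + d))"
    proof (induction d)
      case (Suc d)
      then show ?case using f(1)[of "i + d"] by auto
    qed simp
    then show ?case using f(1)[of "i + d"] that Suc by (auto simp: nth_append)
  qed simp
  have "map (\<lambda>j. f (Suc j) ! j) [0..<m] = take m (f (Suc m))" for m
  proof (rule nth_equalityI)
    show "length (map (\<lambda>j. f (Suc j) ! j) [0..<m]) = length (take m (f (Suc m)))"
      using len[of "Suc m"] by simp
    fix j assume "j < length (map (\<lambda>j. f (Suc j) ! j) [0..<m])"
    then show "map (\<lambda>j. f (Suc j) ! j) [0..<m] ! j = take m (f (Suc m)) ! j"
      using ext[of j "Suc j" "m - j"] len[of "Suc j"] by simp
  qed
  then show ?thesis using that[of "\<lambda>j. f (Suc j) ! j"] take f(2) by metis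
qed

text \<open>A minimum is found by descending through the tree: below a node \<open>s\<close>, take
  the least first entry \<open>x\<close> that occurs among the remaining lists and continue below
  \<open>s @ [x]\<close>. The descent ends by well-foundedness of \<open>children Tr\<close>; the
  empty list is only chosen if nothing extends it, since extensions come first.\<close>

lemma wf_kb:
  assumes closed: "\<And>xs x. xs @ [x] \<in> Tr \<Longrightarrow> xs \<in> Tr" and wf: "wf (children Tr)"
  shows "wf {(xs, ys). xs \<in> Tr \<and> ys \<in> Tr \<and> kb xs ys}"
proof -
  have closed': "xs @ ys \<in> Tr \<Longrightarrow> xs \<in> Tr" for xs ys
  proof (induction ys rule: rev_induct)
    case (snoc y ys)
    then show ?case using closed[of "xs @ ys" y] by simp
  qed simp
  have min: "\<exists>m\<in>Q. \<forall>y\<in>Q. \<not> kb y m" if "Q \<noteq> {}" "Q \<subseteq> {xs. s @ xs \<in> Tr}" for s Q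
    using wf that
  proof (induction s arbitrary: Q rule: wf_induct_rule)
    case (less s)
    show ?case
    proof (cases "Q \<subseteq> {[]}")
      case True
      then show ?thesis using less.prems(1) by (metis kb.simps(1) all_not_in_conv singletonD subsetD)
    next
      case False
      then have ex: "\<exists>x xs. x # xs \<in> Q" by (auto simp: neq_Nil_conv subset_iff)
      define x where "x = (LEAST x. \<exists>xs. x # xs \<in> Q)"
      have x: "\<exists>xs. x # xs \<in> Q" unfolding x_def using ex by (rule LeastI_ex)
      have le: "x \<le> y" if "y # ys \<in> Q" for y ys
        unfolding x_def by (rule Least_le) (use that in blast)
      let ?Q = "{xs. x # xs \<in> Q}"
      have sub: "?Q \<subseteq> {xs. (s @ [x]) @ xs \<in> Tr}" using less.prems(2) by auto
      then have "s @ [x] \<in> Tr" using x closed'[of "s @ [x]"] by blast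
      then obtain m where m: "m \<in> ?Q" "\<forall>y\<in>?Q. \<not> kb y m"
        using less.IH[of "s @ [x]" ?Q] sub x unfolding children_def by blast
      have "\<not> kb y (x # m)" if "y \<in> Q" for y
        using m(2) that le by (cases y) (auto simp: not_less dest: le)
      then show ?thesis using m(1) by blast
    qed
  qed
  show ?thesis
  proof (rule wfI_min)
    fix a :: "nat list" and Q assume a: "a \<in> Q"
    show "\<exists>z\<in>Q. \<forall>y. (y, z) \<in> {(xs, ys). xs \<in> Tr \<and> ys \<in> Tr \<and> kb xs ys} \<longrightarrow> y \<notin> Q"
    proof (cases "Q \<inter> Tr = {}")
      case True
      then show ?thesis using a by blast
    next
      case False
      from min[OF this, of "[]"] show ?thesis by auto
    qed
  qed
qed


text \<open>Codes have the newest entry first, whereas the order compares from the root, hence the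
  reversal. After it the characterization \<open>kb_iff\<close> has only bounded
  quantifiers.\<close>

lemma dec_kb:
  assumes f: "rec X f" and g: "rec X g"
  shows "dec X (\<lambda>n. kb (rev (list_decode (f n))) (rev (list_decode (g n))))"
proof -
  have "kb (rev (list_decode a)) (rev (list_decode b)) \<longleftrightarrow>
     (\<exists>i<clen a. i \<le> clen b \<and> (\<forall>j<i. cnth a (clen a - Suc j) = cnth b (clen b - Suc j)) \<and>
     (i = clen b \<or> cnth a (clen a - Suc i) < cnth b (clen b - Suc i)))" for a b
  proof -
    have *: "i < clen v \<Longrightarrow> rev (list_decode v) ! i = cnth v (clen v - Suc i)" for i v
      by (simp add: rev_nth cnth_eq clen_def)
    show ?thesis unfolding kb_iff length_rev clen_def[symmetric]
    proof (intro iff_exI conj_cong refl)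
      fix i assume i: "i < clen a" "i \<le> clen b"
      then show "(\<forall>j<i. rev (list_decode a) ! j = rev (list_decode b) ! j) \<longleftrightarrow>
        (\<forall>j<i. cnth a (clen a - Suc j) = cnth b (clen b - Suc j))" by (simp add: *)
      show "(i = clen b \<or> rev (list_decode a) ! i < rev (list_decode b) ! i) \<longleftrightarrow>
        (i = clen b \<or> cnth a (clen a - Suc i) < cnth b (clen b - Suc i))"
        using i by (cases "i = clen b") (simp_all add: *)
    qed
  qed
  moreover have "dec X (\<lambda>n. \<exists>i<clen (f n). i \<le> clen (g n) \<and>
     (\<forall>j<i. cnth (f n) (clen (f n) - Suc j) = cnth (g n) (clen (g n) - Suc j)) \<and>
     (i = clen (g n) \<or> cnth (f n) (clen (f n) - Suc i) < cnth (g n) (clen (g n) - Suc i)))"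
    by (intro dec_bex dec_ball rec_intros dec_intros rec_comp[OF f] rec_comp[OF g] f g)
  ultimately show ?thesis by simp
qed

text \<open>\<open>Q s c s'\<close> means that \<open>s'\<close> is an admissible response to the challenge \<open>c\<close> at \<open>s\<close>.\<close>

function safe :: "(nat \<Rightarrow> nat \<Rightarrow> nat \<Rightarrow> bool) \<Rightarrow> omega1 \<Rightarrow> nat \<Rightarrow> bool" where
  "safe Q b s = (\<forall>a\<in>{..<b}. \<forall>c. \<exists>s'. Q s c s' \<and> safe Q a s')"
  by pat_completeness auto
termination
  by (relation "inv_image {(a, b). a < b} (\<lambda>(_, b, _). b)") (auto simp: wf wf_inv_image)

declare safe.simps [simp del]

text \<open>On a well-founded decidable tree the Kleene-Brouwer order is a decidable well-order, and
  a child precedes its parent in it. So the rank of computable well-orders also decreases along the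
  tree.\<close>

lemma tree_rank:
  assumes t: "dec X t" and closed: "\<And>xs x. t (list_encode (rev (xs @ [x]))) \<Longrightarrow> t (list_encode (rev xs))"
    and wf: "wf (children {xs. t (list_encode (rev xs))})"
  obtains \<rho> :: "nat \<Rightarrow> omega1" where "\<And>v. t v \<Longrightarrow> \<rho> v < omega1_CK X"
    "\<And>x v. t (ccons x v) \<Longrightarrow> \<rho> (ccons x v) < \<rho> v"
proof -
  define nodes where "nodes v = rev (list_decode v)" for v
  have nodes: "list_encode (rev (nodes v)) = v" "nodes v = nodes u \<longleftrightarrow> v = u"
    "nodes (ccons x v) = nodes v @ [x]" for u v x
    by (simp_all add: nodes_def list_decode_ccons del: list_decode.simps) (metis list_decode_inverse)
  define R where "R = {(a, b). t a \<and> t b \<and> (a = b \<or> kb (nodes a) (nodes b))}"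
  have "R - Id \<subseteq> inv_image {(xs, ys). xs \<in> {xs. t (list_encode (rev xs))} \<and>
      ys \<in> {xs. t (list_encode (rev xs))} \<and> kb xs ys} nodes"
    unfolding R_def by (auto simp: inv_image_def nodes)
  moreover have "wf (inv_image {(xs, ys). xs \<in> {xs. t (list_encode (rev xs))} \<and>
      ys \<in> {xs. t (list_encode (rev xs))} \<and> kb xs ys} nodes)"
    by (intro wf_inv_image wf_kb wf) (use closed in blast)
  ultimately have wfR: "wf (R - Id)" by (rule wf_subset[rotated])
  have F: "Field R = {v. t v}" unfolding R_def Field_def by auto
  have total: "(a, b) \<in> R \<or> (b, a) \<in> R" if "t a" "t b" for a b
    using that kb_total[of "nodes a" "nodes b"] nodes(2) unfolding R_def by auto
  have as: False if "(a, b) \<in> R - Id" "(b, a) \<in> R - Id" for a b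
    using wf_not_sym[OF wfR] that by blast
  have "Well_order R"
  proof (rule Well_order_wf[OF wfR])
    show "refl_on (Field R) R" unfolding F by (auto simp: refl_on_def R_def)
    show "total_on (Field R) R" unfolding F using total by (auto simp: total_on_def)
    show "antisym R" using as by (auto simp: antisym_def)
    \<comment> \<open>By totality a failure of transitivity would give a cycle through
      \<open>a\<close>, \<open>b\<close> and \<open>c\<close>, against well-foundedness.\<close>
    show "trans R"
    proof (rule transI)
      fix a b c assume ab: "(a, b) \<in> R" and bc: "(b, c) \<in> R"
      then have "t a" "t c" by (auto simp: R_def)
      show "(a, c) \<in> R"
      proof (rule ccontr)
        assume ac: "(a, c) \<notin> R"
        then have "(c, a) \<in> R" using total \<open>t a\<close> \<open>t c\<close> by blast
        moreover have "a \<noteq> b" "b \<noteq> c" using ab bc ac by auto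
        moreover have "c \<noteq> a" using ac \<open>t a\<close> by (auto simp: R_def)
        ultimately have "(a, a) \<in> (R - Id)\<^sup>+" using ab bc
          by (meson DiffI pair_in_Id_conv trancl.simps)
        then show False using wfR wf_trancl[of "R - Id"] by (meson wf_irrefl)
      qed
    qed
  qed
  moreover have "dec X (\<lambda>n. (pfst n, psnd n) \<in> R)"
    unfolding R_def nodes_def mem_Collect_eq case_prod_conv
    by (intro dec_intros dec_kb dec_comp[OF t] rec_intros)
  ultimately obtain \<rho> where \<rho>: "\<And>a. a \<in> Field R \<Longrightarrow> \<rho> a < omega1_CK X"
    "\<And>a b. (a, b) \<in> R \<Longrightarrow> a \<noteq> b \<Longrightarrow> \<rho> a < \<rho> b"
    using computable_well_order_rank by blast
  show ?thesis
  proof (rule that[of \<rho>])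
    show "t v \<Longrightarrow> \<rho> v < omega1_CK X" for v using \<rho>(1) F by simp
    show "\<rho> (ccons x v) < \<rho> v" if "t (ccons x v)" for x v
    proof (rule \<rho>(2))
      have "t v" using closed[of "nodes v" x] that nodes(1)[of "ccons x v"] nodes(1)[of v]
        by (simp only: nodes(3))
      then show "(ccons x v, v) \<in> R" using that kb_snoc unfolding R_def by (simp add: nodes)
      show "ccons x v \<noteq> v"
        using nodes(3)[of x v] by auto
    qed
  qed
qed

text \<open>The idea: attempts to witness safety form a computable tree which is indexed by itself.
  The elements of a branch \<open>g\<close> are pairs of a node and a state; \<open>g (Suc \<langle>k, x, c\<rangle>)\<close> belongs to the
  child \<open>x\<close> of the node of \<open>g k\<close> and, if that child is in the tree, answers the challenge \<open>c\<close>.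
  A branch yields a set of states that is closed under responses.  If there is none, then the tree
  has a rank below \<open>omega1_CK X\<close>, and safety of that rank suffices to construct a branch.\<close>

theorem safe_below_CK:
  assumes Q: "dec X (\<lambda>v. Q (pfst v) (pfst (psnd v)) (psnd (psnd v)))"
    and safe: "\<And>b. b < omega1_CK X \<Longrightarrow> safe Q b s0"
  obtains J where "s0 \<in> J" "\<And>s c. s \<in> J \<Longrightarrow> \<exists>s'\<in>J. Q s c s'"
proof -
  \<comment> \<open>If the newest entry of \<open>v\<close> has number \<open>Suc n\<close>, then
    \<open>ix v\<close> is n, to be read as the triple of k, x and c. As k is at most n, entry k is
    already present; the list has its newest entry first, so \<open>ent v\<close> counts from the
    other end.\<close>
  define ix where "ix v = clen (ctl v) - 1" for v
  define ent where "ent v = cnth (ctl v) (clen (ctl v) - 1 - pfst (ix v))" for v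
  \<comment> \<open>\<open>P\<close> fixes the node named by the newest entry and thus does not
    refer to the tree; entry 0 names the root and has state \<open>s0\<close>. Only
    \<open>P'\<close>, which judges the answer, is subject to membership of that node.\<close>
  define P where "P v \<longleftrightarrow> (if clen (ctl v) = 0 then chd v = pr 0 s0
    else pfst (chd v) = ccons (pfst (psnd (ix v))) (pfst (ent v)))" for v
  define P' where "P' v \<longleftrightarrow> clen (ctl v) = 0 \<or> Q (psnd (ent v)) (psnd (psnd (ix v))) (psnd (chd v))" for v
  define t where "t = tree P P'"
  define code where "code xs = list_encode (rev xs)" for xs :: "nat list"
  have code_simps: "code [] = 0" "code (xs @ [x]) = ccons x (code xs)" for xs x
    by (simp_all add: code_def)
  have t0: "t 0" by (simp add: t_def)
  have len: "clen (ctl (code (xs @ [y]))) = length xs" for xs y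
    by (simp add: code_simps(2)) (simp add: code_def clen_def)
  have ent: "ent (code (xs @ [y])) = xs ! pfst (length xs - 1)" if "xs \<noteq> []" for xs y
  proof -
    have "pfst (length xs - 1) \<le> length xs - 1" by (rule pfst_le)
    then have lt: "pfst (length xs - 1) < length xs" using that by (cases xs) auto
    have "length xs - 1 - pfst (length xs - 1) < clen (code xs)"
      using that by (cases xs) (auto simp: code_def clen_def)
    then show ?thesis
      unfolding ent_def ix_def len using lt that
      by (simp add: code_simps(2) cnth_eq) (simp add: code_def rev_nth)
  qed
  have t_snoc: "t (code (xs @ [y])) \<longleftrightarrow> t (code xs) \<and>
      (if xs = [] then y = pr 0 s0 else let k = pfst (length xs - 1); e = psnd (length xs - 1) in
        pfst y = ccons (pfst e) (pfst (xs ! k)) \<and>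
        (t (pfst y) \<longrightarrow> Q (psnd (xs ! k)) (psnd e) (psnd y)))" for xs y
  proof -
    have "t (code (xs @ [y])) \<longleftrightarrow> t (code xs) \<and> P (code (xs @ [y])) \<and> (t (pfst y) \<longrightarrow> P' (code (xs @ [y])))"
      unfolding t_def by (subst tree.simps) (simp add: code_simps(2))
    moreover have "chd (code (xs @ [y])) = y" by (simp add: code_simps)
    ultimately show ?thesis
      using len[of xs y] ent[of xs y] by (cases "xs = []") (auto simp: P_def P'_def ix_def Let_def)
  qed
  have closed: "t (code (xs @ [x])) \<Longrightarrow> t (code xs)" for xs x using t_snoc by blast
  have rix: "rec X ix" unfolding ix_def by (intro rec_intros)
  have rent: "rec X ent" unfolding ent_def by (intro rec_intros rix)
  have dt: "dec X t"
    unfolding t_def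
  proof (rule dec_tree)
    have "dec X (\<lambda>v. (clen (ctl v) = 0 \<longrightarrow> chd v = pr 0 s0) \<and> (clen (ctl v) \<noteq> 0 \<longrightarrow>
        pfst (chd v) = ccons (pfst (psnd (ix v))) (pfst (ent v))))"
      by (intro dec_intros rec_intros rix rent)
    then show "dec X P" unfolding P_def by (simp add: if_bool_eq_conj)
    have "dec X (\<lambda>v. Q (psnd (ent v)) (psnd (psnd (ix v))) (psnd (chd v)))"
      using dec_comp[OF Q, of "\<lambda>v. pr (psnd (ent v)) (pr (psnd (psnd (ix v))) (psnd (chd v)))"]
      by (simp add: rec_intros rix rent)
    then show "dec X P'" unfolding P'_def by (intro dec_intros rec_intros)
  qed
  let ?Tr = "{xs. t (list_encode (rev xs))}"
  have nwf: "\<not> wf (children ?Tr)"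
  proof
    assume wf: "wf (children ?Tr)"
    obtain \<rho> where \<rho>: "\<And>v. t v \<Longrightarrow> \<rho> v < omega1_CK X" "\<And>x v. t (ccons x v) \<Longrightarrow> \<rho> (ccons x v) < \<rho> v"
      using tree_rank[OF dt _ wf] closed[unfolded code_def] by metis
    \<comment> \<open>Invariant: an entry whose node is in the tree carries a state that is safe for
      the rank of this node. A child in the tree has a parent in the tree and a smaller rank, so
      safety of the parent state supplies an answer; for a child outside the tree any state will do.
      Thus good lists extend forever.\<close>
    define good where "good xs \<longleftrightarrow> t (code xs) \<and>
      (\<forall>k<length xs. t (pfst (xs ! k)) \<longrightarrow> safe Q (\<rho> (pfst (xs ! k))) (psnd (xs ! k)))" for xs
    have step: "\<exists>y. good (xs @ [y])" if xs: "good xs" for xs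
    proof (cases "xs = []")
      case True
      have "safe Q (\<rho> 0) s0" using safe \<rho>(1)[OF t0] by blast
      then have "good (xs @ [pr 0 s0])" unfolding good_def t_snoc using True t0 by (simp add: code_simps)
      then show ?thesis ..
    next
      case False
      define k e where "k = pfst (length xs - 1)" and "e = psnd (length xs - 1)"
      have "pfst (length xs - 1) \<le> length xs - 1" by (rule pfst_le)
      then have k: "k < length xs" using False by (cases xs) (auto simp: k_def)
      let ?v = "ccons (pfst e) (pfst (xs ! k))"
      obtain s' where s': "t ?v \<Longrightarrow> Q (psnd (xs ! k)) (psnd e) s' \<and> safe Q (\<rho> ?v) s'"
      proof (cases "t ?v")
        case True
        then have "t (pfst (xs ! k))"
          using closed[of "rev (list_decode (pfst (xs ! k)))" "pfst e"]
          by (simp only: code_simps(2)) (simp add: code_def)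
        then have "safe Q (\<rho> (pfst (xs ! k))) (psnd (xs ! k))" using xs k unfolding good_def by blast
        then show ?thesis using \<rho>(2)[OF True] that by (subst (asm) safe.simps) blast
      qed (use that in blast)
      have "good (xs @ [pr ?v s'])"
        using xs s' False unfolding good_def t_snoc
        by (auto simp: Let_def nth_append less_Suc_eq k_def e_def)
      then show ?thesis ..
    qed
    have "good []" by (simp add: good_def code_simps t0)
    then obtain xs where "good xs" "\<And>ys. (ys, xs) \<in> children ?Tr \<Longrightarrow> \<not> good ys"
      using wfE_min[OF wf, of "[]" "Collect good"] by auto
    moreover obtain y where "good (xs @ [y])" using step \<open>good xs\<close> by blast
    moreover have "(xs @ [y], xs) \<in> children ?Tr"
      using \<open>good (xs @ [y])\<close> unfolding children_def good_def code_def by blast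
    ultimately show False by blast
  qed
  obtain g where "\<And>m. map g [0..<m] \<in> ?Tr"
    using branch_of_not_wf[OF _ nwf] closed[unfolded code_def] by blast
  then have g: "t (code (map g [0..<m]))" for m unfolding code_def by blast
  have g0: "g 0 = pr 0 s0" using g[of 1] t_snoc[of "[]" "g 0"] by simp
  have gS: "pfst (g (Suc n)) = ccons (pfst (psnd n)) (pfst (g (pfst n)))"
    "t (pfst (g (Suc n))) \<Longrightarrow> Q (psnd (g (pfst n))) (psnd (psnd n)) (psnd (g (Suc n)))" for n
  proof -
    have "map g [0..<Suc n] ! pfst n = g (pfst n)"
      using pfst_le[of n] by (auto simp: nth_append)
    moreover have "t (code (map g [0..<Suc n] @ [g (Suc n)]))" using g[of "Suc (Suc n)"] by simp
    ultimately show "pfst (g (Suc n)) = ccons (pfst (psnd n)) (pfst (g (pfst n)))"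
      "t (pfst (g (Suc n))) \<Longrightarrow> Q (psnd (g (pfst n))) (psnd (psnd n)) (psnd (g (Suc n)))"
      using t_snoc[of "map g [0..<Suc n]" "g (Suc n)"]
      by (simp_all add: Let_def del: upt_Suc)
  qed
  \<comment> \<open>Only entries whose node is an initial segment of the branch \<open>g\<close>
    itself count. These nodes are in the tree, so their answers are genuine.\<close>
  let ?J = "{psnd (g k) | k. \<exists>m. pfst (g k) = code (map g [0..<m])}"
  show ?thesis
  proof (rule that[of ?J])
    have "psnd (g 0) = s0" "pfst (g 0) = code (map g [0..<0])" using g0 by (simp_all add: code_simps)
    then show "s0 \<in> ?J" by blast
    fix s c assume "s \<in> ?J"
    then obtain k m where k: "s = psnd (g k)" "pfst (g k) = code (map g [0..<m])" by blast
    \<comment> \<open>With the child number \<open>g m\<close>, the node of entry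
      \<open>Suc n\<close> is the next longer initial segment of \<open>g\<close>.\<close>
    define n where "n = pr k (pr (g m) c)"
    have n: "pfst (g (Suc n)) = code (map g [0..<Suc m])"
      using gS(1)[of n] k(2) by (simp add: n_def code_simps)
    then have "Q s c (psnd (g (Suc n)))"
      using gS(2)[of n] g[of "Suc m"] k(1) by (simp add: n_def)
    then show "\<exists>s'\<in>?J. Q s c s'" using n by blast
  qed
qed


section \<open>Satisfaction, soundness and back-and-forth systems\<close>

lemma val_cong: "(\<And>i. i \<in> fv_tm t \<Longrightarrow> e i = e' i) \<Longrightarrow> val M e t = val M e' t"
proof (induction t)
  case (Fn f ts)
  have "val M e t = val M e' t" if "t \<in> set ts" for t
  proof (rule Fn.IH[OF that])
    show "e i = e' i" if "i \<in> fv_tm t" for i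
      by (rule Fn.prems) (use that \<open>t \<in> set ts\<close> in auto)
  qed
  then have "map (val M e) ts = map (val M e') ts" by simp
  then show ?case by (simp only: val.simps)
next
  case (Var i)
  show ?case unfolding val.simps by (rule Var) simp
qed

lemma fv_CConj: "\<phi> \<in> rcset F \<Longrightarrow> i \<in> fv \<phi> \<Longrightarrow> i \<in> fv (CConj F)"
  and fv_CDisj: "\<phi> \<in> rcset F \<Longrightarrow> i \<in> fv \<phi> \<Longrightarrow> i \<in> fv (CDisj F)"
  by (auto simp: cimage.rep_eq)

lemma sat_cong: "(\<And>i. i \<in> fv \<phi> \<Longrightarrow> e i = e' i) \<Longrightarrow> sat M \<phi> e \<longleftrightarrow> sat M \<phi> e'"
proof (induction \<phi> arbitrary: e e')
  case (Eq s t)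
  have "val M e s = val M e' s" "val M e t = val M e' t" by (rule val_cong, rule Eq, simp)+
  then show ?case by simp
next
  case (Rel r ts)
  have "val M e t = val M e' t" if "t \<in> set ts" for t
  proof (rule val_cong)
    show "e i = e' i" if "i \<in> fv_tm t" for i
      by (rule Rel) (use that \<open>t \<in> set ts\<close> in auto)
  qed
  then have "map (val M e) ts = map (val M e') ts" by simp
  then show ?case by (simp only: sat.simps)
next
  case (CConj F)
  have "sat M \<phi> e \<longleftrightarrow> sat M \<phi> e'" if "\<phi> \<in> rcset F" for \<phi>
    by (rule CConj.IH[OF that], rule CConj.prems, rule fv_CConj[OF that])
  then show ?case unfolding sat_CConj by blast
next
  case (CDisj F)
  have "sat M \<phi> e \<longleftrightarrow> sat M \<phi> e'" if "\<phi> \<in> rcset F" for \<phi>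
    by (rule CDisj.IH[OF that], rule CDisj.prems, rule fv_CDisj[OF that])
  then show ?case unfolding sat_CDisj by blast
next
  case (Ex \<phi>)
  have "sat M \<phi> (case_nat x e) \<longleftrightarrow> sat M \<phi> (case_nat x e')" for x
  proof (rule Ex.IH)
    show "case_nat x e i = case_nat x e' i" if "i \<in> fv \<phi>" for i
      using Ex.prems[of "i - 1"] that by (cases i) simp_all
  qed
  then show ?case by simp
next
  case (All \<phi>)
  have "sat M \<phi> (case_nat x e) \<longleftrightarrow> sat M \<phi> (case_nat x e')" for x
  proof (rule All.IH)
    show "case_nat x e i = case_nat x e' i" if "i \<in> fv \<phi>" for i
      using All.prems[of "i - 1"] that by (cases i) simp_all
  qed
  then show ?case by simp
next
  case (Neg \<phi>)
  have "sat M \<phi> e \<longleftrightarrow> sat M \<phi> e'" by (rule Neg.IH, rule Neg.prems) simp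
  then show ?case by simp
qed

lemma val_subst_tm: "val M e (subst_tm \<sigma> t) = val M (\<lambda>i. val M e (\<sigma> i)) t"
  by (induction t) (auto simp: comp_def cong: map_cong)

lemma val_up: "(\<lambda>i. val M (case_nat x e) (up \<sigma> i)) = case_nat x (\<lambda>i. val M e (\<sigma> i))"
  by (rule ext) (auto simp: up_def val_subst_tm split: nat.split)

lemma sat_subst: "sat M (subst \<phi> \<sigma>) e \<longleftrightarrow> sat M \<phi> (\<lambda>i. val M e (\<sigma> i))"
proof (induction \<phi> arbitrary: \<sigma> e)
  case (CConj F)
  then show ?case by (simp only: subst.simps sat_CConj) (simp add: cimage.rep_eq)
next
  case (CDisj F)
  then show ?case by (simp only: subst.simps sat_CDisj) (simp add: cimage.rep_eq)
qed (auto simp: val_subst_tm comp_def val_up cong: map_cong)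

lemma sat_lift: "sat M (lift_fm \<phi>) (case_nat x e) \<longleftrightarrow> sat M \<phi> e"
  by (simp add: lift_fm_def sat_subst)

lemma sat_inst: "sat M (inst \<phi> t) e \<longleftrightarrow> sat M \<phi> (case_nat (val M e t) e)"
proof -
  have "(\<lambda>i. val M e (case i of 0 \<Rightarrow> t | Suc i \<Rightarrow> Var i)) = case_nat (val M e t) e"
    by (rule ext) (simp split: nat.split)
  then show ?thesis by (simp add: inst_def sat_subst)
qed

lemma assignment_case_nat: "assignment M e \<Longrightarrow> x \<in> univ M \<Longrightarrow> assignment M (case_nat x e)"
  by (auto simp: assignment_def image_subset_iff split: nat.split)

lemma val_in_univ:
  assumes "structure_of V M" "wf_tm V t" "\<And>i. i \<in> fv_tm t \<Longrightarrow> e i \<in> univ M"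
  shows "val M e t \<in> univ M"
  using assms(2,3)
proof (induction t)
  case (Fn f ts)
  then have "set (map (val M e) ts) \<subseteq> univ M" by (auto simp: list_all_iff)
  moreover have "funar V f = Some (length (map (val M e) ts))" using Fn.prems by simp
  ultimately show ?case using assms(1) unfolding structure_of_def val.simps by blast
qed simp

text \<open>Assumptions and conclusion are read under one assignment, which varies in the induction
  because \<open>allI\<close> and \<open>exE\<close> shift variables. Soundness serves twice later:
  realized types are consistent, and a generator of a principal type forces all of it.\<close>

lemma fderiv_sound:
  assumes "structure_of V M"
  shows "fderiv V \<Gamma> \<psi> \<Longrightarrow> assignment M e \<Longrightarrow> (\<And>\<gamma>. \<gamma> \<in> \<Gamma> \<Longrightarrow> sat M \<gamma> e) \<Longrightarrow> sat M \<psi> e"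
proof (induction arbitrary: e rule: fderiv.induct)
  case (negI \<phi> \<Gamma> \<psi>)
  then show ?case by (metis insert_iff sat.simps(3))
next
  case (contr \<phi> \<Gamma> \<psi>)
  then show ?case by (metis insert_iff sat.simps(3))
next
  case (disjE F \<Gamma> \<chi>)
  then show ?case by (metis insert_iff sat_CDisj)
next
  case (allI \<Gamma> \<phi>)
  show ?case unfolding sat.simps
    by (intro ballI allI.IH assignment_case_nat allI.prems) (auto simp: sat_lift allI.prems)
next
  case (allE \<Gamma> \<phi> t)
  have "val M e t \<in> univ M"
    using val_in_univ[OF assms allE.hyps(2)] allE.prems(1) by (auto simp: assignment_def)
  moreover have "sat M (All \<phi>) e" by (intro allE.IH allE.prems)
  ultimately show ?case by (simp add: sat_inst)
next
  case (exI \<Gamma> \<phi> t)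
  have "val M e t \<in> univ M"
    using val_in_univ[OF assms exI.hyps(2)] exI.prems(1) by (auto simp: assignment_def)
  moreover have "sat M (inst \<phi> t) e" by (intro exI.IH exI.prems)
  ultimately show ?case by (auto simp: sat_inst)
next
  case (exE \<Gamma> \<phi> \<chi>)
  obtain x where x: "x \<in> univ M" "sat M \<phi> (case_nat x e)" using exE.IH(1)[OF exE.prems] by auto
  have "sat M (lift_fm \<chi>) (case_nat x e)"
    by (intro exE.IH(2) assignment_case_nat exE.prems(1) x(1)) (auto simp: sat_lift exE.prems(2) x(2))
  then show ?case by (simp add: sat_lift)
next
  case (disjI \<Gamma> \<phi> F)
  then show ?case unfolding sat_CDisj by blast
next
  case (eq_subst \<Gamma> s t \<phi>)
  then show ?case by (metis sat.simps(1) sat_inst)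
qed (simp_all add: sat_CConj sat_CDisj cimage.rep_eq del: sat.simps(4,5))

text \<open>Only unnested atomic formulas have to be preserved; in a back-and-forth system nested terms are
  handled by extending the partial isomorphism.\<close>

definition partial_iso :: "vocab \<Rightarrow> struct \<Rightarrow> struct \<Rightarrow> (nat \<times> nat) set \<Rightarrow> bool" where
  "partial_iso V A B z \<longleftrightarrow> z \<subseteq> univ A \<times> univ B \<and>
     (\<forall>x y x' y'. (x, y) \<in> z \<and> (x', y') \<in> z \<longrightarrow> (x = x' \<longleftrightarrow> y = y')) \<and>
     (\<forall>r w. relar V r = Some (length w) \<and> set w \<subseteq> z \<longrightarrow>
        irel A r (map fst w) = irel B r (map snd w)) \<and>
     (\<forall>f w x y. funar V f = Some (length w) \<and> set w \<subseteq> z \<and> (x, y) \<in> z \<longrightarrow>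
        (ifun A f (map fst w) = x \<longleftrightarrow> ifun B f (map snd w) = y))"

definition bf_system :: "vocab \<Rightarrow> struct \<Rightarrow> struct \<Rightarrow> (nat \<times> nat) set set \<Rightarrow> bool" where
  "bf_system V A B I \<longleftrightarrow> (\<forall>z\<in>I. partial_iso V A B z \<and>
     (\<forall>x\<in>univ A. \<exists>y. insert (x, y) z \<in> I) \<and> (\<forall>y\<in>univ B. \<exists>x. insert (x, y) z \<in> I))"

lemma bf_systemD:
  assumes "bf_system V A B I" "z \<in> I"
  shows bf_sub: "z \<subseteq> univ A \<times> univ B"
    and bf_inj: "\<And>x y x' y'. (x, y) \<in> z \<Longrightarrow> (x', y') \<in> z \<Longrightarrow> x = x' \<longleftrightarrow> y = y'"
    and bf_rel: "\<And>r w. relar V r = Some (length w) \<Longrightarrow> set w \<subseteq> z \<Longrightarrow>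
      irel A r (map fst w) = irel B r (map snd w)"
    and bf_fun: "\<And>f w x y. funar V f = Some (length w) \<Longrightarrow> set w \<subseteq> z \<Longrightarrow> (x, y) \<in> z \<Longrightarrow>
      ifun A f (map fst w) = x \<longleftrightarrow> ifun B f (map snd w) = y"
    and bf_forth: "\<And>x. x \<in> univ A \<Longrightarrow> \<exists>y. insert (x, y) z \<in> I"
    and bf_back: "\<And>y. y \<in> univ B \<Longrightarrow> \<exists>x. insert (x, y) z \<in> I"
proof -
  note c1 = bspec[OF assms(1)[unfolded bf_system_def partial_iso_def conj_assoc] assms(2)]
  note c2 = c1[THEN conjunct2] note c3 = c2[THEN conjunct2] note c4 = c3[THEN conjunct2]
  note c5 = c4[THEN conjunct2]
  show "z \<subseteq> univ A \<times> univ B" by (rule c1[THEN conjunct1])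
  show "(x, y) \<in> z \<Longrightarrow> (x', y') \<in> z \<Longrightarrow> x = x' \<longleftrightarrow> y = y'" for x y x' y'
    using c2[THEN conjunct1] by simp
  show "relar V r = Some (length w) \<Longrightarrow> set w \<subseteq> z \<Longrightarrow> irel A r (map fst w) = irel B r (map snd w)" for r w
    using c3[THEN conjunct1] by simp
  show "funar V f = Some (length w) \<Longrightarrow> set w \<subseteq> z \<Longrightarrow> (x, y) \<in> z \<Longrightarrow>
      ifun A f (map fst w) = x \<longleftrightarrow> ifun B f (map snd w) = y" for f w x y
    using c4[THEN conjunct1] by simp
  show "x \<in> univ A \<Longrightarrow> \<exists>y. insert (x, y) z \<in> I" for x
    using c5[THEN conjunct1] by simp
  show "y \<in> univ B \<Longrightarrow> \<exists>x. insert (x, y) z \<in> I" for y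
    using c5[THEN conjunct2] by simp
qed

context
  fixes V A B I
  assumes bf: "bf_system V A B I" and A: "structure_of V A" and B: "structure_of V B"
begin

lemma bf_term:
  assumes "z \<in> I" "wf_tm V t" "\<And>i. i \<in> fv_tm t \<Longrightarrow> (e i, e' i) \<in> z"
  shows "\<exists>z'\<in>I. z \<subseteq> z' \<and> (val A e t, val B e' t) \<in> z'"
  using assms
proof (induction t arbitrary: z)
  case (Fn f ts)
  have "\<exists>z'\<in>I. z \<subseteq> z' \<and> (\<forall>t\<in>set us. (val A e t, val B e' t) \<in> z')" if "set us \<subseteq> set ts" for us
    using that
  proof (induction us)
    case Nil
    show ?case using Fn.prems(1) by (intro bexI[of _ z]) auto
  next
    case (Cons u us)
    then obtain z1 where z1: "z1 \<in> I" "z \<subseteq> z1" "\<forall>t\<in>set us. (val A e t, val B e' t) \<in> z1"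
      by (meson set_subset_Cons subset_trans)
    have u: "u \<in> set ts" using Cons.prems by simp
    have "\<exists>z'\<in>I. z1 \<subseteq> z' \<and> (val A e u, val B e' u) \<in> z'"
    proof (rule Fn.IH[OF u z1(1)])
      show "wf_tm V u" using Fn.prems(2) u by (simp add: list_all_iff)
      show "(e i, e' i) \<in> z1" if "i \<in> fv_tm u" for i
        using Fn.prems(3)[of i] u that z1(2) by auto
    qed
    then obtain z2 where "z2 \<in> I" "z1 \<subseteq> z2" "(val A e u, val B e' u) \<in> z2" by blast
    then show ?case using z1(2,3) by (intro bexI[of _ z2]) auto
  qed
  then obtain z' where z': "z' \<in> I" "z \<subseteq> z'" "\<forall>t\<in>set ts. (val A e t, val B e' t) \<in> z'" by blast
  let ?w = "map (\<lambda>t. (val A e t, val B e' t)) ts"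
  have f: "funar V f = Some (length ?w)" using Fn.prems by simp
  have "set ?w \<subseteq> z'" using z'(3) by auto
  then have "set (map fst ?w) \<subseteq> univ A" using bf_sub[OF bf z'(1)] by fastforce
  moreover have "funar V f = Some (length (map fst ?w))" using f by simp
  ultimately have "ifun A f (map fst ?w) \<in> univ A" using A unfolding structure_of_def by blast
  then obtain y where y: "insert (ifun A f (map fst ?w), y) z' \<in> I"
    using bf_forth[OF bf z'(1)] by blast
  \<comment> \<open>The forth property chose \<open>y\<close> without regard to \<open>f\<close>;
    the clause for functions forces it to be the value in \<open>B\<close>.\<close>
  then have "ifun B f (map snd ?w) = y"
    using bf_fun[OF bf y f] \<open>set ?w \<subseteq> z'\<close> by blast
  then show ?case using z'(2) by (intro bexI[OF _ y]) (auto simp: comp_def)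
next
  case (Var i)
  have "(e i, e' i) \<in> z" by (rule Var.prems) simp
  then show ?case using Var.prems(1) by auto
qed

lemma bf_terms:
  assumes "z \<in> I" "list_all (wf_tm V) ts" "\<And>i. i \<in> \<Union> (set (map fv_tm ts)) \<Longrightarrow> (e i, e' i) \<in> z"
  shows "\<exists>z'\<in>I. z \<subseteq> z' \<and> (\<forall>t\<in>set ts. (val A e t, val B e' t) \<in> z')"
  using assms
proof (induction ts arbitrary: z)
  case (Cons t ts)
  have "\<exists>z'\<in>I. z \<subseteq> z' \<and> (val A e t, val B e' t) \<in> z'"
    by (rule bf_term[OF Cons.prems(1)]) (use Cons.prems(2) in simp, rule Cons.prems(3), simp)
  then obtain z1 where z1: "z1 \<in> I" "z \<subseteq> z1" "(val A e t, val B e' t) \<in> z1" by blast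
  have "\<exists>z'\<in>I. z1 \<subseteq> z' \<and> (\<forall>t\<in>set ts. (val A e t, val B e' t) \<in> z')"
  proof (rule Cons.IH[OF z1(1)])
    show "list_all (wf_tm V) ts" using Cons.prems(2) by simp
    show "(e i, e' i) \<in> z1" if "i \<in> \<Union> (set (map fv_tm ts))" for i
      by (rule subsetD[OF z1(2)], rule Cons.prems(3)) (use that in simp)
  qed
  then obtain z2 where "z2 \<in> I" "z1 \<subseteq> z2" "\<forall>t\<in>set ts. (val A e t, val B e' t) \<in> z2" by blast
  then show ?case using z1(2,3) by (intro bexI[of _ z2]) auto
qed auto

text \<open>Infinite conjunctions and disjunctions leave the position \<open>z\<close> unchanged,
  and a quantifier extends it by one pair. Hence a back-and-forth system preserves all infinitary
  formulas, of whatever rank.\<close>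

lemma bf_sat:
  assumes "z \<in> I" "wf_shape V \<phi>" "\<And>i. i \<in> fv \<phi> \<Longrightarrow> (e i, e' i) \<in> z"
  shows "sat A \<phi> e \<longleftrightarrow> sat B \<phi> e'"
  using assms
proof (induction \<phi> arbitrary: z e e')
  case (Eq s t)
  have "\<exists>z'\<in>I. z \<subseteq> z' \<and> (\<forall>u\<in>set [s, t]. (val A e u, val B e' u) \<in> z')"
    by (rule bf_terms[OF Eq(1)]) (use Eq(2) in simp, rule Eq(3), simp)
  then obtain z' where "z' \<in> I" "(val A e s, val B e' s) \<in> z'" "(val A e t, val B e' t) \<in> z'"
    by auto
  then show ?case using bf_inj[OF bf] by simp
next
  case (Rel r ts)
  have "\<exists>z'\<in>I. z \<subseteq> z' \<and> (\<forall>t\<in>set ts. (val A e t, val B e' t) \<in> z')"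
    by (rule bf_terms[OF Rel(1)]) (use Rel(2) in simp, rule Rel(3), simp)
  then obtain z' where z': "z' \<in> I" "\<forall>t\<in>set ts. (val A e t, val B e' t) \<in> z'" by blast
  show ?case
    using bf_rel[OF bf z'(1), of r "map (\<lambda>t. (val A e t, val B e' t)) ts"] z'(2) Rel.prems
    by (auto simp: comp_def)
next
  case (CConj F)
  have "sat A \<phi> e \<longleftrightarrow> sat B \<phi> e'" if "\<phi> \<in> rcset F" for \<phi>
  proof (rule CConj.IH[OF that CConj.prems(1)])
    show "wf_shape V \<phi>" using CConj.prems(2) that unfolding wf_shape_CConj by blast
    show "(e i, e' i) \<in> z" if "i \<in> fv \<phi>" for i
      by (rule CConj.prems(3), rule fv_CConj) fact+
  qed
  then show ?case unfolding sat_CConj by blast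
next
  case (CDisj F)
  have "sat A \<phi> e \<longleftrightarrow> sat B \<phi> e'" if "\<phi> \<in> rcset F" for \<phi>
  proof (rule CDisj.IH[OF that CDisj.prems(1)])
    show "wf_shape V \<phi>" using CDisj.prems(2) that unfolding wf_shape_CDisj by blast
    show "(e i, e' i) \<in> z" if "i \<in> fv \<phi>" for i
      by (rule CDisj.prems(3), rule fv_CDisj) fact+
  qed
  then show ?case unfolding sat_CDisj by blast
next
  case (Ex \<phi>)
  have "sat A \<phi> (case_nat x e) \<longleftrightarrow> sat B \<phi> (case_nat y e')" if "insert (x, y) z \<in> I" for x y
  proof (rule Ex.IH[OF that])
    show "wf_shape V \<phi>" using Ex.prems(2) by simp
    show "(case_nat x e i, case_nat y e' i) \<in> insert (x, y) z" if "i \<in> fv \<phi>" for i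
      using Ex.prems(3)[of "i - 1"] that by (cases i) simp_all
  qed
  moreover have "x \<in> univ A" "y \<in> univ B" if "insert (x, y) z \<in> I" for x y
    using bf_sub[OF bf that] by auto
  ultimately show ?case unfolding sat.simps
    using bf_forth[OF bf Ex.prems(1)] bf_back[OF bf Ex.prems(1)] by meson
next
  case (All \<phi>)
  have "sat A \<phi> (case_nat x e) \<longleftrightarrow> sat B \<phi> (case_nat y e')" if "insert (x, y) z \<in> I" for x y
  proof (rule All.IH[OF that])
    show "wf_shape V \<phi>" using All.prems(2) by simp
    show "(case_nat x e i, case_nat y e' i) \<in> insert (x, y) z" if "i \<in> fv \<phi>" for i
      using All.prems(3)[of "i - 1"] that by (cases i) simp_all
  qed
  moreover have "x \<in> univ A" "y \<in> univ B" if "insert (x, y) z \<in> I" for x y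
    using bf_sub[OF bf that] by auto
  ultimately show ?case unfolding sat.simps
    using bf_forth[OF bf All.prems(1)] bf_back[OF bf All.prems(1)] by meson
next
  case (Neg \<phi>)
  have "sat A \<phi> e \<longleftrightarrow> sat B \<phi> e'"
    by (rule Neg.IH[OF Neg.prems(1)]) (use Neg.prems(2) in simp, rule Neg.prems(3), simp)
  then show ?case by simp
qed

text \<open>Universes consist of natural numbers, so the stage number enumerates both: stage n puts
  n into the domain and into the range, if it belongs there. Finitely many pairs of the union
  \<open>G\<close> lie in one stage, so \<open>G\<close> inherits the clauses of
  \<open>partial_iso\<close>.\<close>

lemma bf_isomorphic:
  assumes "{} \<in> I" shows "isomorphic V A B"
proof -
  have step: "\<exists>z'\<in>I. z \<subseteq> z' \<and> (n \<in> univ A \<longrightarrow> (\<exists>y. (n, y) \<in> z')) \<and> (n \<in> univ B \<longrightarrow> (\<exists>x. (x, n) \<in> z'))"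
    if z: "z \<in> I" for n z
  proof -
    obtain z1 where z1: "z1 \<in> I" "z \<subseteq> z1" "n \<in> univ A \<longrightarrow> (\<exists>y. (n, y) \<in> z1)"
    proof (cases "n \<in> univ A")
      case True
      then obtain y where "insert (n, y) z \<in> I" using bf_forth[OF bf z] by blast
      then show ?thesis using that[of "insert (n, y) z"] by blast
    qed (use z that in blast)
    obtain z2 where "z2 \<in> I" "z1 \<subseteq> z2" "n \<in> univ B \<longrightarrow> (\<exists>y. (y, n) \<in> z2)"
    proof (cases "n \<in> univ B")
      case True
      then obtain x where "insert (x, n) z1 \<in> I" using bf_back[OF bf z1(1)] by blast
      then show ?thesis using that[of "insert (x, n) z1"] by blast
    qed (use z1 that in blast)
    then show ?thesis using z1 by (intro bexI[of _ z2]) auto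
  qed
  have "\<exists>f. \<forall>n. f n \<in> I \<and> f n \<subseteq> f (Suc n) \<and> (n \<in> univ A \<longrightarrow> (\<exists>y. (n, y) \<in> f (Suc n)))
      \<and> (n \<in> univ B \<longrightarrow> (\<exists>x. (x, n) \<in> f (Suc n)))"
    using assms step[unfolded Bex_def] by (intro dependent_nat_choice[of "\<lambda>_ z. z \<in> I"]) blast+
  then obtain f where f: "\<And>n. f n \<in> I" "\<And>n. f n \<subseteq> f (Suc n) \<and> (n \<in> univ A \<longrightarrow> (\<exists>y. (n, y) \<in> f (Suc n)))
      \<and> (n \<in> univ B \<longrightarrow> (\<exists>x. (x, n) \<in> f (Suc n)))"
    by meson
  have mono: "f m \<subseteq> f n" if "m \<le> n" for m n
    using that f(2) by (rule_tac lift_Suc_mono_le) auto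
  define G where "G = (\<Union>n. f n)"
  have fin: "\<exists>n. X \<subseteq> f n" if "finite X" "X \<subseteq> G" for X
    using that
  proof (induction X)
    case (insert a X)
    then obtain m n where "X \<subseteq> f m" "a \<in> f n" unfolding G_def by blast
    then have "insert a X \<subseteq> f (max m n)" using mono[of m "max m n"] mono[of n "max m n"] by auto
    then show ?case ..
  qed auto
  have inj: "x = x' \<longleftrightarrow> y = y'" if "(x, y) \<in> G" "(x', y') \<in> G" for x y x' y'
  proof -
    have "{(x, y), (x', y')} \<subseteq> G" using that by simp
    then obtain n where "{(x, y), (x', y')} \<subseteq> f n" using fin by (meson finite.intros)
    then show ?thesis using bf_inj[OF bf f(1), of x y n x' y'] by simp
  qed
  have sub: "G \<subseteq> univ A \<times> univ B" using bf_sub[OF bf f(1)] unfolding G_def by blast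
  have dom: "\<exists>y. (x, y) \<in> G" if "x \<in> univ A" for x using f(2)[of x] that unfolding G_def by blast
  have ran: "\<exists>x. (x, y) \<in> G" if "y \<in> univ B" for y using f(2)[of y] that unfolding G_def by blast
  define h where "h x = (SOME y. (x, y) \<in> G)" for x
  have h: "(x, h x) \<in> G" if "x \<in> univ A" for x
    unfolding h_def using dom[OF that] by (rule someI_ex)
  have w: "\<exists>n. set (map (\<lambda>x. (x, h x)) xs) \<subseteq> f n" if "set xs \<subseteq> univ A" for xs
    using h that by (intro fin) auto
  show ?thesis unfolding isomorphic_def
  proof (intro HOL.exI[of _ h] HOL.conjI HOL.allI impI)
    show "bij_betw h (univ A) (univ B)"
      unfolding bij_betw_def
    proof
      show "inj_on h (univ A)"
        using inj[OF h h] by (intro inj_onI) simp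
      show "h ` univ A = univ B"
      proof
        show "h ` univ A \<subseteq> univ B" using h sub by auto
        show "univ B \<subseteq> h ` univ A"
        proof
          fix y assume "y \<in> univ B"
          then obtain x where "(x, y) \<in> G" using ran by blast
          moreover have "x \<in> univ A" using sub \<open>(x, y) \<in> G\<close> by blast
          ultimately have "y = h x" using inj[OF h, of x x y] by simp
          then show "y \<in> h ` univ A" using \<open>x \<in> univ A\<close> by blast
        qed
      qed
    qed
    fix r xs assume "relar V r = Some (length xs) \<and> set xs \<subseteq> univ A"
    then show "irel A r xs = irel B r (map h xs)"
      using w[of xs] bf_rel[OF bf f(1), of r "map (\<lambda>x. (x, h x)) xs"] by (auto simp: comp_def)
  next
    fix g xs assume g: "funar V g = Some (length xs) \<and> set xs \<subseteq> univ A"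
    then have "ifun A g xs \<in> univ A" using A unfolding structure_of_def by blast
    then have "set (map (\<lambda>x. (x, h x)) (ifun A g xs # xs)) \<subseteq> G" using h g by auto
    then obtain n where "set (map (\<lambda>x. (x, h x)) (ifun A g xs # xs)) \<subseteq> f n"
      using fin by (metis List.finite_set)
    then show "h (ifun A g xs) = ifun B g (map h xs)"
      using bf_fun[OF bf f(1), of g "map (\<lambda>x. (x, h x)) xs" n "ifun A g xs" "h (ifun A g xs)"] g
      by (simp add: comp_def)
  qed
qed

end

text \<open>The subsets of the graph of an isomorphism form a back-and-forth system, so no separate
  induction on formulas is required.\<close>

lemma isomorphic_sat:
  assumes "isomorphic V A B" "structure_of V A" "structure_of V B"
  obtains h where "bij_betw h (univ A) (univ B)"
    "\<And>\<phi> e. wf_shape V \<phi> \<Longrightarrow> assignment A e \<Longrightarrow> sat A \<phi> e \<longleftrightarrow> sat B \<phi> (h \<circ> e)"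
proof -
  obtain h where h: "bij_betw h (univ A) (univ B)"
    "\<And>r xs. relar V r = Some (length xs) \<Longrightarrow> set xs \<subseteq> univ A \<Longrightarrow> irel A r xs = irel B r (map h xs)"
    "\<And>f xs. funar V f = Some (length xs) \<Longrightarrow> set xs \<subseteq> univ A \<Longrightarrow> h (ifun A f xs) = ifun B f (map h xs)"
    using assms(1) unfolding isomorphic_def by blast
  let ?G = "{(x, h x) | x. x \<in> univ A}"
  have w: "map snd w = map h (map fst w)" "set (map fst w) \<subseteq> univ A" if "set w \<subseteq> ?G" for w
    using that by (induction w) auto
  have inj: "h x = h y \<longleftrightarrow> x = y" if "x \<in> univ A" "y \<in> univ A" for x y
    using h(1) that unfolding bij_betw_def by (meson inj_on_contraD)
  have "bf_system V A B (Pow ?G)"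
    unfolding bf_system_def partial_iso_def
  proof (intro ballI HOL.conjI HOL.allI impI)
    fix z assume z: "z \<in> Pow ?G"
    show "z \<subseteq> univ A \<times> univ B" using z h(1) by (auto simp: bij_betw_def)
    show "x = x' \<longleftrightarrow> y = y'" if "(x, y) \<in> z \<and> (x', y') \<in> z" for x y x' y'
      using that z inj[of x x'] by auto
    show "irel A r (map fst w) = irel B r (map snd w)"
      if "relar V r = Some (length w) \<and> set w \<subseteq> z" for r w
    proof -
      have "set w \<subseteq> ?G" using that z by auto
      have "relar V r = Some (length (map fst w))" using that by simp
      from h(2)[OF this w(2)[OF \<open>set w \<subseteq> ?G\<close>]] show ?thesis
        unfolding w(1)[OF \<open>set w \<subseteq> ?G\<close>] .
    qed
    show "(ifun A f (map fst w) = x) = (ifun B f (map snd w) = y)"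
      if "funar V f = Some (length w) \<and> set w \<subseteq> z \<and> (x, y) \<in> z" for f w x y
    proof -
      have wG: "set w \<subseteq> ?G" and xy: "x \<in> univ A" "y = h x" using that z by auto
      have l: "funar V f = Some (length (map fst w))" using that by simp
      then have "ifun A f (map fst w) \<in> univ A"
        using assms(2) w(2)[OF wG] unfolding structure_of_def by blast
      moreover have "h (ifun A f (map fst w)) = ifun B f (map snd w)"
        using h(3)[OF l w(2)[OF wG]] unfolding w(1)[OF wG] .
      ultimately show ?thesis using inj[of "ifun A f (map fst w)" x] xy by simp
    qed
    show "\<exists>y. insert (x, y) z \<in> Pow ?G" if "x \<in> univ A" for x using z that by auto
    show "\<exists>x. insert (x, y) z \<in> Pow ?G" if "y \<in> univ B" for y
    proof -
      obtain x where "x \<in> univ A" "y = h x" using h(1) \<open>y \<in> univ B\<close> by (auto simp: bij_betw_def)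
      then show ?thesis using z by auto
    qed
  qed
  note sat = bf_sat[OF this assms(2,3)]
  show ?thesis
  proof (rule that[OF h(1)])
    fix \<phi> e assume "wf_shape V \<phi>" "assignment A e"
    then show "sat A \<phi> e \<longleftrightarrow> sat B \<phi> (h \<circ> e)"
      by (intro sat[of ?G]) (auto simp: assignment_def image_subset_iff)
  qed
qed

lemma isomorphic_refl: "isomorphic V A A"
  unfolding isomorphic_def by (rule HOL.exI[of _ id]) auto

lemma isomorphic_trans:
  assumes "isomorphic V A B" "isomorphic V B D" shows "isomorphic V A D"
proof -
  obtain h where h: "bij_betw h (univ A) (univ B)"
    "\<And>r xs. relar V r = Some (length xs) \<Longrightarrow> set xs \<subseteq> univ A \<Longrightarrow> irel A r xs = irel B r (map h xs)"
    "\<And>f xs. funar V f = Some (length xs) \<Longrightarrow> set xs \<subseteq> univ A \<Longrightarrow> h (ifun A f xs) = ifun B f (map h xs)"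
    using assms(1) unfolding isomorphic_def by blast
  obtain g where g: "bij_betw g (univ B) (univ D)"
    "\<And>r xs. relar V r = Some (length xs) \<Longrightarrow> set xs \<subseteq> univ B \<Longrightarrow> irel B r xs = irel D r (map g xs)"
    "\<And>f xs. funar V f = Some (length xs) \<Longrightarrow> set xs \<subseteq> univ B \<Longrightarrow> g (ifun B f xs) = ifun D f (map g xs)"
    using assms(2) unfolding isomorphic_def by blast
  have sub: "set (map h xs) \<subseteq> univ B" if "set xs \<subseteq> univ A" for xs
    using h(1) that by (auto simp: bij_betw_def)
  show ?thesis
    unfolding isomorphic_def
  proof (intro HOL.exI[of _ "g \<circ> h"] HOL.conjI HOL.allI impI bij_betw_trans[OF h(1) g(1)])
    fix r xs assume "relar V r = Some (length xs) \<and> set xs \<subseteq> univ A"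
    then show "irel A r xs = irel D r (map (g \<circ> h) xs)"
      using h(2)[of r xs] g(2)[of r "map h xs"] sub[of xs] by simp
  next
    fix f xs assume "funar V f = Some (length xs) \<and> set xs \<subseteq> univ A"
    then show "(g \<circ> h) (ifun A f xs) = ifun D f (map (g \<circ> h) xs)"
      using h(3)[of f xs] g(3)[of f "map h xs"] sub[of xs] by simp
  qed
qed

lemma isomorphic_sym:
  assumes "isomorphic V A B" "structure_of V A" shows "isomorphic V B A"
proof -
  obtain h where h: "bij_betw h (univ A) (univ B)"
    "\<And>r xs. relar V r = Some (length xs) \<Longrightarrow> set xs \<subseteq> univ A \<Longrightarrow> irel A r xs = irel B r (map h xs)"
    "\<And>f xs. funar V f = Some (length xs) \<Longrightarrow> set xs \<subseteq> univ A \<Longrightarrow> h (ifun A f xs) = ifun B f (map h xs)"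
    using assms(1) unfolding isomorphic_def by blast
  let ?k = "inv_into (univ A) h"
  have k: "bij_betw ?k (univ B) (univ A)" using bij_betw_inv_into[OF h(1)] .
  have hk: "map h (map ?k xs) = xs" "set (map ?k xs) \<subseteq> univ A" if "set xs \<subseteq> univ B" for xs
    using that h(1) k by (induction xs) (auto simp: bij_betw_def f_inv_into_f)
  show ?thesis
    unfolding isomorphic_def
  proof (intro HOL.exI[of _ ?k] HOL.conjI HOL.allI impI k)
    fix r xs assume "relar V r = Some (length xs) \<and> set xs \<subseteq> univ B"
    then show "irel B r xs = irel A r (map ?k xs)" using h(2)[of r "map ?k xs"] hk[of xs] by simp
  next
    fix f xs assume f: "funar V f = Some (length xs) \<and> set xs \<subseteq> univ B"
    then have f': "funar V f = Some (length (map ?k xs))" by simp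
    then have "ifun A f (map ?k xs) \<in> univ A"
      using assms(2) hk[of xs] f unfolding structure_of_def by blast
    then have "?k (h (ifun A f (map ?k xs))) = ifun A f (map ?k xs)"
      using h(1) by (simp add: bij_betw_def)
    then show "?k (ifun B f xs) = ifun A f (map ?k xs)" using h(3)[OF f'] hk[of xs] f by simp
  qed
qed


text \<open>The n quantifiers bind the variables below n; the old variable i has become i +
  n.\<close>

lemma sat_Ex_funpow:
  "assignment M e \<Longrightarrow> sat M ((Ex ^^ n) \<psi>) e \<longleftrightarrow>
    (\<exists>e'. assignment M e' \<and> (\<forall>i. e' (i + n) = e i) \<and> sat M \<psi> e')"
proof (induction n arbitrary: e)
  case 0
  then show ?case by (auto simp flip: fun_eq_iff)
next
  case (Suc n)
  have "sat M ((Ex ^^ Suc n) \<psi>) e \<longleftrightarrow> (\<exists>x\<in>univ M. \<exists>e'. assignment M e' \<and>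
      (\<forall>i. e' (i + n) = case_nat x e i) \<and> sat M \<psi> e')"
    using Suc.IH[OF assignment_case_nat[OF Suc.prems]] by simp
  also have "\<dots> \<longleftrightarrow> (\<exists>e'. assignment M e' \<and> (\<forall>i. e' (i + Suc n) = e i) \<and> sat M \<psi> e')"
  proof
    assume "\<exists>x\<in>univ M. \<exists>e'. assignment M e' \<and> (\<forall>i. e' (i + n) = case_nat x e i) \<and> sat M \<psi> e'"
    then obtain x e' where "assignment M e'" "\<forall>i. e' (i + n) = case_nat x e i" "sat M \<psi> e'" by blast
    moreover have "e' (i + Suc n) = e i" for i
      using spec[OF \<open>\<forall>i. e' (i + n) = case_nat x e i\<close>, of "Suc i"] by simp
    ultimately show "\<exists>e'. assignment M e' \<and> (\<forall>i. e' (i + Suc n) = e i) \<and> sat M \<psi> e'" by blast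
  next
    assume "\<exists>e'. assignment M e' \<and> (\<forall>i. e' (i + Suc n) = e i) \<and> sat M \<psi> e'"
    then obtain e' where e': "assignment M e'" "\<forall>i. e' (i + Suc n) = e i" "sat M \<psi> e'" by blast
    have "e' (i + n) = case_nat (e' n) e i" for i using e'(2) by (cases i) auto
    moreover have "e' n \<in> univ M" using e'(1) by (auto simp: assignment_def)
    ultimately show "\<exists>x\<in>univ M. \<exists>e'. assignment M e' \<and> (\<forall>i. e' (i + n) = case_nat x e i) \<and> sat M \<psi> e'"
      using e' by blast
  qed
  finally show ?case .
qed

lemma fv_Ex_funpow: "fv ((Ex ^^ n) \<psi>) = {i. i + n \<in> fv \<psi>}"
  by (induction n) auto

lemma wf_shape_Ex_funpow: "wf_shape V ((Ex ^^ n) \<psi>) \<longleftrightarrow> wf_shape V \<psi>"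
  by (induction n) auto

lemma fv_subst_tm: "fv_tm (subst_tm \<sigma> t) = (\<Union>i\<in>fv_tm t. fv_tm (\<sigma> i))"
  by (induction t) auto

lemma fv_subst: "fv (subst \<phi> \<sigma>) \<subseteq> (\<Union>i\<in>fv \<phi>. fv_tm (\<sigma> i))"
proof (induction \<phi> arbitrary: \<sigma>)
  case (CConj F)
  show ?case
  proof
    fix i assume "i \<in> fv (subst (CConj F) \<sigma>)"
    then obtain \<phi> where \<phi>: "\<phi> \<in> rcset F" "i \<in> fv (subst \<phi> \<sigma>)" by (auto simp: cimage.rep_eq)
    then show "i \<in> (\<Union>i\<in>fv (CConj F). fv_tm (\<sigma> i))" using CConj.IH[OF \<phi>(1), of \<sigma>] fv_CConj[OF \<phi>(1)] by blast
  qed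
next
  case (CDisj F)
  show ?case
  proof
    fix i assume "i \<in> fv (subst (CDisj F) \<sigma>)"
    then obtain \<phi> where \<phi>: "\<phi> \<in> rcset F" "i \<in> fv (subst \<phi> \<sigma>)" by (auto simp: cimage.rep_eq)
    then show "i \<in> (\<Union>i\<in>fv (CDisj F). fv_tm (\<sigma> i))" using CDisj.IH[OF \<phi>(1), of \<sigma>] fv_CDisj[OF \<phi>(1)] by blast
  qed
next
  case (Ex \<phi>)
  show ?case
  proof
    fix i assume "i \<in> fv (subst (Ex \<phi>) \<sigma>)"
    then obtain j where "j \<in> fv \<phi>" "Suc i \<in> fv_tm (up \<sigma> j)" using Ex.IH[of "up \<sigma>"] by auto
    then show "i \<in> (\<Union>i\<in>fv (Ex \<phi>). fv_tm (\<sigma> i))" by (cases j) (auto simp: up_def fv_subst_tm)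
  qed
next
  case (All \<phi>)
  show ?case
  proof
    fix i assume "i \<in> fv (subst (All \<phi>) \<sigma>)"
    then obtain j where "j \<in> fv \<phi>" "Suc i \<in> fv_tm (up \<sigma> j)" using All.IH[of "up \<sigma>"] by auto
    then show "i \<in> (\<Union>i\<in>fv (All \<phi>). fv_tm (\<sigma> i))" by (cases j) (auto simp: up_def fv_subst_tm)
  qed
qed (auto simp: fv_subst_tm)


section \<open>Types along a branch of nodes\<close>

lemma osuc_le: "a < b \<Longrightarrow> osuc a \<le> b"
  unfolding osuc_def by (rule Least_le)

lemma less_osuc_iff: "a < osuc b \<longleftrightarrow> a \<le> b"
  using osuc_greater[of b] osuc_le[of b a] by (metis leD le_less_trans not_le)

lemma omega1_cases:
  obtains "a = 0" | b where "a = osuc b" | "islim a"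
  unfolding islim_def by blast

text \<open>Regularity: the initial segments given by an unbounded countable set would cover
  \<open>omega1\<close> by countably many countable sets.\<close>

lemma countable_bounded_omega1:
  assumes "countable (S :: omega1 set)" obtains b where "\<And>a. a \<in> S \<Longrightarrow> a < b"
proof (rule ccontr)
  assume "\<not> thesis"
  then have "\<exists>a\<in>S. b \<le> a" for b using that by (meson not_le)
  then have "UNIV \<subseteq> (\<Union>a\<in>S. insert a {..<a})" by (auto simp: order_le_less)
  moreover have "countable (\<Union>a\<in>S. insert a {..<a})"
    using assms countable_below_omega1 by (intro countable_UN) auto
  ultimately show False using uncountable_omega1 countable_subset by blast
qed

text \<open>At limit levels of a branch \<open>is_fragment\<close> is not assumed; these closure properties pass to unions.\<close>

definition frag_like :: "vocab \<Rightarrow> fm set \<Rightarrow> bool" where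
  "frag_like V L \<longleftrightarrow> countable L \<and> (\<forall>\<phi>\<in>L. wf_fm V \<phi>) \<and>
     (\<forall>s t. wf_fm V (Eq s t) \<longrightarrow> Eq s t \<in> L) \<and>
     (\<forall>r ts. wf_fm V (Rel r ts) \<longrightarrow> Rel r ts \<in> L) \<and>
     (\<forall>\<phi>\<in>L. Neg \<phi> \<in> L) \<and> (\<forall>\<phi>\<in>L. Ex \<phi> \<in> L) \<and>
     (\<forall>\<phi>\<in>L. \<forall>\<sigma>. (\<forall>i. wf_tm V (\<sigma> i)) \<longrightarrow> subst \<phi> \<sigma> \<in> L)"

lemma frag_like_fragment:
  assumes "is_fragment V L" shows "frag_like V L"
proof -
  note * = assms[unfolded is_fragment_def fragment_closed_def]
  show ?thesis unfolding frag_like_def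
    by (intro HOL.conjI) (use * in \<open>simp_all\<close>)
qed

lemma frag_likeD:
  assumes "frag_like V L"
  shows "countable L" "\<And>\<phi>. \<phi> \<in> L \<Longrightarrow> wf_fm V \<phi>" "\<And>s t. wf_fm V (Eq s t) \<Longrightarrow> Eq s t \<in> L"
    "\<And>r ts. wf_fm V (Rel r ts) \<Longrightarrow> Rel r ts \<in> L" "\<And>\<phi>. \<phi> \<in> L \<Longrightarrow> Neg \<phi> \<in> L"
    "\<And>\<phi>. \<phi> \<in> L \<Longrightarrow> Ex \<phi> \<in> L" "\<And>\<phi> \<sigma>. \<phi> \<in> L \<Longrightarrow> (\<And>i. wf_tm V (\<sigma> i)) \<Longrightarrow> subst \<phi> \<sigma> \<in> L"
  using assms unfolding frag_like_def by simp_all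

lemma frag_like_Union:
  assumes "\<And>L. L \<in> LL \<Longrightarrow> frag_like V L" "countable LL" "LL \<noteq> {}"
  shows "frag_like V (\<Union>LL)"
proof -
  have "countable (\<Union>L\<in>LL. L)" using frag_likeD(1)[OF assms(1)] assms(2) by (rule_tac countable_UN) auto
  then have "countable (\<Union>LL)" by simp
  moreover obtain L where "L \<in> LL" using assms(3) by blast
  ultimately show ?thesis unfolding frag_like_def
    using frag_likeD(2-7)[OF assms(1)] by (intro HOL.conjI ballI HOL.allI impI) blast+
qed

lemma frag_like_Ex_funpow: "frag_like V L \<Longrightarrow> \<psi> \<in> L \<Longrightarrow> (Ex ^^ n) \<psi> \<in> L"
  by (induction n) (auto intro: frag_likeD(6))

lemma frag_gen_subset: "X \<subseteq> frag_gen V X"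
  unfolding frag_gen_def by blast

context
  fixes V \<phi> B assumes B: "is_branch V \<phi> B"
begin

lemma branch_root: "root_node V \<phi> (B 0)"
  and branch_child: "child_node V (B \<delta>) (B (osuc \<delta>))"
  and branch_lim: "islim \<delta> \<Longrightarrow> B \<delta> = (\<Union>\<gamma><\<delta>. fst (B \<gamma>), \<Union>\<gamma><\<delta>. snd (B \<gamma>))"
  using B unfolding is_branch_def by simp_all

lemma branch_mono: "\<gamma> \<le> \<delta> \<Longrightarrow> fst (B \<gamma>) \<subseteq> fst (B \<delta>) \<and> snd (B \<gamma>) \<subseteq> snd (B \<delta>)"
proof (induction \<delta> rule: less_induct)
  case (less \<delta>)
  show ?case
  proof (cases "\<gamma> = \<delta>")
    case False
    then have lt: "\<gamma> < \<delta>" using less.prems by simp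
    consider "\<delta> = 0" | \<beta> where "\<delta> = osuc \<beta>" | "islim \<delta>" by (rule omega1_cases)
    then show ?thesis
    proof cases
      case 1
      then show ?thesis using lt zero_le_omega1[of \<gamma>] by simp
    next
      case (2 \<beta>)
      then have "\<gamma> \<le> \<beta>" "\<beta> < \<delta>" using lt osuc_greater by (simp_all add: less_osuc_iff)
      then have "fst (B \<gamma>) \<subseteq> fst (B \<beta>) \<and> snd (B \<gamma>) \<subseteq> snd (B \<beta>)" using less.IH by blast
      moreover have "fst (B \<beta>) \<subseteq> fst (B \<delta>)"
        using branch_child[of \<beta>] frag_gen_subset 2 unfolding child_node_def next_frag_def by fastforce
      moreover have "snd (B \<beta>) \<subseteq> snd (B \<delta>)" using branch_child[of \<beta>] 2 unfolding child_node_def by simp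
      ultimately show ?thesis by blast
    next
      case 3
      show ?thesis unfolding branch_lim[OF 3] fst_conv snd_conv using lt by blast
    qed
  qed simp
qed

lemma branch_frag_like: "frag_like V (fst (B \<delta>))"
proof (induction \<delta> rule: less_induct)
  case (less \<delta>)
  consider "\<delta> = 0" | \<beta> where "\<delta> = osuc \<beta>" | "islim \<delta>" by (rule omega1_cases)
  then show ?case
  proof cases
    case 1
    then show ?thesis using branch_root frag_like_fragment unfolding root_node_def by blast
  next
    case (2 \<beta>)
    then show ?thesis using branch_child[of \<beta>] frag_like_fragment unfolding child_node_def by blast
  next
    case 3
    then have "0 < \<delta>" using zero_le_omega1[of \<delta>] unfolding islim_def by (metis order_le_less)
    then have "frag_like V (\<Union> ((\<lambda>\<gamma>. fst (B \<gamma>)) ` {..<\<delta>}))"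
      using less.IH countable_below_omega1 by (intro frag_like_Union) auto
    then show ?thesis unfolding branch_lim[OF 3] fst_conv .
  qed
qed

text \<open>At a limit level every sentence already belongs to an earlier level, whose decision is
  inherited.\<close>

lemma branch_complete: "\<sigma> \<in> fst (B \<delta>) \<Longrightarrow> fv \<sigma> = {} \<Longrightarrow> \<sigma> \<in> snd (B \<delta>) \<or> Neg \<sigma> \<in> snd (B \<delta>)"
proof (induction \<delta> rule: less_induct)
  case (less \<delta>)
  consider "\<delta> = 0" | \<beta> where "\<delta> = osuc \<beta>" | "islim \<delta>" by (rule omega1_cases)
  then show ?case
  proof cases
    case 1
    then show ?thesis using branch_root less.prems
      unfolding root_node_def omega_complete_def sentences_def by blast
  next
    case (2 \<beta>)
    then show ?thesis using branch_child[of \<beta>] less.prems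
      unfolding child_node_def omega_complete_def sentences_def by blast
  next
    case 3
    then obtain \<gamma> where "\<gamma> < \<delta>" "\<sigma> \<in> fst (B \<gamma>)"
      using less.prems(1) unfolding branch_lim[OF 3] fst_conv by blast
    then have "\<sigma> \<in> snd (B \<gamma>) \<or> Neg \<sigma> \<in> snd (B \<gamma>)" using less.IH less.prems(2) by blast
    then show ?thesis using branch_mono[of \<gamma> \<delta>] \<open>\<gamma> < \<delta>\<close> by (auto dest: less_imp_le)
  qed
qed

lemma model_of_mono: "\<gamma> \<le> \<delta> \<Longrightarrow> model_of V (snd (B \<delta>)) A \<Longrightarrow> model_of V (snd (B \<gamma>)) A"
  using branch_mono[of \<gamma> \<delta>] unfolding model_of_def by blast

lemma model_of_branch: "model_of V (snd (B \<delta>)) A \<Longrightarrow> A \<in> models V \<phi>"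
  using model_of_mono[OF zero_le_omega1] branch_root
  unfolding model_of_def root_node_def base_thy_def models_def by blast

end

section \<open>Types realized in models of a node\<close>

lemma tp_subset_eq:
  assumes "frag_like V L" "tp L A n e \<subseteq> tp L A' n e'" shows "tp L A n e = tp L A' n e'"
proof -
  have "sat A \<psi> e" if "\<psi> \<in> tp L A' n e'" for \<psi>
  proof (rule ccontr)
    assume "\<not> sat A \<psi> e"
    then have "Neg \<psi> \<in> tp L A n e"
      using that frag_likeD(5)[OF assms(1)] unfolding tp_def formulas_in_def by simp
    then show False using assms(2) that unfolding tp_def by auto
  qed
  then show ?thesis using assms(2) unfolding tp_def by blast
qed

lemma tp_mono_eq: "tp L A n e = tp L A' n e' \<Longrightarrow> L' \<subseteq> L \<Longrightarrow> tp L' A n e = tp L' A' n e'"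
  unfolding tp_def formulas_in_def set_eq_iff by (simp add: subset_iff) blast

text \<open>Consistency holds by soundness, maximality because the fragment is closed under
  \<open>Neg\<close>. So every realized non-principal type contributes its conjunction to the next
  fragment.\<close>

lemma is_type_tp:
  assumes L: "frag_like V L" and A: "model_of V S A" and e: "assignment A e"
  shows "is_type V L S n (tp L A n e)"
  unfolding is_type_def
proof (intro HOL.conjI HOL.allI impI)
  show "tp L A n e \<subseteq> formulas_in L n" unfolding tp_def by blast
  have sat: "sat A \<gamma> e" if "\<gamma> \<in> S \<union> tp L A n e" for \<gamma>
    using that A e unfolding model_of_def holds_def tp_def by blast
  have "sat A \<psi> e" if "fderiv V (S \<union> tp L A n e) \<psi>" for \<psi>
    using fderiv_sound[OF _ that e sat] A unfolding model_of_def by blast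
  then show "fin_consistent V (S \<union> tp L A n e)" unfolding fin_consistent_def by (metis sat.simps(3))
  fix q assume q: "tp L A n e \<subseteq> q \<and> q \<subseteq> formulas_in L n \<and> fin_consistent V (S \<union> q)"
  have "\<psi> \<in> tp L A n e" if \<psi>: "\<psi> \<in> q" for \<psi>
  proof (rule ccontr)
    assume "\<psi> \<notin> tp L A n e"
    then have "Neg \<psi> \<in> tp L A n e"
      using \<psi> q frag_likeD(5)[OF L] unfolding tp_def formulas_in_def by auto
    then have "fderiv V (S \<union> q) (Neg \<psi>)" "fderiv V (S \<union> q) \<psi>" using q \<psi> by (auto intro: assm)
    then show False using q unfolding fin_consistent_def by blast
  qed
  then show "q = tp L A n e" using q by blast
qed

lemma principal_tp:
  assumes L: "frag_like V L" and p: "principal V S (tp L A n e)"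
  obtains \<psi> where "\<psi> \<in> tp L A n e"
    "\<And>A' e'. model_of V S A' \<Longrightarrow> assignment A' e' \<Longrightarrow> sat A' \<psi> e' \<Longrightarrow> tp L A n e = tp L A' n e'"
proof -
  obtain \<psi> where \<psi>: "\<psi> \<in> tp L A n e" "\<And>\<chi>. \<chi> \<in> tp L A n e \<Longrightarrow> fderiv V (insert \<psi> S) \<chi>"
    using p unfolding principal_def by blast
  have "tp L A n e = tp L A' n e'" if A': "model_of V S A'" and e': "assignment A' e'" "sat A' \<psi> e'" for A' e'
  proof (rule tp_subset_eq[OF L], rule subsetI)
    fix \<chi> assume \<chi>: "\<chi> \<in> tp L A n e"
    have "sat A' \<gamma> e'" if "\<gamma> \<in> insert \<psi> S" for \<gamma>
      using that A' e' unfolding model_of_def holds_def by blast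
    then have "sat A' \<chi> e'"
      using fderiv_sound[OF _ \<psi>(2)[OF \<chi>] e'(1)] A' unfolding model_of_def by blast
    then show "\<chi> \<in> tp L A' n e'" using \<chi> unfolding tp_def by blast
  qed
  then show ?thesis using that \<psi>(1) by blast
qed

lemma rcset_acset: "countable X \<Longrightarrow> rcset (acset X) = X"
  by (simp add: acset_inverse)

lemma sat_CConj_tp:
  assumes L: "frag_like V L"
  shows "sat A' (CConj (acset (tp L A n e))) e' \<longleftrightarrow> tp L A n e = tp L A' n e'"
proof -
  have "tp L A n e \<subseteq> L" unfolding tp_def formulas_in_def by blast
  then have "countable (tp L A n e)" using frag_likeD(1)[OF L] countable_subset by blast
  then have "sat A' (CConj (acset (tp L A n e))) e' \<longleftrightarrow> (\<forall>\<chi>\<in>tp L A n e. sat A' \<chi> e')"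
    unfolding sat_CConj by (simp add: rcset_acset)
  also have "\<dots> \<longleftrightarrow> tp L A n e \<subseteq> tp L A' n e'" unfolding tp_def by blast
  also have "\<dots> \<longleftrightarrow> tp L A n e = tp L A' n e'" using tp_subset_eq[OF L] by blast
  finally show ?thesis .
qed

lemma fv_CConj_subset: "countable p \<Longrightarrow> fv (CConj (acset p)) \<subseteq> X \<longleftrightarrow> (\<forall>\<psi>\<in>p. fv \<psi> \<subseteq> X)"
  by (auto simp: cimage.rep_eq rcset_acset)

text \<open>If the type is principal, its generator isolates it among tuples in models of the node.
  Otherwise its infinite conjunction is a formula of the next fragment, by the construction of
  \<open>next_frag\<close>.\<close>

lemma isolating_formula:
  assumes B: "is_branch V \<phi> B" and A: "model_of V (snd (B \<delta>)) A" and e: "assignment A e"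
  obtains \<chi> where "\<chi> \<in> fst (B (osuc \<delta>))" "fv \<chi> \<subseteq> {..<n}"
    "\<And>A' e'. model_of V (snd (B \<delta>)) A' \<Longrightarrow> assignment A' e' \<Longrightarrow>
       sat A' \<chi> e' \<longleftrightarrow> tp (fst (B \<delta>)) A n e = tp (fst (B \<delta>)) A' n e'"
proof -
  let ?p = "tp (fst (B \<delta>)) A n e"
  note L = branch_frag_like[OF B, of \<delta>]
  have pL: "?p \<subseteq> fst (B \<delta>)" "\<And>\<psi>. \<psi> \<in> ?p \<Longrightarrow> fv \<psi> \<subseteq> {..<n}" unfolding tp_def formulas_in_def by blast+
  show ?thesis
  proof (cases "principal V (snd (B \<delta>)) ?p")
    case True
    then obtain \<psi> where \<psi>: "\<psi> \<in> ?p" "\<And>A' e'. model_of V (snd (B \<delta>)) A' \<Longrightarrow> assignment A' e' \<Longrightarrow>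
      sat A' \<psi> e' \<Longrightarrow> ?p = tp (fst (B \<delta>)) A' n e'"
      using principal_tp[OF L] by blast
    have "\<psi> \<in> fst (B (osuc \<delta>))"
      using \<psi>(1) pL(1) branch_mono[OF B less_imp_le[OF osuc_greater]] by blast
    moreover have "sat A' \<psi> e'" if "?p = tp (fst (B \<delta>)) A' n e'" for A' e'
      using \<psi>(1) that unfolding tp_def by blast
    ultimately show ?thesis using that[of \<psi>] \<psi> pL(2) by blast
  next
    case False
    have "CConj (acset ?p) \<in> next_frag V (B \<delta>)"
      unfolding next_frag_def using is_type_tp[OF L A e] False
      by (intro subsetD[OF frag_gen_subset]) blast
    then have "CConj (acset ?p) \<in> fst (B (osuc \<delta>))"
      using branch_child[OF B, of \<delta>] unfolding child_node_def by simp
    moreover have "fv (CConj (acset ?p)) \<subseteq> {..<n}"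
      using pL countable_subset[OF pL(1) frag_likeD(1)[OF L]] by (subst fv_CConj_subset) auto
    ultimately show ?thesis using that sat_CConj_tp[OF L] by blast
  qed
qed

text \<open>The type of the longer tuple at level \<delta> is isolated by a formula \<chi> of the
  next level, and \<open>Ex \<chi>\<close> belongs to the type of the shorter tuple there. This is
  the price of one level per move.\<close>

lemma tp_forth:
  assumes B: "is_branch V \<phi> B" and A: "model_of V (snd (B (osuc \<delta>))) A" "assignment A e"
    and A': "model_of V (snd (B (osuc \<delta>))) A'" "assignment A' e'"
    and eq: "tp (fst (B (osuc \<delta>))) A n e = tp (fst (B (osuc \<delta>))) A' n e'" and x: "x \<in> univ A"
  obtains y where "y \<in> univ A'"
    "tp (fst (B \<delta>)) A (Suc n) (case_nat x e) = tp (fst (B \<delta>)) A' (Suc n) (case_nat y e')"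
proof -
  have le: "\<delta> \<le> osuc \<delta>" using osuc_greater[of \<delta>] by simp
  note M = model_of_mono[OF B le A(1)] and M' = model_of_mono[OF B le A'(1)]
  obtain \<chi> where \<chi>: "\<chi> \<in> fst (B (osuc \<delta>))" "fv \<chi> \<subseteq> {..<Suc n}"
    "\<And>A' e'. model_of V (snd (B \<delta>)) A' \<Longrightarrow> assignment A' e' \<Longrightarrow>
       sat A' \<chi> e' \<longleftrightarrow> tp (fst (B \<delta>)) A (Suc n) (case_nat x e) = tp (fst (B \<delta>)) A' (Suc n) e'"
    using isolating_formula[OF B M assignment_case_nat[OF A(2) x], of "Suc n"] by blast
  have "sat A (Ex \<chi>) e" using \<chi>(3)[OF M assignment_case_nat[OF A(2) x]] x by auto
  moreover have "Ex \<chi> \<in> formulas_in (fst (B (osuc \<delta>))) n"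
    using \<chi>(1,2) frag_likeD(6)[OF branch_frag_like[OF B]] unfolding formulas_in_def by auto
  ultimately have "Ex \<chi> \<in> tp (fst (B (osuc \<delta>))) A n e" unfolding tp_def by blast
  then have "Ex \<chi> \<in> tp (fst (B (osuc \<delta>))) A' n e'" unfolding eq .
  then obtain y where "y \<in> univ A'" "sat A' \<chi> (case_nat y e')" unfolding tp_def by auto
  then show ?thesis using that \<chi>(3)[OF M' assignment_case_nat[OF A'(2)]] by blast
qed


section \<open>Homogeneity of fiber models\<close>

text \<open>Assignments are total, so \<open>d\<close> fills the variables beyond the list. The head
  of the list is variable 0; prepending an element is thus exactly what a quantifier does.\<close>

definition env :: "nat \<Rightarrow> nat list \<Rightarrow> nat \<Rightarrow> nat" where
  "env d xs i = (if i < length xs then xs ! i else d)"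

lemma env_Cons: "env d (x # xs) = case_nat x (env d xs)"
  by (rule ext) (simp add: env_def split: nat.split)

lemma assignment_env: "set xs \<subseteq> univ A \<Longrightarrow> d \<in> univ A \<Longrightarrow> assignment A (env d xs)"
  unfolding assignment_def env_def by auto

definition ltp :: "fm set \<Rightarrow> struct \<Rightarrow> nat \<Rightarrow> nat list \<Rightarrow> fm set" where
  "ltp L A d xs = tp L A (length xs) (env d xs)"

lemma tp_eq_sat:
  "tp L A n e = tp L A' n e' \<Longrightarrow> \<psi> \<in> L \<Longrightarrow> fv \<psi> \<subseteq> {..<n} \<Longrightarrow> sat A \<psi> e \<longleftrightarrow> sat A' \<psi> e'"
  unfolding tp_def formulas_in_def by blast

text \<open>Each clause is an unnested atomic formula in variables, and these belong to every
  fragment.\<close>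

lemma partial_iso_of_ltp:
  assumes L: "frag_like V L" and eq: "ltp L A d (map fst w) = ltp L A' d' (map snd w)"
    and w: "set w \<subseteq> univ A \<times> univ A'"
  shows "partial_iso V A A' (set w)"
proof -
  let ?e = "env d (map fst w)" and ?e' = "env d' (map snd w)"
  have sat: "sat A \<psi> ?e \<longleftrightarrow> sat A' \<psi> ?e'" if "\<psi> \<in> L" "fv \<psi> \<subseteq> {..<length w}" for \<psi>
    using tp_eq_sat[OF eq[unfolded ltp_def length_map]] that by blast
  \<comment> \<open>A pair may occur several times in \<open>w\<close>; any of its positions can
    serve as its variable.\<close>
  define ix where "ix p = (SOME j. j < length w \<and> w ! j = p)" for p
  have ix: "ix p < length w" "w ! ix p = p" if "p \<in> set w" for p
    using someI_ex[of "\<lambda>j. j < length w \<and> w ! j = p"] that unfolding in_set_conv_nth ix_def by blast+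
  have e: "?e (ix p) = fst p" "?e' (ix p) = snd p" if "p \<in> set w" for p
    using ix[OF that] by (simp_all add: env_def)
  have m: "map (val A ?e) (map (\<lambda>p. Var (ix p)) v) = map fst v"
    "map (val A' ?e') (map (\<lambda>p. Var (ix p)) v) = map snd v" if "set v \<subseteq> set w" for v
    using that e by auto
  have fv: "\<Union> (set (map fv_tm (map (\<lambda>p. Var (ix p)) v))) \<subseteq> {..<length w}"
    if "set v \<subseteq> set w" for v using that ix by auto
  show ?thesis
    unfolding partial_iso_def
  proof (intro HOL.conjI HOL.allI impI w)
    fix x y x' y' assume *: "(x, y) \<in> set w \<and> (x', y') \<in> set w"
    let ?\<psi> = "Eq (Var (ix (x, y))) (Var (ix (x', y')))"
    have "?\<psi> \<in> L" by (rule frag_likeD(3)[OF L]) (simp add: wf_fm_def)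
    moreover have "fv ?\<psi> \<subseteq> {..<length w}" using * ix by simp
    ultimately show "x = x' \<longleftrightarrow> y = y'" using sat[of ?\<psi>] e * by simp
  next
    fix r v assume *: "relar V r = Some (length v) \<and> set v \<subseteq> set w"
    let ?\<psi> = "Rel r (map (\<lambda>p. Var (ix p)) v)"
    have "?\<psi> \<in> L" by (rule frag_likeD(4)[OF L]) (use * in \<open>simp add: wf_fm_def list_all_iff\<close>)
    moreover have "fv ?\<psi> \<subseteq> {..<length w}" using fv[of v] * unfolding fv.simps by blast
    ultimately have "sat A ?\<psi> ?e \<longleftrightarrow> sat A' ?\<psi> ?e'" by (rule sat)
    moreover have "set v \<subseteq> set w" using * by simp
    ultimately show "irel A r (map fst v) = irel A' r (map snd v)"
      unfolding sat.simps by (simp only: m)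
  next
    fix f v x y assume *: "funar V f = Some (length v) \<and> set v \<subseteq> set w \<and> (x, y) \<in> set w"
    let ?\<psi> = "Eq (Fn f (map (\<lambda>p. Var (ix p)) v)) (Var (ix (x, y)))"
    have "?\<psi> \<in> L" by (rule frag_likeD(3)[OF L]) (use * in \<open>simp add: wf_fm_def list_all_iff\<close>)
    moreover have "fv ?\<psi> \<subseteq> {..<length w}"
      using fv[of v] * ix[of "(x, y)"] unfolding fv.simps fv_tm.simps by blast
    ultimately have "sat A ?\<psi> ?e \<longleftrightarrow> sat A' ?\<psi> ?e'" by (rule sat)
    moreover have "set v \<subseteq> set w" "(x, y) \<in> set w" using * by simp_all
    ultimately show "(ifun A f (map fst v) = x) = (ifun A' f (map snd v) = y)"
      unfolding sat.simps val.simps by (simp only: m e fst_conv snd_conv)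
  qed
qed

section \<open>Positions and challenges as numbers\<close>

definition pairs :: "nat \<Rightarrow> (nat \<times> nat) list" where
  "pairs z = map prod_decode (list_decode z)"

lemma pairs_encode [simp]: "pairs (list_encode (map prod_encode v)) = v"
  by (simp add: pairs_def comp_def)

lemma pairs_ccons [simp]: "pairs (ccons (pr x y) z) = (x, y) # pairs z"
  unfolding pairs_def list_decode_ccons by simp

definition pmap :: "(nat \<Rightarrow> nat) \<Rightarrow> nat \<Rightarrow> nat" where
  "pmap h l = list_encode (map h (list_decode l))"

lemma pmap_pairs: "pmap pfst w = list_encode (map fst (pairs w))" "pmap psnd w = list_encode (map snd (pairs w))"
  by (simp_all add: pmap_def pairs_def pfst_def[abs_def] psnd_def[abs_def] comp_def)

text \<open>The code of the image list is found by search: it is the only number with the right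
  length and entries.\<close>

lemma rec_pmap:
  assumes h: "rec X h" and f: "rec X f" shows "rec X (\<lambda>n. pmap h (f n))"
proof -
  have 1: "clen m = clen n \<and> (\<forall>i<clen n. cnth m i = h (cnth n i)) \<longleftrightarrow> m = pmap h n" for m n
  proof -
    have "clen m = clen n \<and> (\<forall>i<clen n. cnth m i = h (cnth n i)) \<longleftrightarrow>
       list_decode m = map h (list_decode n)"
      unfolding list_eq_iff_nth_eq length_map clen_def[symmetric]
      by (auto simp: cnth_eq) (metis clen_def nth_map cnth_eq)+
    also have "\<dots> \<longleftrightarrow> m = pmap h n"
      unfolding pmap_def by (metis list_decode_inverse list_encode_inverse)
    finally show ?thesis .
  qed
  have "rec X (\<lambda>n. LEAST m. clen m = clen n \<and> (\<forall>i<clen n. cnth m i = h (cnth n i)))"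
  proof (rule rec_Least)
    show "\<exists>m. clen m = clen n \<and> (\<forall>i<clen n. cnth m i = h (cnth n i))" for n
      unfolding 1 by blast
  qed (intro dec_intros dec_ball rec_intros rec_comp[OF h])
  then have "rec X (\<lambda>n. pmap h n)" unfolding 1 by (simp add: Least_equality)
  from rec_comp[OF this f] show ?thesis .
qed

definition psub :: "nat \<Rightarrow> nat \<Rightarrow> bool" where
  "psub w z \<longleftrightarrow> (\<forall>i<clen w. \<exists>j<clen z. cnth w i = cnth z j)"

lemma psub_iff: "psub w z \<longleftrightarrow> set (pairs w) \<subseteq> set (pairs z)"
proof -
  have "psub w z \<longleftrightarrow> set (list_decode w) \<subseteq> set (list_decode z)"
    unfolding psub_def subset_iff by (simp add: clen_def cnth_eq in_set_conv_nth) (metis cnth_eq clen_def)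
  also have "\<dots> \<longleftrightarrow> set (pairs w) \<subseteq> set (pairs z)"
    unfolding pairs_def set_map by (simp add: inj_image_subset_iff inj_prod_decode)
  finally show ?thesis .
qed

text \<open>For \<open>t = Suc (pr i r)\<close> the diagram is asked about the symbol
  \<open>r\<close>: i = 0 stands for relations and i = 1 for graphs of functions, where the head of
  the list is the value. For larger i the answer is negative in every diagram.\<close>

definition test :: "nat set \<Rightarrow> nat \<Rightarrow> nat \<Rightarrow> bool" where
  "test D t l \<longleftrightarrow> (t = 0 \<longrightarrow> ctl l \<noteq> 0 \<longrightarrow> chd l = chd (ctl l)) \<and>
     (t \<noteq> 0 \<longrightarrow> pr (Suc (pfst (t - 1))) (pr (psnd (t - 1)) l) \<in> D)"

text \<open>A position codes a finite list of pairs.  In a challenge \<open>\<langle>\<langle>i, x\<rangle>, t, w\<rangle>\<close> an element \<open>x\<close> of one of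
  the two sides has to be matched, in such a way that the sublist \<open>w\<close> of the new position does not
  violate the atomic formula given by \<open>t\<close>; the case \<open>t = 0\<close> is for equality.\<close>

definition game :: "nat set \<Rightarrow> nat \<Rightarrow> nat \<Rightarrow> nat \<Rightarrow> bool" where
  "game D z c z' \<longleftrightarrow> (pr 0 (psnd (pfst c)) \<in> D \<longrightarrow> z' \<noteq> 0 \<and> ctl z' = z \<and>
     pr 0 (pfst (chd z')) \<in> D \<and> pr 0 (psnd (chd z')) \<in> D \<and>
     (pfst (pfst c) = 0 \<longrightarrow> pfst (chd z') = psnd (pfst c)) \<and>
     (pfst (pfst c) \<noteq> 0 \<longrightarrow> psnd (chd z') = psnd (pfst c)) \<and>
     (psub (psnd (psnd c)) z' \<longrightarrow> (test D (pfst (psnd c)) (pmap pfst (psnd (psnd c))) \<longleftrightarrow>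
        test D (pfst (psnd c)) (pmap psnd (psnd (psnd c))))))"

lemma dec_game:
  assumes D: "dec X (\<lambda>n. n \<in> D)"
  shows "dec X (\<lambda>v. game D (pfst v) (pfst (psnd v)) (psnd (psnd v)))"
  unfolding game_def psub_def test_def
  by (intro dec_intros dec_ball dec_bex dec_comp[OF D] rec_intros rec_pmap)

lemma game_iff:
  "game D z (pr (pr i x) (pr t (list_encode (map prod_encode w)))) z' \<longleftrightarrow> (pr 0 x \<in> D \<longrightarrow>
     (\<exists>y y'. z' = ccons (pr y y') z \<and> pr 0 y \<in> D \<and> pr 0 y' \<in> D \<and> (if i = 0 then y = x else y' = x) \<and>
     (set w \<subseteq> set (pairs z') \<longrightarrow>
       (test D t (list_encode (map fst w)) \<longleftrightarrow> test D t (list_encode (map snd w))))))"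
proof -
  have "z' = ccons (pr (pfst (chd z')) (psnd (chd z'))) (ctl z')" if "z' \<noteq> 0" for z'
    using that by (simp add: chd_def ctl_def)
  then show ?thesis
    unfolding game_def pfst_pr psnd_pr psub_iff pmap_pairs pairs_encode
    by (smt (verit, best) chd_ccons ctl_ccons nat.distinct(1) pfst_pr psnd_pr)
qed

section \<open>Tests against the atomic diagram\<close>

lemma diagram_univ: "pr 0 x \<in> diagram V A \<longleftrightarrow> x \<in> univ A"
  unfolding diagram_def by auto

lemma diagram_rel: "pr (Suc 0) (pr r (list_encode xs)) \<in> diagram V A \<longleftrightarrow>
    relar V r = Some (length xs) \<and> set xs \<subseteq> univ A \<and> irel A r xs"
  unfolding diagram_def by (auto simp: list_encode_eq)

lemma diagram_fun: "pr (Suc (Suc 0)) (pr f (list_encode xs)) \<in> diagram V A \<longleftrightarrow>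
    (\<exists>y ys. xs = y # ys \<and> y = ifun A f ys \<and> funar V f = Some (length ys) \<and> set ys \<subseteq> univ A)"
  unfolding diagram_def by (auto simp del: list_encode.simps simp: list_encode_eq numeral_2_eq_2)

lemma diagram_other: "pr (Suc (Suc (Suc i))) n \<notin> diagram V A"
  unfolding diagram_def by auto

lemma test_partial_iso:
  assumes iso: "partial_iso V A A z" and v: "set v \<subseteq> z"
  shows "test (diagram V A) t (list_encode (map fst v)) \<longleftrightarrow> test (diagram V A) t (list_encode (map snd v))"
proof (cases t)
  case 0
  have inj: "fst p = fst q \<longleftrightarrow> snd p = snd q" if "p \<in> z" "q \<in> z" for p q
    using iso that unfolding partial_iso_def by (metis prod.collapse)
  show ?thesis
  proof (cases v)
    case (Cons p v')
    then show ?thesis using 0 v inj by (cases v') (auto simp: test_def)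
  qed (use 0 in \<open>simp add: test_def ctl_def\<close>)
next
  case (Suc u)
  have U: "set (map fst v) \<subseteq> univ A" "set (map snd v) \<subseteq> univ A"
    using iso v unfolding partial_iso_def by fastforce+
  have t: "test (diagram V A) t l \<longleftrightarrow> pr (Suc (pfst u)) (pr (psnd u) l) \<in> diagram V A" for l
    by (simp add: test_def Suc)
  consider "pfst u = 0" | "pfst u = Suc 0" | i where "pfst u = Suc (Suc i)"
    by (metis not0_implies_Suc)
  then show ?thesis
  proof cases
    case 1
    then show ?thesis using iso v U unfolding t 1 diagram_rel partial_iso_def by auto
  next
    case 2
    show ?thesis
    proof (cases v)
      case (Cons p v')
      have "funar V f = Some (length v') \<Longrightarrow> (ifun A f (map fst v') = fst p) = (ifun A f (map snd v') = snd p)" for f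
        using iso v Cons unfolding partial_iso_def by (cases p) auto
      then have "funar V f = Some (length v') \<Longrightarrow> (fst p = ifun A f (map fst v')) = (snd p = ifun A f (map snd v'))" for f
        by (metis (lifting))
      then show ?thesis using U Cons unfolding t 2 diagram_fun by (simp, blast)
    qed simp
  next
    case 3
    then show ?thesis unfolding t 3 by (simp add: diagram_other)
  qed
qed

lemma partial_iso_of_test:
  assumes z: "z \<subseteq> univ A \<times> univ A" and A: "structure_of V A"
    and t: "\<And>v t. set v \<subseteq> z \<Longrightarrow> test (diagram V A) t (list_encode (map fst v)) \<longleftrightarrow>
      test (diagram V A) t (list_encode (map snd v))"
  shows "partial_iso V A A z"
proof -
  have U: "set (map fst v) \<subseteq> univ A" "set (map snd v) \<subseteq> univ A" if "set v \<subseteq> z" for v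
    using z that by fastforce+
  have t': "pr (Suc i) (pr r (list_encode (map fst v))) \<in> diagram V A \<longleftrightarrow>
      pr (Suc i) (pr r (list_encode (map snd v))) \<in> diagram V A" if "set v \<subseteq> z" for v i r
    using t[OF that, of "Suc (pr i r)"] by (simp add: test_def)
  show ?thesis
    unfolding partial_iso_def
  proof (intro HOL.conjI HOL.allI impI z)
    fix x y x' y' assume "(x, y) \<in> z \<and> (x', y') \<in> z"
    then show "x = x' \<longleftrightarrow> y = y'" using t[of "[(x, y), (x', y')]" 0] by (simp add: test_def)
  next
    fix r v assume "relar V r = Some (length v) \<and> set v \<subseteq> z"
    then show "irel A r (map fst v) = irel A r (map snd v)"
      using t'[of v 0 r] U[of v] by (simp add: diagram_rel)
  next
    fix f v x y assume *: "funar V f = Some (length v) \<and> set v \<subseteq> z \<and> (x, y) \<in> z"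
    \<comment> \<open>The diagram lists the value of a function before its arguments.\<close>
    then have "set ((x, y) # v) \<subseteq> z" by simp
    from t'[OF this, of "Suc 0" f] show "(ifun A f (map fst v) = x) = (ifun A f (map snd v) = y)"
      using * U[of v] unfolding diagram_fun by auto
  qed
qed

text \<open>If fewer than \<delta> rounds are still to be granted, say \<gamma>, then
  \<open>osuc \<gamma>\<close> is at most \<delta>, and agreement at level
  \<open>osuc \<gamma>\<close> lets \<open>tp_forth\<close> answer the challenge with agreement at
  level \<gamma>. The equality of types also makes the new position a partial isomorphism, so it
  passes every test.\<close>

lemma safe_game:
  assumes B: "is_branch V \<phi> B" and A: "model_of V (snd (B \<kappa>)) A" and d: "d \<in> univ A"
  shows "\<delta> \<le> \<kappa> \<Longrightarrow> set (pairs z) \<subseteq> univ A \<times> univ A \<Longrightarrow>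
    ltp (fst (B \<delta>)) A d (map fst (pairs z)) = ltp (fst (B \<delta>)) A d (map snd (pairs z)) \<Longrightarrow>
    safe (game (diagram V A)) \<delta> z"
proof (induction \<delta> arbitrary: z rule: less_induct)
  case (less \<delta>)
  let ?D = "diagram V A" and ?w = "pairs z"
  have U: "set (map fst ?w) \<subseteq> univ A" "set (map snd ?w) \<subseteq> univ A" using less.prems(2) by fastforce+
  note e = assignment_env[OF U(1) d] assignment_env[OF U(2) d]
  have "\<exists>z'. game ?D z c z' \<and> safe (game ?D) \<gamma> z'" if \<gamma>: "\<gamma> < \<delta>" for \<gamma> c
  proof -
    have le: "osuc \<gamma> \<le> \<delta>" "\<gamma> \<le> \<delta>" using osuc_le[OF \<gamma>] \<gamma> by simp_all
    obtain i x t w where c: "c = pr (pr i x) (pr t (list_encode (map prod_encode w)))"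
    proof (rule that)
      show "c = pr (pr (pfst (pfst c)) (psnd (pfst c)))
          (pr (pfst (psnd c)) (list_encode (map prod_encode (pairs (psnd (psnd c))))))"
        by (simp add: pairs_def comp_def)
    qed
    have eq: "ltp (fst (B \<beta>)) A d (map fst ?w) = ltp (fst (B \<beta>)) A d (map snd ?w)" if "\<beta> \<le> \<delta>" for \<beta>
      using tp_mono_eq[OF less.prems(3)[unfolded ltp_def length_map]] branch_mono[OF B that]
      unfolding ltp_def length_map by blast
    show ?thesis
    proof (cases "x \<in> univ A")
      case False
      \<comment> \<open>A challenge with a number outside the universe demands nothing, and the
        position may stay as it is.\<close>
      then have "game ?D z c z" unfolding c game_iff by (simp add: diagram_univ)
      then show ?thesis using less.IH[OF \<gamma>] less.prems(1,2) eq[OF le(2)] le(2) by fastforce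
    next
      case True
      note M = model_of_mono[OF B order.trans[OF le(1) less.prems(1)] A]
      obtain y y' where y: "y \<in> univ A" "y' \<in> univ A" "if i = 0 then y = x else y' = x"
        "ltp (fst (B \<gamma>)) A d (y # map fst ?w) = ltp (fst (B \<gamma>)) A d (y' # map snd ?w)"
      proof (cases "i = 0")
        case i: True
        obtain y' where "y' \<in> univ A"
          "ltp (fst (B \<gamma>)) A d (x # map fst ?w) = ltp (fst (B \<gamma>)) A d (y' # map snd ?w)"
          using tp_forth[OF B M e(1) M e(2) eq[OF le(1), unfolded ltp_def length_map] True]
          unfolding ltp_def env_Cons length_Cons length_map by blast
        then show ?thesis using that[of x y'] True i by simp
      next
        case i: False
        obtain y where "y \<in> univ A"
          "ltp (fst (B \<gamma>)) A d (x # map snd ?w) = ltp (fst (B \<gamma>)) A d (y # map fst ?w)"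
          using tp_forth[OF B M e(2) M e(1) eq[OF le(1), unfolded ltp_def length_map, symmetric] True]
          unfolding ltp_def env_Cons length_Cons length_map by blast
        then show ?thesis using that[of y x] True i by simp
      qed
      let ?z = "ccons (pr y y') z"
      have sub: "set (pairs ?z) \<subseteq> univ A \<times> univ A" using y(1,2) less.prems(2) by simp
      have eqz: "ltp (fst (B \<gamma>)) A d (map fst (pairs ?z)) = ltp (fst (B \<gamma>)) A d (map snd (pairs ?z))"
        using y(4) by simp
      have "test ?D t (list_encode (map fst w)) \<longleftrightarrow> test ?D t (list_encode (map snd w))"
        if "set w \<subseteq> set (pairs ?z)"
        using test_partial_iso[OF partial_iso_of_ltp[OF branch_frag_like[OF B] eqz sub] that] .
      then have "game ?D z c ?z" unfolding c game_iff diagram_univ using y(1-3) by blast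
      moreover have "safe (game ?D) \<gamma> ?z"
        using less.IH[OF \<gamma> _ sub eqz] le(2) less.prems(1) by simp
      ultimately show ?thesis by blast
    qed
  qed
  then show ?case by (subst safe.simps) blast
qed

text \<open>Equal types at level \<kappa> are equal at all lower levels, hence safe for all \<delta>
  below \<kappa>. Since \<kappa> is \<open>omega1_CK X\<close> and the game is decidable in
  \<open>X\<close>, this suffices for a set of positions closed under answers.\<close>

lemma homogeneous:
  assumes B: "is_branch V \<phi> B" and A: "model_of V (snd (B \<kappa>)) A" and d: "d \<in> univ A"
    and X: "computes X (diagram V A)" "omega1_CK X = \<kappa>"
    and w: "set w \<subseteq> univ A \<times> univ A"
      "ltp (fst (B \<kappa>)) A d (map fst w) = ltp (fst (B \<kappa>)) A d (map snd w)"
  obtains I where "bf_system V A A I" "set w \<in> I"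
proof -
  let ?D = "diagram V A" and ?z = "list_encode (map prod_encode w)"
  have "safe (game ?D) \<delta> ?z" if "\<delta> < omega1_CK X" for \<delta>
  proof (rule safe_game[OF B A d])
    show "\<delta> \<le> \<kappa>" using that X(2) by simp
    then show "ltp (fst (B \<delta>)) A d (map fst (pairs ?z)) = ltp (fst (B \<delta>)) A d (map snd (pairs ?z))"
      using tp_mono_eq[OF w(2)[unfolded ltp_def length_map]] branch_mono[OF B, of \<delta> \<kappa>]
      unfolding ltp_def length_map pairs_encode by blast
  qed (use w(1) in simp)
  with safe_below_CK[OF dec_game[OF X(1)[unfolded computes_iff_dec]]]
  obtain J where J: "?z \<in> J" "\<And>z c. z \<in> J \<Longrightarrow> \<exists>z'\<in>J. game ?D z c z'" by blast
  \<comment> \<open>A challenge from outside the universe admits any answer, so \<open>J\<close> may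
    contain stray positions. Those with pairs in the universe still answer all challenges and may be
    kept.\<close>
  let ?I = "{set (pairs z) | z. z \<in> J \<and> set (pairs z) \<subseteq> univ A \<times> univ A}"
  have step: "\<exists>y y'. insert (y, y') (set (pairs z)) \<in> ?I \<and> (if i = 0 then y = x else y' = x) \<and>
     (set v \<subseteq> insert (y, y') (set (pairs z)) \<longrightarrow>
       (test ?D t (list_encode (map fst v)) \<longleftrightarrow> test ?D t (list_encode (map snd v))))"
    if z: "z \<in> J" "set (pairs z) \<subseteq> univ A \<times> univ A" and x: "x \<in> univ A" for z x t v and i :: nat
  proof -
    obtain z' where z': "z' \<in> J" "game ?D z (pr (pr i x) (pr t (list_encode (map prod_encode v)))) z'"
      using J(2)[OF z(1)] by blast
    then obtain y y' where y: "z' = ccons (pr y y') z" "y \<in> univ A" "y' \<in> univ A"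
      "if i = 0 then y = x else y' = x" "set v \<subseteq> set (pairs z') \<longrightarrow>
       (test ?D t (list_encode (map fst v)) \<longleftrightarrow> test ?D t (list_encode (map snd v)))"
      unfolding game_iff diagram_univ using x by blast
    have s: "insert (y, y') (set (pairs z)) = set (pairs z')" unfolding y(1) pairs_ccons by simp
    have "set (pairs z') \<subseteq> univ A \<times> univ A" unfolding s[symmetric] using y(2,3) z(2) by simp
    then have "set (pairs z') \<in> ?I" using z'(1) by blast
    then show ?thesis
      using y(4,5) unfolding s[symmetric] by (intro HOL.exI[of _ y] HOL.exI[of _ y'] HOL.conjI)
  qed
  have "bf_system V A A ?I"
    unfolding bf_system_def
  proof (intro ballI HOL.conjI)
    fix I assume "I \<in> ?I"
    then obtain z where z: "I = set (pairs z)" "z \<in> J" "set (pairs z) \<subseteq> univ A \<times> univ A" by blast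
    show "partial_iso V A A I"
      unfolding z(1)
    proof (rule partial_iso_of_test[OF z(3)])
      show "structure_of V A" using A unfolding model_of_def by blast
      \<comment> \<open>A position is not tested itself, but the answer to any challenge contains
        it: challenging with \<open>d\<close> and the sublist \<open>v\<close> tests
        \<open>v\<close> one move later.\<close>
      show "test ?D t (list_encode (map fst v)) \<longleftrightarrow> test ?D t (list_encode (map snd v))"
        if "set v \<subseteq> set (pairs z)" for v t
        using step[OF z(2,3) d, of 0 v t] that by blast
    qed
    show "\<exists>y. insert (x, y) I \<in> ?I" if "x \<in> univ A" for x
      using step[OF z(2,3) that, of 0] unfolding z(1) if_P[OF refl] by blast
    show "\<exists>x. insert (x, y) I \<in> ?I" if "y \<in> univ A" for y
      using step[OF z(2,3) that, of 1 "[]" 0] unfolding z(1) if_not_P[OF one_neq_zero] by blast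
  qed
  moreover have "set w \<in> ?I" using J(1) w(1) by (force intro: HOL.exI[of _ ?z])
  ultimately show ?thesis using that by blast
qed


section \<open>Normal forms of infinitary formulas\<close>

text \<open>\<open>Sigma_in\<close> and \<open>Pi_in\<close> are syntactic shapes, and
  \<open>equiv_in\<close> inspects only sentences of such a shape. A sentence has to be replaced by
  an equivalent one, which must not acquire free variables.\<close>

definition has_form :: "vocab \<Rightarrow> (fm \<Rightarrow> bool) \<Rightarrow> fm \<Rightarrow> bool" where
  "has_form V S \<phi> \<longleftrightarrow>
     (\<exists>\<psi>. S \<psi> \<and> (\<forall>M e. sat M \<psi> e = sat M \<phi> e) \<and> fv \<psi> \<subseteq> fv \<phi> \<and> wf_shape V \<psi>)"

lemma has_form_cong:
  "has_form V S \<phi> \<Longrightarrow> (\<And>M e. sat M \<phi> e = sat M \<phi>' e) \<Longrightarrow> fv \<phi> \<subseteq> fv \<phi>' \<Longrightarrow> has_form V S \<phi>'"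
  unfolding has_form_def by (metis subset_trans)

lemma has_form_self: "S \<phi> \<Longrightarrow> wf_shape V \<phi> \<Longrightarrow> has_form V S \<phi>"
  unfolding has_form_def by blast

lemma has_form_members:
  assumes "\<And>\<chi>. \<chi> \<in> rcset F \<Longrightarrow> \<exists>\<alpha><b. has_form V (S \<alpha>) \<chi>"
  obtains G f where "rcset G = f ` rcset F" "\<And>\<chi>. \<chi> \<in> rcset F \<Longrightarrow> (\<exists>\<alpha><b. S \<alpha> (f \<chi>)) \<and>
    (\<forall>M e. sat M (f \<chi>) e = sat M \<chi> e) \<and> fv (f \<chi>) \<subseteq> fv \<chi> \<and> wf_shape V (f \<chi>)"
proof -
  have "\<forall>\<chi>\<in>rcset F. \<exists>\<psi>. (\<exists>\<alpha><b. S \<alpha> \<psi>) \<and> (\<forall>M e. sat M \<psi> e = sat M \<chi> e) \<and> fv \<psi> \<subseteq> fv \<chi> \<and> wf_shape V \<psi>"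
    using assms unfolding has_form_def by blast
  then obtain f where "\<forall>\<chi>\<in>rcset F. (\<exists>\<alpha><b. S \<alpha> (f \<chi>)) \<and>
    (\<forall>M e. sat M (f \<chi>) e = sat M \<chi> e) \<and> fv (f \<chi>) \<subseteq> fv \<chi> \<and> wf_shape V (f \<chi>)"
    by (rule bchoice[THEN HOL.exE])
  then show ?thesis using that[of "cimage f F" f] by (simp add: cimage.rep_eq)
qed

lemma has_form_CConj:
  assumes "0 < b" and F: "\<And>\<chi>. \<chi> \<in> rcset F \<Longrightarrow> \<exists>\<alpha><b. has_form V (Sigma_in \<alpha>) \<chi>"
  shows "has_form V (Pi_in b) (CConj F)"
proof -
  obtain G f where G: "rcset G = f ` rcset F" "\<And>\<chi>. \<chi> \<in> rcset F \<Longrightarrow> (\<exists>\<alpha><b. Sigma_in \<alpha> (f \<chi>)) \<and>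
    (\<forall>M e. sat M (f \<chi>) e = sat M \<chi> e) \<and> fv (f \<chi>) \<subseteq> fv \<chi> \<and> wf_shape V (f \<chi>)"
    using has_form_members[of F b V Sigma_in] F by metis
  have "Pi_in b (CConj G)"
  proof (rule Sigma_in_Pi_in.intros(4)[OF assms(1)])
    fix \<chi> assume "\<chi> \<in> rcset G"
    then obtain \<alpha> where "\<alpha> < b" "Sigma_in \<alpha> \<chi>" using G(2) unfolding G(1) by blast
    then show "\<exists>k \<beta> \<psi>. \<beta> < b \<and> Sigma_in \<beta> \<psi> \<and> \<chi> = (All ^^ k) \<psi>"
      by (intro HOL.exI[of _ 0] HOL.exI[of _ \<alpha>] HOL.exI[of _ \<chi>]) simp
  qed
  moreover have "fv (CConj G) \<subseteq> fv (CConj F)" using G by (fastforce simp: cimage.rep_eq)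
  ultimately show ?thesis
    unfolding has_form_def using G by (intro HOL.exI[of _ "CConj G"]) (simp add: sat_CConj wf_shape_CConj del: sat.simps wf_shape.simps fv.simps)
qed

lemma has_form_CDisj:
  assumes "0 < b" and F: "\<And>\<chi>. \<chi> \<in> rcset F \<Longrightarrow> \<exists>\<alpha><b. has_form V (Pi_in \<alpha>) \<chi>"
  shows "has_form V (Sigma_in b) (CDisj F)"
proof -
  obtain G f where G: "rcset G = f ` rcset F" "\<And>\<chi>. \<chi> \<in> rcset F \<Longrightarrow> (\<exists>\<alpha><b. Pi_in \<alpha> (f \<chi>)) \<and>
    (\<forall>M e. sat M (f \<chi>) e = sat M \<chi> e) \<and> fv (f \<chi>) \<subseteq> fv \<chi> \<and> wf_shape V (f \<chi>)"
    using has_form_members[of F b V Pi_in] F by metis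
  have "Sigma_in b (CDisj G)"
  proof (rule Sigma_in_Pi_in.intros(3)[OF assms(1)])
    fix \<chi> assume "\<chi> \<in> rcset G"
    then obtain \<alpha> where "\<alpha> < b" "Pi_in \<alpha> \<chi>" using G(2) unfolding G(1) by blast
    then show "\<exists>k \<beta> \<psi>. \<beta> < b \<and> Pi_in \<beta> \<psi> \<and> \<chi> = (Ex ^^ k) \<psi>"
      by (intro HOL.exI[of _ 0] HOL.exI[of _ \<alpha>] HOL.exI[of _ \<chi>]) simp
  qed
  moreover have "fv (CDisj G) \<subseteq> fv (CDisj F)" using G by (fastforce simp: cimage.rep_eq)
  ultimately show ?thesis
    unfolding has_form_def using G by (intro HOL.exI[of _ "CDisj G"]) (simp add: sat_CDisj wf_shape_CDisj del: sat.simps wf_shape.simps fv.simps)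
qed

lemma rcset_single: "rcset (acset {x}) = {x}"
  by (simp add: rcset_acset)

lemma has_form_Pi:
  assumes "has_form V (Sigma_in \<alpha>) \<phi>" "\<alpha> < b" shows "has_form V (Pi_in b) \<phi>"
proof (rule has_form_cong[of V _ "CConj (acset {\<phi>})"])
  have "0 < b" using assms(2) zero_le_omega1[of \<alpha>] by simp
  then show "has_form V (Pi_in b) (CConj (acset {\<phi>}))"
    using assms by (intro has_form_CConj) (auto simp: rcset_single)
qed (simp_all add: cimage.rep_eq rcset_single)

lemma has_form_Sigma:
  assumes "has_form V (Pi_in \<alpha>) \<phi>" "\<alpha> < b" shows "has_form V (Sigma_in b) \<phi>"
proof (rule has_form_cong[of V _ "CDisj (acset {\<phi>})"])
  have "0 < b" using assms(2) zero_le_omega1[of \<alpha>] by simp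
  then show "has_form V (Sigma_in b) (CDisj (acset {\<phi>}))"
    using assms by (intro has_form_CDisj) (auto simp: rcset_single)
qed (simp_all add: cimage.rep_eq rcset_single)

lemma has_form_Ex:
  assumes "has_form V (Pi_in \<alpha>) \<phi>" "\<alpha> < b" shows "has_form V (Sigma_in b) (Ex \<phi>)"
proof -
  obtain \<psi> where \<psi>: "Pi_in \<alpha> \<psi>" "\<And>M e. sat M \<psi> e = sat M \<phi> e" "fv \<psi> \<subseteq> fv \<phi>" "wf_shape V \<psi>"
    using assms(1) unfolding has_form_def by blast
  have "0 < b" using assms(2) zero_le_omega1[of \<alpha>] by simp
  then have "Sigma_in b (CDisj (acset {Ex \<psi>}))"
  proof (rule Sigma_in_Pi_in.intros(3))
    fix \<chi> assume "\<chi> \<in> rcset (acset {Ex \<psi>})"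
    then show "\<exists>k \<beta> \<psi>. \<beta> < b \<and> Pi_in \<beta> \<psi> \<and> \<chi> = (Ex ^^ k) \<psi>"
      using \<psi>(1) assms(2) by (intro HOL.exI[of _ 1] HOL.exI[of _ \<alpha>] HOL.exI[of _ \<psi>]) (simp add: rcset_single)
  qed
  then show ?thesis unfolding has_form_def
    by (intro HOL.exI[of _ "CDisj (acset {Ex \<psi>})"]) (use \<psi>(2-4) in \<open>auto simp: cimage.rep_eq rcset_single\<close>)
qed

lemma has_form_All:
  assumes "has_form V (Sigma_in \<alpha>) \<phi>" "\<alpha> < b" shows "has_form V (Pi_in b) (All \<phi>)"
proof -
  obtain \<psi> where \<psi>: "Sigma_in \<alpha> \<psi>" "\<And>M e. sat M \<psi> e = sat M \<phi> e" "fv \<psi> \<subseteq> fv \<phi>" "wf_shape V \<psi>"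
    using assms(1) unfolding has_form_def by blast
  have "0 < b" using assms(2) zero_le_omega1[of \<alpha>] by simp
  then have "Pi_in b (CConj (acset {All \<psi>}))"
  proof (rule Sigma_in_Pi_in.intros(4))
    fix \<chi> assume "\<chi> \<in> rcset (acset {All \<psi>})"
    then show "\<exists>k \<beta> \<psi>. \<beta> < b \<and> Sigma_in \<beta> \<psi> \<and> \<chi> = (All ^^ k) \<psi>"
      using \<psi>(1) assms(2) by (intro HOL.exI[of _ 1] HOL.exI[of _ \<alpha>] HOL.exI[of _ \<psi>]) (simp add: rcset_single)
  qed
  then show ?thesis unfolding has_form_def
    by (intro HOL.exI[of _ "CConj (acset {All \<psi>})"]) (use \<psi>(2-4) in \<open>auto simp: cimage.rep_eq rcset_single\<close>)
qed

text \<open>With both shapes at one level, a formula can be a member of a conjunction or of a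
  disjunction alike, and its level can be raised at will.\<close>

definition nf :: "vocab \<Rightarrow> omega1 \<Rightarrow> fm \<Rightarrow> bool" where
  "nf V \<alpha> \<phi> \<longleftrightarrow> has_form V (Sigma_in \<alpha>) \<phi> \<and> has_form V (Pi_in \<alpha>) \<phi>"

lemma nf_mono: "nf V \<alpha> \<phi> \<Longrightarrow> \<alpha> \<le> \<beta> \<Longrightarrow> nf V \<beta> \<phi>"
  unfolding nf_def using has_form_Pi has_form_Sigma by (metis order_le_less)

lemma nf_cong:
  "nf V \<alpha> \<phi> \<Longrightarrow> (\<And>M e. sat M \<phi> e = sat M \<phi>' e) \<Longrightarrow> fv \<phi> \<subseteq> fv \<phi>' \<Longrightarrow> nf V \<alpha> \<phi>'"
  unfolding nf_def using has_form_cong by metis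

text \<open>The first successor gives the existential shape; the second leaves room to wrap it into
  a singleton conjunction.\<close>

lemma nf_Ex: "nf V \<alpha> \<phi> \<Longrightarrow> nf V (osuc (osuc \<alpha>)) (Ex \<phi>)"
  unfolding nf_def using has_form_Ex[of V \<alpha> \<phi>] has_form_Pi[of V "osuc \<alpha>"] osuc_greater
  by (meson less_trans)

lemma nf_All: "nf V \<alpha> \<phi> \<Longrightarrow> nf V (osuc (osuc \<alpha>)) (All \<phi>)"
  unfolding nf_def using has_form_All[of V \<alpha> \<phi>] has_form_Sigma[of V "osuc \<alpha>"] osuc_greater
  by (meson less_trans)

text \<open>Regularity of \<open>omega1\<close> gives a common bound for the levels of the members.
  Above it the conjunction has the shape \<open>Pi_in\<close> and the disjunction the shape
  \<open>Sigma_in\<close>; one level higher the other shape is obtained by a singleton.\<close>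

lemma nf_Conn:
  assumes "\<And>\<chi>. \<chi> \<in> rcset F \<Longrightarrow> \<exists>\<alpha>. nf V \<alpha> \<chi>"
  shows "\<exists>\<alpha>. nf V \<alpha> (CConj F)" "\<exists>\<alpha>. nf V \<alpha> (CDisj F)"
proof -
  obtain f where f: "\<And>\<chi>. \<chi> \<in> rcset F \<Longrightarrow> nf V (f \<chi>) \<chi>" using assms by metis
  have "countable (f ` rcset F)" using rcset[of F] by simp
  then obtain b where b: "\<And>\<chi>. \<chi> \<in> rcset F \<Longrightarrow> f \<chi> < b"
    using countable_bounded_omega1 by (metis imageI)
  let ?c = "osuc b"
  have c: "0 < ?c" "\<And>\<chi>. \<chi> \<in> rcset F \<Longrightarrow> f \<chi> < ?c" "0 < osuc ?c" "\<And>\<chi>. \<chi> \<in> rcset F \<Longrightarrow> f \<chi> < osuc ?c"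
    "?c < osuc ?c"
    using b osuc_greater zero_le_omega1 by (meson le_less_trans less_trans)+
  have "has_form V (Pi_in d) (CConj F)" "has_form V (Sigma_in d) (CDisj F)"
    if "0 < d" "\<And>\<chi>. \<chi> \<in> rcset F \<Longrightarrow> f \<chi> < d" for d
    using that f unfolding nf_def by (blast intro: has_form_CConj has_form_CDisj)+
  note this[OF c(1,2)] this[OF c(3,4)]
  then show "\<exists>\<alpha>. nf V \<alpha> (CConj F)" "\<exists>\<alpha>. nf V \<alpha> (CDisj F)"
    using has_form_Pi[OF _ c(5)] has_form_Sigma[OF _ c(5)] unfolding nf_def by blast+
qed

text \<open>The shapes allow negation only at level 0. A formula and its negation are therefore
  normalized together, moving negations inwards by duality.\<close>

lemma nf_exists: "wf_shape V \<phi> \<Longrightarrow> (\<exists>\<alpha>. nf V \<alpha> \<phi>) \<and> (\<exists>\<alpha>. nf V \<alpha> (Neg \<phi>))"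
proof (induction \<phi>)
  case (Eq s t)
  have "nf V 0 (Eq s t)" "nf V 0 (Neg (Eq s t))"
    unfolding nf_def using Eq by (auto intro!: has_form_self Sigma_in_Pi_in.intros(1,2) fin_qf.intros)
  then show ?case by blast
next
  case (Rel r ts)
  have "nf V 0 (Rel r ts)" "nf V 0 (Neg (Rel r ts))"
    unfolding nf_def using Rel by (auto intro!: has_form_self Sigma_in_Pi_in.intros(1,2) fin_qf.intros)
  then show ?case by blast
next
  case (Neg \<phi>)
  then show ?case using nf_cong[of V _ \<phi> "Neg (Neg \<phi>)"] by auto
next
  case (CConj F)
  then have F: "\<exists>\<alpha>. nf V \<alpha> \<chi>" "\<exists>\<alpha>. nf V \<alpha> (Neg \<chi>)" if "\<chi> \<in> rcset F" for \<chi>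
    using that unfolding wf_shape_CConj by blast+
  obtain \<alpha> where "nf V \<alpha> (CDisj (cimage Neg F))"
    using nf_Conn(2)[of "cimage Neg F" V] F(2) by (auto simp: cimage.rep_eq)
  then have "nf V \<alpha> (Neg (CConj F))"
    by (rule nf_cong) (auto simp: cimage.rep_eq)
  then show ?case using nf_Conn(1)[OF F(1)] by blast
next
  case (CDisj F)
  then have F: "\<exists>\<alpha>. nf V \<alpha> \<chi>" "\<exists>\<alpha>. nf V \<alpha> (Neg \<chi>)" if "\<chi> \<in> rcset F" for \<chi>
    using that unfolding wf_shape_CDisj by blast+
  obtain \<alpha> where "nf V \<alpha> (CConj (cimage Neg F))"
    using nf_Conn(1)[of "cimage Neg F" V] F(2) by (auto simp: cimage.rep_eq)
  then have "nf V \<alpha> (Neg (CDisj F))"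
    by (rule nf_cong) (auto simp: cimage.rep_eq)
  then show ?case using nf_Conn(2)[OF F(1)] by blast
next
  case (Ex \<phi>)
  then obtain \<alpha> \<beta> where "nf V \<alpha> \<phi>" "nf V \<beta> (Neg \<phi>)" by auto
  then have "nf V (osuc (osuc \<alpha>)) (Ex \<phi>)" "nf V (osuc (osuc \<beta>)) (All (Neg \<phi>))" using nf_Ex nf_All by blast+
  moreover from this(2) have "nf V (osuc (osuc \<beta>)) (Neg (Ex \<phi>))" by (rule nf_cong) auto
  ultimately show ?case by blast
next
  case (All \<phi>)
  then obtain \<alpha> \<beta> where "nf V \<alpha> \<phi>" "nf V \<beta> (Neg \<phi>)" by auto
  then have "nf V (osuc (osuc \<alpha>)) (All \<phi>)" "nf V (osuc (osuc \<beta>)) (Ex (Neg \<phi>))" using nf_Ex nf_All by blast+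
  moreover from this(2) have "nf V (osuc (osuc \<beta>)) (Neg (All \<phi>))" by (rule nf_cong) auto
  ultimately show ?case by blast
qed


section \<open>The fiber and its traces\<close>

text \<open>Lifted formulas do not mention variable 0, so they express in the longer tuple what
  holds of the shorter one.\<close>

lemma ltp_tail:
  assumes L: "frag_like V L" and eq: "ltp L A d (x # xs) = ltp L A' d' (y # ys)"
    and len: "length xs = length ys"
  shows "ltp L A d xs = ltp L A' d' ys"
proof -
  have "sat A \<psi> (env d xs) \<longleftrightarrow> sat A' \<psi> (env d' ys)" if \<psi>: "\<psi> \<in> formulas_in L (length ys)" for \<psi>
  proof -
    have "lift_fm \<psi> \<in> L" unfolding lift_fm_def
      by (rule frag_likeD(7)[OF L]) (use \<psi> in \<open>simp_all add: formulas_in_def\<close>)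
    moreover have "fv (lift_fm \<psi>) \<subseteq> {..<Suc (length ys)}"
      using fv_subst[of \<psi> "\<lambda>i. Var (Suc i)"] \<psi> unfolding lift_fm_def formulas_in_def by fastforce
    ultimately have "sat A (lift_fm \<psi>) (env d (x # xs)) \<longleftrightarrow> sat A' (lift_fm \<psi>) (env d' (y # ys))"
      using tp_eq_sat[OF eq[unfolded ltp_def length_Cons len]] by blast
    then show ?thesis unfolding env_Cons sat_lift .
  qed
  then show ?thesis unfolding ltp_def tp_def len by blast
qed

text \<open>In the principal case the existential closure of the generator holds in \<open>A\<close>
  and is decided by the theory, so it holds in \<open>A'\<close> too. The bound on \<open>n\<close>
  matches \<open>nonprincipal_types\<close>, which collects types in at least one variable.\<close>

lemma realize_type:
  assumes B: "is_branch V \<phi> B" and A: "model_of V (snd (B \<kappa>)) A" and A': "model_of V (snd (B \<kappa>)) A'"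
    and sub: "trace V B \<kappa> A \<subseteq> trace V B \<kappa> A'" and e: "assignment A e" and n: "1 \<le> n"
  obtains e' where "assignment A' e'" "tp (fst (B \<kappa>)) A n e = tp (fst (B \<kappa>)) A' n e'"
proof (cases "principal V (snd (B \<kappa>)) (tp (fst (B \<kappa>)) A n e)")
  case True
  note L = branch_frag_like[OF B, of \<kappa>]
  obtain \<psi> where \<psi>: "\<psi> \<in> tp (fst (B \<kappa>)) A n e"
    "\<And>A' e'. model_of V (snd (B \<kappa>)) A' \<Longrightarrow> assignment A' e' \<Longrightarrow> sat A' \<psi> e' \<Longrightarrow>
      tp (fst (B \<kappa>)) A n e = tp (fst (B \<kappa>)) A' n e'"
    using principal_tp[OF L True] by blast
  have \<psi>': "\<psi> \<in> fst (B \<kappa>)" "fv \<psi> \<subseteq> {..<n}" "sat A \<psi> e"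
    using \<psi>(1) unfolding tp_def formulas_in_def by auto
  let ?\<sigma> = "(Ex ^^ n) \<psi>"
  have "assignment A (\<lambda>i. e (i + n))" using e unfolding assignment_def by blast
  then have "sat A ?\<sigma> (\<lambda>i. e (i + n))" "\<not> holds A (Neg ?\<sigma>)"
    using sat_Ex_funpow[of A "\<lambda>i. e (i + n)" n \<psi>] e \<psi>'(3) unfolding holds_def by auto
  moreover have "?\<sigma> \<in> fst (B \<kappa>)" "fv ?\<sigma> = {}"
    using frag_like_Ex_funpow[OF L \<psi>'(1)] \<psi>'(2) by (auto simp: fv_Ex_funpow)
  ultimately have "?\<sigma> \<in> snd (B \<kappa>)"
    using branch_complete[OF B] A unfolding model_of_def by blast
  then have "holds A' ?\<sigma>" using A' unfolding model_of_def by blast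
  moreover obtain a where "a \<in> univ A'" using A' unfolding model_of_def structure_of_def by blast
  then have "assignment A' (\<lambda>_. a)" by (simp add: assignment_def)
  ultimately obtain e' where "assignment A' e'" "sat A' \<psi> e'"
    using sat_Ex_funpow unfolding holds_def by blast
  then show ?thesis using that \<psi>(2)[OF A'] by blast
next
  case False
  let ?p = "tp (fst (B \<kappa>)) A n e"
  note L = branch_frag_like[OF B, of \<kappa>]
  have "?p \<in> nonprincipal_types V (B \<kappa>)"
    unfolding nonprincipal_types_def using is_type_tp[OF L A e] n False by blast
  moreover have "realizes A ?p" unfolding realizes_def tp_def using e by blast
  ultimately have "realizes A' ?p" using sub unfolding trace_def by blast
  then obtain e' where e': "assignment A' e'" "\<forall>\<psi>\<in>?p. sat A' \<psi> e'" unfolding realizes_def by blast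
  then have "?p \<subseteq> tp (fst (B \<kappa>)) A' n e'" unfolding tp_def by blast
  then show ?thesis using that[OF e'(1)] tp_subset_eq[OF L] by blast
qed

text \<open>The type of \<open>x # xs\<close> is realized in \<open>A'\<close> by some tuple
  \<open>y0 # ys0\<close>, but \<open>ys0\<close> need not be \<open>ys\<close>. Both have the same
  type, so homogeneity of \<open>A'\<close> moves \<open>ys0\<close> to \<open>ys\<close>, and the
  partner of \<open>y0\<close> is the element wanted.\<close>

lemma ltp_forth:
  assumes B: "is_branch V \<phi> B" and A: "model_of V (snd (B \<kappa>)) A" and A': "model_of V (snd (B \<kappa>)) A'"
    and sub: "trace V B \<kappa> A \<subseteq> trace V B \<kappa> A'"
    and X: "computes X (diagram V A')" "omega1_CK X = \<kappa>"
    and d: "d \<in> univ A" "d' \<in> univ A'" and xs: "set xs \<subseteq> univ A" and ys: "set ys \<subseteq> univ A'"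
    and len: "length xs = length ys" and eq: "ltp (fst (B \<kappa>)) A d xs = ltp (fst (B \<kappa>)) A' d' ys"
    and x: "x \<in> univ A"
  obtains y where "y \<in> univ A'" "ltp (fst (B \<kappa>)) A d (x # xs) = ltp (fst (B \<kappa>)) A' d' (y # ys)"
proof -
  let ?L = "fst (B \<kappa>)" and ?n = "length ys"
  note L = branch_frag_like[OF B, of \<kappa>]
  obtain e' where e': "assignment A' e'" "tp ?L A (Suc ?n) (env d (x # xs)) = tp ?L A' (Suc ?n) e'"
    using realize_type[OF B A A' sub assignment_env[of "x # xs"], of d "Suc ?n"] xs x d by auto
  define y0 ys0 where "y0 = e' 0" and "ys0 = map (\<lambda>i. e' (Suc i)) [0..<?n]"
  have ys0: "y0 \<in> univ A'" "set ys0 \<subseteq> univ A'" "length ys0 = ?n"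
    using e'(1) unfolding assignment_def y0_def ys0_def by auto
  have "sat A' \<psi> e' \<longleftrightarrow> sat A' \<psi> (env d' (y0 # ys0))" if "\<psi> \<in> formulas_in ?L (Suc ?n)" for \<psi>
  proof (rule sat_cong)
    fix i assume "i \<in> fv \<psi>"
    then have "i < Suc ?n" using that unfolding formulas_in_def by auto
    then show "e' i = env d' (y0 # ys0) i"
      by (cases i) (simp_all add: env_def y0_def ys0_def)
  qed
  then have eq0: "ltp ?L A d (x # xs) = ltp ?L A' d' (y0 # ys0)"
    using e'(2) ys0(3) len unfolding ltp_def tp_def length_Cons by auto
  have "ltp ?L A' d' ys0 = ltp ?L A' d' ys"
    using ltp_tail[OF L eq0] ys0(3) len eq by simp
  then have "ltp ?L A' d' (map fst (zip ys0 ys)) = ltp ?L A' d' (map snd (zip ys0 ys))"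
    using ys0(3) by simp
  moreover have "set (zip ys0 ys) \<subseteq> univ A' \<times> univ A'"
    using ys0(2) ys by (auto dest: set_zip_leftD set_zip_rightD)
  ultimately obtain I where I: "bf_system V A' A' I" "set (zip ys0 ys) \<in> I"
    using homogeneous[OF B A' d(2) X] by blast
  obtain y where y: "insert (y0, y) (set (zip ys0 ys)) \<in> I" using bf_forth[OF I ys0(1)] by blast
  have S: "structure_of V A'" using A' unfolding model_of_def by blast
  \<comment> \<open>Homogeneity provides a whole back-and-forth system, which preserves the full
    type at level \<kappa> rather than the types at lower levels only.\<close>
  have "sat A' \<psi> (env d' (y0 # ys0)) \<longleftrightarrow> sat A' \<psi> (env d' (y # ys))"
    if \<psi>: "\<psi> \<in> formulas_in ?L (Suc ?n)" for \<psi>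
  proof (rule bf_sat[OF I(1) S S y])
    show "wf_shape V \<psi>" using frag_likeD(2)[OF L] \<psi> unfolding formulas_in_def wf_fm_def by blast
    fix i assume "i \<in> fv \<psi>"
    then have "i < Suc ?n" using \<psi> unfolding formulas_in_def by auto
    then show "(env d' (y0 # ys0) i, env d' (y # ys) i) \<in> insert (y0, y) (set (zip ys0 ys))"
      using ys0(3) by (cases i) (auto simp: env_def set_zip)
  qed
  then have "ltp ?L A' d' (y0 # ys0) = ltp ?L A' d' (y # ys)"
    using ys0(3) unfolding ltp_def tp_def length_Cons by auto
  moreover have "y \<in> univ A'" using bf_sub[OF I(1) y] by blast
  ultimately show ?thesis using that eq0 by simp
qed

text \<open>Going forth uses homogeneity of \<open>A'\<close> and so only the oracle
  \<open>X'\<close>; going back uses \<open>A\<close> and \<open>X\<close>. The oracles are never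
  joined.\<close>

lemma isomorphic_of_trace_eq:
  assumes B: "is_branch V \<phi> B" and A: "model_of V (snd (B \<kappa>)) A" and A': "model_of V (snd (B \<kappa>)) A'"
    and tr: "trace V B \<kappa> A = trace V B \<kappa> A'"
    and X: "computes X (diagram V A)" "omega1_CK X = \<kappa>"
    and X': "computes X' (diagram V A')" "omega1_CK X' = \<kappa>"
  shows "isomorphic V A A'"
proof -
  let ?L = "fst (B \<kappa>)"
  note L = branch_frag_like[OF B, of \<kappa>]
  have S: "structure_of V A" "structure_of V A'" using A A' unfolding model_of_def by blast+
  obtain d d' where d: "d \<in> univ A" "d' \<in> univ A'" using S unfolding structure_of_def by blast
  define I where "I = {set w | w. set w \<subseteq> univ A \<times> univ A' \<and> ltp ?L A d (map fst w) = ltp ?L A' d' (map snd w)}"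
  have "bf_system V A A' I"
    unfolding bf_system_def
  proof (intro ballI HOL.conjI)
    fix z assume "z \<in> I"
    then obtain w where w: "z = set w" "set w \<subseteq> univ A \<times> univ A'"
      "ltp ?L A d (map fst w) = ltp ?L A' d' (map snd w)" unfolding I_def by blast
    have U: "set (map fst w) \<subseteq> univ A" "set (map snd w) \<subseteq> univ A'" using w(2) by fastforce+
    show "partial_iso V A A' z" unfolding w(1) by (rule partial_iso_of_ltp[OF L w(3,2)])
    have ext: "insert (x, y) z \<in> I" if "x \<in> univ A" "y \<in> univ A'"
      "ltp ?L A d (x # map fst w) = ltp ?L A' d' (y # map snd w)" for x y
      unfolding I_def mem_Collect_eq using that w(1,2) by (intro HOL.exI[of _ "(x, y) # w"]) simp
    have len: "length (map fst w) = length (map snd w)" by simp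
    show "\<exists>y. insert (x, y) z \<in> I" if x: "x \<in> univ A" for x
    proof -
      obtain y where "y \<in> univ A'" "ltp ?L A d (x # map fst w) = ltp ?L A' d' (y # map snd w)"
        using ltp_forth[OF B A A' equalityD1[OF tr] X' d U len w(3) x] .
      then show ?thesis using ext[OF x] by blast
    qed
    show "\<exists>x. insert (x, y) z \<in> I" if y: "y \<in> univ A'" for y
    proof -
      obtain x where "x \<in> univ A" "ltp ?L A' d' (y # map snd w) = ltp ?L A d (x # map fst w)"
        using ltp_forth[OF B A' A equalityD2[OF tr] X d(2,1) U(2,1) len[symmetric] w(3)[symmetric] y] .
      then show ?thesis using ext[OF _ y] by auto
    qed
  qed
  moreover have "{} \<in> I"
  proof -
    \<comment> \<open>The system starts with the empty tuples, which have the same type because the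
      theory decides every sentence of its fragment.\<close>
    have "sat A \<psi> (env d []) \<longleftrightarrow> sat A' \<psi> (env d' [])" if \<psi>: "\<psi> \<in> ?L" "fv \<psi> = {}" for \<psi>
    proof -
      have e: "assignment A (env d [])" "assignment A' (env d' [])"
        using assignment_env[of "[]"] d by simp_all
      have "(\<psi> \<in> snd (B \<kappa>) \<longrightarrow> sat M \<psi> e) \<and> (Neg \<psi> \<in> snd (B \<kappa>) \<longrightarrow> \<not> sat M \<psi> e)"
        if "model_of V (snd (B \<kappa>)) M" "assignment M e" for M e
        using that unfolding model_of_def holds_def by auto
      then show ?thesis using branch_complete[OF B \<psi>] A A' e by blast
    qed
    then have "ltp ?L A d [] = ltp ?L A' d' []" unfolding ltp_def tp_def formulas_in_def by auto
    then show ?thesis unfolding I_def mem_Collect_eq by (intro HOL.exI[of _ "[]"]) simp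
  qed
  ultimately show ?thesis using bf_isomorphic S by blast
qed

section \<open>Invariance under isomorphism and passage to copies\<close>

lemma computes_self: "computes X X"
  unfolding computes_def using reval.intros(4)[of X _ "[]"] by blast

lemma isomorphic_holds:
  assumes "isomorphic V A A'" "structure_of V A" "structure_of V A'" "wf_shape V \<sigma>"
  shows "holds A \<sigma> \<longleftrightarrow> holds A' \<sigma>"
proof -
  have "holds D' \<sigma>" if iso: "isomorphic V D D'" "structure_of V D" "structure_of V D'" and h: "holds D \<sigma>" for D D'
  proof -
    obtain h where h': "bij_betw h (univ D) (univ D')" "\<And>\<phi> e. wf_shape V \<phi> \<Longrightarrow> assignment D e \<Longrightarrow>
        sat D \<phi> e \<longleftrightarrow> sat D' \<phi> (h \<circ> e)"
      using isomorphic_sat[OF iso] by blast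
    show ?thesis unfolding holds_def
    proof (intro HOL.allI impI)
      fix e assume e: "assignment D' e"
      let ?e = "inv_into (univ D) h \<circ> e"
      have "h \<circ> ?e = e" "assignment D ?e"
        using e h'(1) unfolding assignment_def bij_betw_def
        by (auto simp: fun_eq_iff f_inv_into_f inv_into_into image_subset_iff)
      then show "sat D' \<sigma> e" using h h'(2)[OF assms(4)] unfolding holds_def by metis
    qed
  qed
  from this[OF assms(1-3)] this[OF isomorphic_sym[OF assms(1,2)] assms(3,2)] show ?thesis by blast
qed

lemma realizes_mono_isomorphic:
  assumes "isomorphic V A A'" "structure_of V A" "structure_of V A'"
    and p: "\<And>\<psi>. \<psi> \<in> p \<Longrightarrow> wf_shape V \<psi>" and r: "realizes A p"
  shows "realizes A' p"
proof -
  obtain h where h: "bij_betw h (univ A) (univ A')" "\<And>\<phi> e. wf_shape V \<phi> \<Longrightarrow> assignment A e \<Longrightarrow>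
      sat A \<phi> e \<longleftrightarrow> sat A' \<phi> (h \<circ> e)"
    using isomorphic_sat[OF assms(1-3)] by blast
  obtain e where e: "assignment A e" "\<And>\<psi>. \<psi> \<in> p \<Longrightarrow> sat A \<psi> e" using r unfolding realizes_def by blast
  have "assignment A' (h \<circ> e)" using e(1) h(1) by (auto simp: assignment_def bij_betw_def)
  then show ?thesis unfolding realizes_def using h(2)[OF p e(1)] e(2) by blast
qed

lemma nonprincipal_type_subset: "p \<in> nonprincipal_types V N \<Longrightarrow> \<exists>n. p \<subseteq> formulas_in (fst N) n"
  unfolding nonprincipal_types_def is_type_def by blast

lemma trace_isomorphic:
  assumes B: "is_branch V \<phi> B" and iso: "isomorphic V A A'" and S: "structure_of V A" "structure_of V A'"
  shows "trace V B \<kappa> A = trace V B \<kappa> A'"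
proof -
  have "wf_shape V \<psi>" if "p \<in> nonprincipal_types V (B \<kappa>)" "\<psi> \<in> p" for p \<psi>
    using nonprincipal_type_subset[OF that(1)] that(2) frag_likeD(2)[OF branch_frag_like[OF B]]
    unfolding formulas_in_def wf_fm_def by blast
  then have "realizes A p \<longleftrightarrow> realizes A' p" if "p \<in> nonprincipal_types V (B \<kappa>)" for p
    using that realizes_mono_isomorphic[OF iso S] realizes_mono_isomorphic[OF isomorphic_sym[OF iso S(1)] S(2,1)]
    by blast
  then show ?thesis unfolding trace_def by blast
qed

lemma branch_theory_subset:
  assumes B: "is_branch V \<phi> B" shows "snd (B \<delta>) \<subseteq> fst (B \<delta>)"
proof (induction \<delta> rule: less_induct)
  case (less \<delta>)
  consider "\<delta> = 0" | \<beta> where "\<delta> = osuc \<beta>" | "islim \<delta>" by (rule omega1_cases)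
  then show ?case
  proof cases
    case 1
    then show ?thesis using branch_root[OF B]
      unfolding root_node_def omega_complete_def sentences_def by blast
  next
    case (2 \<beta>)
    then show ?thesis using branch_child[OF B, of \<beta>]
      unfolding child_node_def omega_complete_def sentences_def by blast
  next
    case 3
    then show ?thesis using less.IH unfolding branch_lim[OF B 3] fst_conv snd_conv by blast
  qed
qed

text \<open>The minimum in \<open>omega1_of\<close> is attained: it ranges over a nonempty set,
  since the diagram of M computes itself.\<close>

lemma fiber_copy:
  assumes B: "is_branch V \<phi> B" and M: "M \<in> fiber V B \<kappa>"
  obtains A X where "isomorphic V M A" "model_of V (snd (B \<kappa>)) A"
    "computes X (diagram V A)" "omega1_CK X = \<kappa>"
proof -
  let ?P = "\<lambda>\<alpha>. \<exists>X A. structure_of V A \<and> isomorphic V M A \<and> computes X (diagram V A) \<and> omega1_CK X = \<alpha>"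
  have MM: "model_of V (snd (B \<kappa>)) M" and \<kappa>: "\<kappa> = (LEAST \<alpha>. ?P \<alpha>)"
    using M unfolding fiber_def omega1_of_def by auto
  have S: "structure_of V M" using MM unfolding model_of_def by blast
  then have "?P (omega1_CK (diagram V M))" using isomorphic_refl computes_self by blast
  then have "?P \<kappa>" unfolding \<kappa> by (rule LeastI[of ?P])
  then obtain X A where A: "structure_of V A" "isomorphic V M A" "computes X (diagram V A)" "omega1_CK X = \<kappa>"
    by blast
  have "wf_shape V \<sigma>" if "\<sigma> \<in> snd (B \<kappa>)" for \<sigma>
    using branch_theory_subset[OF B] frag_likeD(2)[OF branch_frag_like[OF B]] that unfolding wf_fm_def by blast
  then have "model_of V (snd (B \<kappa>)) A"
    using MM A(1) isomorphic_holds[OF A(2) S A(1)] unfolding model_of_def by blast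
  then show ?thesis using that A by blast
qed

text \<open>Members of the fiber need not themselves be computed by an oracle suited to \<kappa>,
  but some copy of each is. Traces do not change under the passage to copies.\<close>

lemma fiber_isomorphic:
  assumes B: "is_branch V \<phi> B" and M: "M \<in> fiber V B \<kappa>" and M': "M' \<in> fiber V B \<kappa>"
    and tr: "trace V B \<kappa> M = trace V B \<kappa> M'"
  shows "isomorphic V M M'"
proof -
  obtain A X where A: "isomorphic V M A" "model_of V (snd (B \<kappa>)) A"
    "computes X (diagram V A)" "omega1_CK X = \<kappa>" using fiber_copy[OF B M] by blast
  obtain A' X' where A': "isomorphic V M' A'" "model_of V (snd (B \<kappa>)) A'"
    "computes X' (diagram V A')" "omega1_CK X' = \<kappa>" using fiber_copy[OF B M'] by blast
  have S: "structure_of V M" "structure_of V M'" "structure_of V A" "structure_of V A'"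
    using M M' A(2) A'(2) unfolding fiber_def model_of_def by blast+
  have "trace V B \<kappa> A = trace V B \<kappa> A'"
    using trace_isomorphic[OF B A(1) S(1,3)] trace_isomorphic[OF B A'(1) S(2,4)] tr by simp
  then have "isomorphic V A A'"
    using isomorphic_of_trace_eq[OF B A(2) A'(2) _ A(3,4) A'(3,4)] by blast
  then show ?thesis
    using isomorphic_trans[OF A(1) isomorphic_trans[OF _ isomorphic_sym[OF A'(1) S(2)]]] by blast
qed

text \<open>Realizing a type is expressed by a single infinitary sentence, so all of the countably many
  non-principal types are decided by one of the equivalences \<open>equiv_in\<close>.\<close>

lemma trace_determined:
  assumes B: "is_branch V \<phi> B" and N: "countable (nonprincipal_types V (B \<kappa>))"
  obtains b where "\<And>M M'. structure_of V M \<Longrightarrow> structure_of V M' \<Longrightarrow> equiv_in V b M M' \<Longrightarrow>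
    trace V B \<kappa> M = trace V B \<kappa> M'"
proof -
  let ?N = "nonprincipal_types V (B \<kappa>)"
  have "\<exists>\<theta>. wf_shape V \<theta> \<and> fv \<theta> = {} \<and> (\<forall>M. structure_of V M \<longrightarrow> (realizes M p \<longleftrightarrow> holds M \<theta>))"
    if p: "p \<in> ?N" for p
  proof -
    obtain n where n: "p \<subseteq> formulas_in (fst (B \<kappa>)) n" using nonprincipal_type_subset[OF p] by blast
    then have pL: "p \<subseteq> fst (B \<kappa>)" "\<And>\<psi>. \<psi> \<in> p \<Longrightarrow> fv \<psi> \<subseteq> {..<n}" unfolding formulas_in_def by blast+
    have cp: "countable p" using countable_subset[OF pL(1) frag_likeD(1)[OF branch_frag_like[OF B]]] .
    let ?\<theta> = "(Ex ^^ n) (CConj (acset p))"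
    have "wf_shape V ?\<theta>"
      unfolding wf_shape_Ex_funpow wf_shape_CConj rcset_acset[OF cp]
      using pL(1) frag_likeD(2)[OF branch_frag_like[OF B]] unfolding wf_fm_def by blast
    moreover have "fv (CConj (acset p)) \<subseteq> {..<n}" using pL(2) by (subst fv_CConj_subset[OF cp]) blast
    then have fv: "fv ?\<theta> = {}" unfolding fv_Ex_funpow by auto
    moreover have "realizes M p \<longleftrightarrow> holds M ?\<theta>" if M: "structure_of V M" for M
    proof -
      obtain a where a: "a \<in> univ M" using M unfolding structure_of_def by blast
      then have e0: "assignment M (\<lambda>_. a)" by (simp add: assignment_def)
      \<comment> \<open>\<open>holds\<close> quantifies over all assignments, realization asks for
        one. For a formula without free variables this makes no difference, as assignments
        exist.\<close>
      have "holds M ?\<theta> \<longleftrightarrow> sat M ?\<theta> e" if "assignment M e" for e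
        using that sat_cong[of ?\<theta> _ _ M] fv unfolding holds_def by blast
      then have "(\<exists>e. assignment M e \<and> sat M ?\<theta> e) \<longleftrightarrow> holds M ?\<theta>" using e0 by blast
      moreover have "realizes M p \<longleftrightarrow> (\<exists>e. assignment M e \<and> sat M ?\<theta> e)"
      proof
        assume "realizes M p"
        then obtain e where e: "assignment M e" "sat M (CConj (acset p)) e"
          unfolding realizes_def sat_CConj rcset_acset[OF cp] by blast
        moreover have "assignment M (\<lambda>i. e (i + n))" using e(1) unfolding assignment_def by blast
        ultimately show "\<exists>e. assignment M e \<and> sat M ?\<theta> e"
          using sat_Ex_funpow[of M "\<lambda>i. e (i + n)" n] by blast
      next
        assume "\<exists>e. assignment M e \<and> sat M ?\<theta> e"
        then show "realizes M p"
          using sat_Ex_funpow unfolding realizes_def by (metis sat_CConj rcset_acset[OF cp])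
      qed
      ultimately show ?thesis by blast
    qed
    ultimately show ?thesis by blast
  qed
  then obtain \<theta> where \<theta>: "\<And>p. p \<in> ?N \<Longrightarrow> wf_shape V (\<theta> p)" "\<And>p. p \<in> ?N \<Longrightarrow> fv (\<theta> p) = {}"
    "\<And>p M. p \<in> ?N \<Longrightarrow> structure_of V M \<Longrightarrow> realizes M p \<longleftrightarrow> holds M (\<theta> p)" by metis
  have "\<forall>p\<in>?N. \<exists>a. nf V a (\<theta> p)" using nf_exists \<theta>(1) by blast
  from bchoice[OF this] obtain r where r: "\<And>p. p \<in> ?N \<Longrightarrow> nf V (r p) (\<theta> p)" by blast
  obtain b where b: "\<And>a. a \<in> r ` ?N \<Longrightarrow> a < b"
    using countable_bounded_omega1[OF countable_image[OF N]] by blast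
  have "trace V B \<kappa> M = trace V B \<kappa> M'"
    if S: "structure_of V M" "structure_of V M'" and eq: "equiv_in V b M M'" for M M'
  proof -
    have "realizes M p \<longleftrightarrow> realizes M' p" if p: "p \<in> ?N" for p
    proof -
      have "nf V b (\<theta> p)" using nf_mono[OF r[OF p]] b p by (metis imageI less_imp_le)
      then obtain \<sigma> where \<sigma>: "Pi_in b \<sigma>" "\<And>M e. sat M \<sigma> e = sat M (\<theta> p) e" "fv \<sigma> = {}" "wf_shape V \<sigma>"
        using \<theta>(2)[OF p] unfolding nf_def has_form_def by auto
      then have "holds M \<sigma> = holds M' \<sigma>"
        using eq unfolding equiv_in_def sentence_def wf_fm_def by simp
      then show ?thesis using \<theta>(3)[OF p] S \<sigma>(2) unfolding holds_def by simp
    qed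
    then show ?thesis unfolding trace_def by blast
  qed
  then show ?thesis using that by blast
qed

text \<open>Fiber models are models of \<phi>, and on these the trace factors through the classes of
  one equivalence \<open>equiv_in V b\<close>; scatteredness makes the classes countable in
  number.\<close>

lemma countable_Spec:
  assumes B: "is_branch V \<phi> B" and N: "countable (nonprincipal_types V (B \<kappa>))"
    and scattered: "\<And>\<alpha>. countable (equiv_class V \<phi> \<alpha> ` models V \<phi>)"
  shows "countable (Spec V B \<kappa>)"
proof -
  obtain b where b: "\<And>M M'. structure_of V M \<Longrightarrow> structure_of V M' \<Longrightarrow> equiv_in V b M M' \<Longrightarrow>
    trace V B \<kappa> M = trace V B \<kappa> M'" using trace_determined[OF B N] by blast
  have fib: "M \<in> models V \<phi>" if "M \<in> fiber V B \<kappa>" for M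
    using that model_of_branch[OF B] unfolding fiber_def by blast
  let ?h = "\<lambda>K. trace V B \<kappa> (SOME M. M \<in> K)"
  have "trace V B \<kappa> M = ?h (equiv_class V \<phi> b M)" if M: "M \<in> models V \<phi>" for M
  proof -
    have "M \<in> equiv_class V \<phi> b M" using M by (simp add: equiv_class_def equiv_in_def)
    then have "(SOME M'. M' \<in> equiv_class V \<phi> b M) \<in> equiv_class V \<phi> b M" by (rule someI)
    then show ?thesis using M by (intro b) (auto simp: equiv_class_def models_def)
  qed
  then have "Spec V B \<kappa> \<subseteq> ?h ` equiv_class V \<phi> b ` models V \<phi>"
    unfolding Spec_def using fib by blast
  then show ?thesis by (rule countable_subset) (intro countable_image scattered)
qed

theorem mainTheorem6:
  fixes V :: vocab and \<phi> :: fm and B :: "omega1 \<Rightarrow> fm set \<times> fm set"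
    and C :: "omega1 set" and \<kappa> :: omega1
  assumes "minimal_counterexample V \<phi>"
    and "sacks_branch V \<phi> B"
    and "sacks_club V \<phi> B C"
    and "\<kappa> \<in> S_circ V \<phi> C"
  shows "(\<forall>M\<in>fiber V B \<kappa>. \<forall>M'\<in>fiber V B \<kappa>.
            trace V B \<kappa> M = trace V B \<kappa> M' \<longrightarrow> isomorphic V M M')
       \<and> (\<forall>M\<in>fiber V B \<kappa>. \<forall>M'\<in>fiber V B \<kappa>.
            isomorphic V M M' \<longleftrightarrow> trace V B \<kappa> M = trace V B \<kappa> M')
       \<and> countable (Spec V B \<kappa>)
       \<and> bij_betw (\<lambda>K. the_elem (trace V B \<kappa> ` K)) (iso_types V (fiber V B \<kappa>)) (Spec V B \<kappa>)"
proof -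
  let ?F = "fiber V B \<kappa>" and ?t = "trace V B \<kappa>"
  have B: "is_branch V \<phi> B" using assms(2) unfolding sacks_branch_def by blast
  have N: "countable (nonprincipal_types V (B \<kappa>))"
    using assms(3,4) unfolding sacks_club_def S_circ_def by blast
  have sc: "\<And>\<alpha>. countable (equiv_class V \<phi> \<alpha> ` models V \<phi>)"
    using assms(1) unfolding minimal_counterexample_def by blast
  have S: "structure_of V M" if "M \<in> ?F" for M using that unfolding fiber_def model_of_def by blast
  have iff: "isomorphic V M M' \<longleftrightarrow> ?t M = ?t M'" if "M \<in> ?F" "M' \<in> ?F" for M M'
    using fiber_isomorphic[OF B that] trace_isomorphic[OF B _ S[OF that(1)] S[OF that(2)]] by blast
  let ?R = "{(M, N). M \<in> ?F \<and> N \<in> ?F \<and> isomorphic V M N}" and ?f = "\<lambda>K. the_elem (?t ` K)"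
  \<comment> \<open>Isomorphism classes within the fiber are the level sets of the trace. So the
    trace maps a class to a singleton, from which \<open>the_elem\<close> extracts the common
    value.\<close>
  have cl: "?R `` {M} = {M' \<in> ?F. ?t M' = ?t M}" if "M \<in> ?F" for M
    using that iff[OF that] by (auto simp: Image_iff)
  have f: "?f (?R `` {M}) = ?t M" if "M \<in> ?F" for M
  proof -
    have "?t ` (?R `` {M}) = {?t M}" unfolding cl[OF that] using that by auto
    then show ?thesis by simp
  qed
  have "bij_betw ?f (iso_types V ?F) (Spec V B \<kappa>)"
    unfolding bij_betw_def
  proof
    show "inj_on ?f (iso_types V ?F)"
    proof (rule inj_onI)
      fix K K' assume "K \<in> iso_types V ?F" "K' \<in> iso_types V ?F" and eq: "?f K = ?f K'"
      then obtain M M' where M: "M \<in> ?F" "K = ?R `` {M}" "M' \<in> ?F" "K' = ?R `` {M'}"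
        unfolding iso_types_def by (auto elim!: quotientE)
      then have "?t M = ?t M'" using eq f by simp
      then show "K = K'" unfolding M(2,4) cl[OF M(1)] cl[OF M(3)] by simp
    qed
    have "?f ` iso_types V ?F = (\<lambda>M. ?f (?R `` {M})) ` ?F"
      unfolding iso_types_def quotient_def by blast
    also have "\<dots> = Spec V B \<kappa>" unfolding Spec_def using f by (rule image_cong[OF refl])
    finally show "?f ` iso_types V ?F = Spec V B \<kappa>" .
  qed
  then show ?thesis using iff countable_Spec[OF B N sc] by blast
qed

end
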